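(* The rules of the Clifford ZX-calculus together with the S4 rule are complete for CNOT+T circuits: if $U$ and $V$ are quantum circuits on the same number of qubits built from CNOT and $T$ gates, regarded as ZX-diagrams, and $\llbracket U\rrbracket=\llbracket V\rrbracket$ (up to a nonzero scalar), then $U$ can be transformed into $V$ using only the rules of the Clifford ZX-calculus and the S4 rule.
   Context: ZX-diagrams are built by composition and tensor product from: Z-spiders with $m$ inputs, $n$ outputs and phase $\alpha\in\mathbb R$ (mod $2\pi$), denoting $|0\rangle^{\otimes n}\langle 0|^{\otimes m}+e^{i\alpha}|1\rangle^{\otimes n}\langle 1|^{\otimes m}$; X-spiders, denoting $|+\rangle^{\otimes n}\langle +|^{\otimes m}+e^{i\alpha}|-\rangle^{\otimes n}\langle -|^{\otimes m}$; the Hadamard box $H$; identity wires, swaps, cups $\sum_i|ii\rangle$ and caps $\sum_i\langle ii|$. An omitted phase is $0$. $\llbracket D\rrbracket$ is the linear map denoted by $D$. Only connectivity matters: diagrams with the same underlying labelled open graph are identified. All equations are taken up to nonzero scalar factors (so diagrams with no inputs and outputs denoting a nonzero number may be freely added or removed). A diagram can be transformed into another if this can be done by a finite sequence of applications, in either direction and to any subdiagram, of the rules. Clifford ZX-calculus rules (for all phases $\alpha,\beta$ and all numbers of legs; each also holds with colours Z/X exchanged): - spider fusion: two Z-spiders with phases $\alpha,\beta$ joined by one or more wires equal one Z-spider with phase $\alpha+\beta$ carrying the remaining legs; - colour change: a Z-spider of phase $\alpha$ with an $H$ on every leg equals the X-spider of phase $\alpha$ with the same legs; - $\pi$-copy: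 a Z-spider of phase $\alpha$ with a 2-legged X-spider of phase $\pi$ on every input equals the Z-spider of phase $-\alpha$ with a 2-legged X-spider of phase $\pi$ on every output; - strong complementarity: an X-spider of phase 0 with $m$ inputs, connected by one wire to a Z-spider of phase 0 with $n$ outputs, equals the diagram with one phase-0 Z-spider on each of the $m$ inputs and one phase-0 X-spider on each of the $n$ outputs, each Z-spider being connected to each X-spider by one wire; - identity: a 2-legged spider of phase 0 is a wire; - $H$-cancellation: $H$ followed by $H$ is a wire; - Euler decomposition: $H$ equals the composite of 2-legged spiders Z$(\frac\pi2)$, X$(\frac\pi2)$, Z$(\frac\pi2)$. Spider-nest maps: $s_n$ is a ZX-diagram with 1 input and $n$ outputs, defined inductively. $s_0$ is the Z-spider of phase $\frac\pi4$ with one input and no outputs. $s_n$ ($n\ge1$) is: the input goes into a phase-0 Z-spider with two outputs; the first output is the input of a copy of $s_{n-1}$; the second goes into a phase-0 3-legged X-spider, whose other two legs are the input of a second copy of $s_{n-1}$ and the $n$-th output wire of $s_n$; for each $1\le j\le n-1$, the $j$-th outputs of the two copies of $s_{n-1}$ are merged by a phase-0 3-legged Z-spider whose remaining leg is the $j$-th output of $s_n$. S4 rule: $s_4$ equals the disconnected diagram consisting of a phase-0 Z-spider with one leg on the input wire and a phase-0 Z-spider with one leg on each of the four output wires. Circuits as ZX-diagrams: the gate $T=\mathrm{diag}(1,e^{i\pi/4})$ is the 2-legged Z-spider of phase $\frac\pi4$; the CNOT gate is a phase-0 3-legged Z-spider on the control wire joined by a wire to a phase-0 3-legged X-spider on the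 target wire (equal to CNOT up to a nonzero scalar). *)

theory Defs
  imports Complex_Main "HOL-Library.Multiset" "HOL-Library.Real_Mod"
begin

section \<open>ZX-diagrams\<close>

datatype colour = Z | X

primrec opp :: "colour \<Rightarrow> colour" where
  "opp Z = X"
| "opp X = Z"

text \<open>
  \<open>Spider c m n \<alpha>\<close> has \<open>m\<close> inputs, \<open>n\<close> outputs and phase \<open>\<alpha>\<close>. Composition is in diagrammatic
  order: in \<open>D ;; E\<close> the outputs of \<open>D\<close> are plugged into the inputs of \<open>E\<close>. \<open>Wires n\<close> consists of
  \<open>n\<close> parallel identity wires; in particular \<open>Wires 0\<close> is the empty diagram.
\<close>

datatype zx =
    Spider colour nat nat real
  | Hadamard
  | Wires nat
  | Swap
  | Cup
  | Cap
  | Comp zx zx  (infixl \<open>;;\<close> 60)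
  | Tensor zx zx  (infixr \<open>\<otimes>\<close> 70)

primrec ins :: "zx \<Rightarrow> nat" where
  "ins (Spider c m n \<alpha>) = m"
| "ins Hadamard = 1"
| "ins (Wires n) = n"
| "ins Swap = 2"
| "ins Cup = 0"
| "ins Cap = 2"
| "ins (D ;; E) = ins D"
| "ins (D \<otimes> E) = ins D + ins E"

primrec outs :: "zx \<Rightarrow> nat" where
  "outs (Spider c m n \<alpha>) = n"
| "outs Hadamard = 1"
| "outs (Wires n) = n"
| "outs Swap = 2"
| "outs Cup = 2"
| "outs Cap = 0"
| "outs (D ;; E) = outs E"
| "outs (D \<otimes> E) = outs D + outs E"

primrec wf_zx :: "zx \<Rightarrow> bool" where
  "wf_zx (Spider c m n \<alpha>) = True"
| "wf_zx Hadamard = True"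
| "wf_zx (Wires n) = True"
| "wf_zx Swap = True"
| "wf_zx Cup = True"
| "wf_zx Cap = True"
| "wf_zx (D ;; E) = (wf_zx D \<and> wf_zx E \<and> outs D = ins E)"
| "wf_zx (D \<otimes> E) = (wf_zx D \<and> wf_zx E)"

primrec tensor_power :: "nat \<Rightarrow> zx \<Rightarrow> zx" where
  "tensor_power 0 D = Wires 0"
| "tensor_power (Suc k) D = D \<otimes> tensor_power k D"


section \<open>The linear map denoted by a diagram\<close>

text \<open>
  The computational basis of the state space of \<open>n\<close> qubits is indexed by the bit strings of
  length \<open>n\<close>, and a linear map is given by its matrix entries: \<open>interp D x y\<close> is
  \<open>\<langle>y|D|x\<rangle>\<close>. Only the values at \<open>length x = ins D\<close> and \<open>length y = outs D\<close> are meaningful.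

  \<open>basis_ket c False\<close> and \<open>basis_ket c True\<close> are \<open>|0\<rangle>, |1\<rangle>\<close> for \<open>c = Z\<close> and \<open>|+\<rangle>, |-\<rangle>\<close> for
  \<open>c = X\<close>, as functions of the bit.
\<close>

fun basis_ket :: "colour \<Rightarrow> bool \<Rightarrow> bool \<Rightarrow> complex" where
  "basis_ket Z s b = (if b = s then 1 else 0)"
| "basis_ket X s b = (if s \<and> b then - 1 else 1) / complex_of_real (sqrt 2)"

definition ket_power :: "(bool \<Rightarrow> complex) \<Rightarrow> bool list \<Rightarrow> complex" where
  "ket_power v xs = (\<Prod>b\<leftarrow>xs. v b)"

definition bra_power :: "(bool \<Rightarrow> complex) \<Rightarrow> bool list \<Rightarrow> complex" where
  "bra_power v xs = (\<Prod>b\<leftarrow>xs. cnj (v b))"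

primrec interp :: "zx \<Rightarrow> bool list \<Rightarrow> bool list \<Rightarrow> complex" where
  "interp (Spider c m n \<alpha>) x y =
     ket_power (basis_ket c False) y * bra_power (basis_ket c False) x
     + cis \<alpha> * ket_power (basis_ket c True) y * bra_power (basis_ket c True) x"
| "interp Hadamard x y = (if x = [True] \<and> y = [True] then - 1 else 1) / complex_of_real (sqrt 2)"
| "interp (Wires n) x y = (if x = y then 1 else 0)"
| "interp Swap x y = (if y = [x ! 1, x ! 0] then 1 else 0)"
| "interp Cup x y = (if y ! 0 = y ! 1 then 1 else 0)"
| "interp Cap x y = (if x ! 0 = x ! 1 then 1 else 0)"
| "interp (D ;; E) x y = (\<Sum>z | length z = outs D. interp D x z * interp E z y)"
| "interp (D \<otimes> E) x y =
     interp D (take (ins D) x) (take (outs D) y) * interp E (drop (ins D) x) (drop (outs D) y)"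

definition proportional :: "zx \<Rightarrow> zx \<Rightarrow> bool" where
  "proportional D E \<longleftrightarrow> ins D = ins E \<and> outs D = outs E \<and>
     (\<exists>c. c \<noteq> 0 \<and> (\<forall>x y. length x = ins D \<longrightarrow> length y = outs D \<longrightarrow>
        interp D x y = c * interp E x y))"


section \<open>The labelled open graph underlying a diagram\<close>

text \<open>
  \<open>open_graph D W N I J\<close>: the labelled open graph of \<open>D\<close> has the set of wires \<open>W\<close>, the
  multiset of nodes \<open>N\<close>, each consisting of its label and the multiset of wires at its legs, and
  the wires at the inputs and outputs of \<open>D\<close> are those listed in \<open>I\<close> and \<open>J\<close>. Phases occur
  modulo \<open>2\<pi>\<close>. Wires are named by arbitrary natural numbers, and the predicate holds for every
  choice of names. In a composite, \<open>f\<close> maps each wire of the two parts to the wire of the composite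
  it belongs to: it identifies two wires iff they become connected by plugging outputs into
  inputs. (A wire without any end is a closed loop.)
\<close>

datatype node = Spider_node colour real | Hadamard_node

inductive open_graph ::
  "zx \<Rightarrow> nat set \<Rightarrow> (node \<times> nat multiset) multiset \<Rightarrow> nat list \<Rightarrow> nat list \<Rightarrow> bool"
where
  Spider: "\<lbrakk>length xs = m; length ys = n; distinct (xs @ ys)\<rbrakk> \<Longrightarrow>
    open_graph (Spider c m n \<alpha>) (set (xs @ ys))
      {#(Spider_node c (\<alpha> rmod (2 * pi)), mset (xs @ ys))#} xs ys"
| Hadamard: "x \<noteq> y \<Longrightarrow> open_graph Hadamard {x, y} {#(Hadamard_node, {#x, y#})#} [x] [y]"
| Wires: "\<lbrakk>length xs = n; distinct xs\<rbrakk> \<Longrightarrow> open_graph (Wires n) (set xs) {#} xs xs"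
| Swap: "x \<noteq> y \<Longrightarrow> open_graph Swap {x, y} {#} [x, y] [y, x]"
| Cup: "open_graph Cup {x} {#} [] [x, x]"
| Cap: "open_graph Cap {x} {#} [x, x] []"
| Comp: "\<lbrakk>open_graph D W N I J; open_graph E W' N' I' J'; W \<inter> W' = {}; length J = length I';
    \<forall>x \<in> W \<union> W'. \<forall>y \<in> W \<union> W'. f x = f y \<longleftrightarrow> equivclp (\<lambda>u v. (u, v) \<in> set (zip J I')) x y\<rbrakk> \<Longrightarrow>
    open_graph (D ;; E) (f ` (W \<union> W')) (image_mset (map_prod id (image_mset f)) (N + N'))
      (map f I) (map f J')"
| Tensor: "\<lbrakk>open_graph D W N I J; open_graph E W' N' I' J'; W \<inter> W' = {}\<rbrakk> \<Longrightarrow>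
    open_graph (D \<otimes> E) (W \<union> W') (N + N') (I @ I') (J @ J')"

definition same_graph :: "zx \<Rightarrow> zx \<Rightarrow> bool" where
  "same_graph D E \<longleftrightarrow> (\<exists>W N I J. open_graph D W N I J \<and> open_graph E W N I J)"


section \<open>Transformation of diagrams by a set of rules\<close>

text \<open>
  Equations hold up to nonzero scalars, so a diagram without inputs and outputs that denotes a
  nonzero number may be exchanged for the empty diagram.
\<close>

inductive transforms :: "(zx \<Rightarrow> zx \<Rightarrow> bool) \<Rightarrow> zx \<Rightarrow> zx \<Rightarrow> bool" for R where
  rule: "R D E \<Longrightarrow> transforms R D E"
| connectivity: "same_graph D E \<Longrightarrow> transforms R D E"
| scalar: "\<lbrakk>wf_zx D; ins D = 0; outs D = 0; interp D [] [] \<noteq> 0\<rbrakk> \<Longrightarrow> transforms R D (Wires 0)"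
| refl: "wf_zx D \<Longrightarrow> transforms R D D"
| sym: "transforms R D E \<Longrightarrow> transforms R E D"
| trans: "\<lbrakk>transforms R C D; transforms R D E\<rbrakk> \<Longrightarrow> transforms R C E"
| comp: "\<lbrakk>transforms R D D'; transforms R E E'; outs D = ins E\<rbrakk> \<Longrightarrow> transforms R (D ;; E) (D' ;; E')"
| tensor: "\<lbrakk>transforms R D D'; transforms R E E'\<rbrakk> \<Longrightarrow> transforms R (D \<otimes> E) (D' \<otimes> E')"


section \<open>Rules\<close>

text \<open>
  Some permutations of wires: \<open>pass k : k + 1 \<rightarrow> 1 + k\<close> moves the last wire to the front,
  \<open>block_swap k l : k + l \<rightarrow> l + k\<close> exchanges two blocks of wires,
  \<open>interleave n m : n + n * m \<rightarrow> n * (1 + m)\<close> puts the \<open>j\<close>-th of the first \<open>n\<close> wires in front of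
  the \<open>j\<close>-th of the \<open>n\<close> blocks of \<open>m\<close> wires, and \<open>transposition m n : m * n \<rightarrow> n * m\<close>
  takes the \<open>j\<close>-th wire of the \<open>i\<close>-th block to the \<open>i\<close>-th wire of the \<open>j\<close>-th block.
\<close>

primrec pass :: "nat \<Rightarrow> zx" where
  "pass 0 = Wires 1"
| "pass (Suc k) = (Wires 1 \<otimes> pass k) ;; (Swap \<otimes> Wires k)"

primrec block_swap :: "nat \<Rightarrow> nat \<Rightarrow> zx" where
  "block_swap k 0 = Wires k"
| "block_swap k (Suc l) = (pass k \<otimes> Wires l) ;; (Wires 1 \<otimes> block_swap k l)"

primrec interleave :: "nat \<Rightarrow> nat \<Rightarrow> zx" where
  "interleave 0 m = Wires 0"
| "interleave (Suc n) m =
     (Wires 1 \<otimes> block_swap n m \<otimes> Wires (n * m)) ;; (Wires (1 + m) \<otimes> interleave n m)"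

primrec transposition :: "nat \<Rightarrow> nat \<Rightarrow> zx" where
  "transposition 0 n = Wires 0"
| "transposition (Suc m) n = (Wires n \<otimes> transposition m n) ;; interleave n m"

inductive clifford_rule :: "zx \<Rightarrow> zx \<Rightarrow> bool" where
  spider_fusion: "k \<ge> 1 \<Longrightarrow> clifford_rule
    ((Spider c m\<^sub>1 (n\<^sub>1 + k) \<alpha> \<otimes> Wires m\<^sub>2) ;; (Wires n\<^sub>1 \<otimes> Spider c (k + m\<^sub>2) n\<^sub>2 \<beta>))
    (Spider c (m\<^sub>1 + m\<^sub>2) (n\<^sub>1 + n\<^sub>2) (\<alpha> + \<beta>))"
| colour_change: "clifford_rule
    (tensor_power m Hadamard ;; Spider c m n \<alpha> ;; tensor_power n Hadamard)
    (Spider (opp c) m n \<alpha>)"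
| pi_copy: "clifford_rule
    (tensor_power m (Spider (opp c) 1 1 pi) ;; Spider c m n \<alpha>)
    (Spider c m n (- \<alpha>) ;; tensor_power n (Spider (opp c) 1 1 pi))"
| strong_complementarity: "clifford_rule
    (Spider (opp c) m 1 0 ;; Spider c 1 n 0)
    (tensor_power m (Spider c 1 n 0) ;; transposition m n ;; tensor_power n (Spider (opp c) m 1 0))"
| identity: "clifford_rule (Spider c 1 1 0) (Wires 1)"
| hadamard_cancellation: "clifford_rule (Hadamard ;; Hadamard) (Wires 1)"
| euler_decomposition: "clifford_rule Hadamard
    (Spider c 1 1 (pi / 2) ;; Spider (opp c) 1 1 (pi / 2) ;; Spider c 1 1 (pi / 2))"

primrec spider_nest :: "nat \<Rightarrow> zx" where
  "spider_nest 0 = Spider Z 1 0 (pi / 4)"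
| "spider_nest (Suc n) =
     Spider Z 1 2 0 ;;
     (spider_nest n \<otimes> (Spider X 1 2 0 ;; (spider_nest n \<otimes> Wires 1))) ;;
     ((transposition 2 n ;; tensor_power n (Spider Z 2 1 0)) \<otimes> Wires 1)"

inductive S4_rule :: "zx \<Rightarrow> zx \<Rightarrow> bool" where
  S4: "S4_rule (spider_nest 4) (Spider Z 1 0 0 \<otimes> tensor_power 4 (Spider Z 0 1 0))"


section \<open>CNOT+T circuits\<close>

text \<open>Qubits are numbered from \<open>0\<close>; the arguments of \<open>CNOT\<close> are the control and the target.\<close>

datatype gate = Tgate nat | CNOT nat nat

primrec valid_gate :: "nat \<Rightarrow> gate \<Rightarrow> bool" where
  "valid_gate n (Tgate i) \<longleftrightarrow> i < n"
| "valid_gate n (CNOT i j) \<longleftrightarrow> i < n \<and> j < n \<and> i \<noteq> j"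

text \<open>
  For \<open>i < j < n\<close>, \<open>link n c i d j\<close> has \<open>n\<close> qubit wires, with a phase-free three-legged spider of
  colour \<open>c\<close> on wire \<open>i\<close> joined by a wire to one of colour \<open>d\<close> on wire \<open>j\<close>. The joining wire
  crosses the qubit wires strictly between \<open>i\<close> and \<open>j\<close>.
\<close>

definition link :: "nat \<Rightarrow> colour \<Rightarrow> nat \<Rightarrow> colour \<Rightarrow> nat \<Rightarrow> zx" where
  "link n c i d j =
     (Wires j \<otimes> Spider d 1 2 0 \<otimes> Wires (n - j - 1)) ;;
     (Wires (i + 1) \<otimes> pass (j - i - 1) \<otimes> Wires (n - j)) ;;
     (Wires i \<otimes> Spider c 2 1 0 \<otimes> Wires (n - i - 1))"

primrec gate_diagram :: "nat \<Rightarrow> gate \<Rightarrow> zx" where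
  "gate_diagram n (Tgate i) = Wires i \<otimes> Spider Z 1 1 (pi / 4) \<otimes> Wires (n - i - 1)"
| "gate_diagram n (CNOT i j) = (if i < j then link n Z i X j else link n X j Z i)"

definition is_circuit :: "nat \<Rightarrow> gate list \<Rightarrow> bool" where
  "is_circuit n gs \<longleftrightarrow> (\<forall>g \<in> set gs. valid_gate n g)"

primrec circuit_diagram :: "nat \<Rightarrow> gate list \<Rightarrow> zx" where
  "circuit_diagram n [] = Wires n"
| "circuit_diagram n (g # gs) = gate_diagram n g ;; circuit_diagram n gs"


section \<open>Arities\<close>

lemma arity_tensor_power [simp]:
  "ins (tensor_power k D) = k * ins D" "outs (tensor_power k D) = k * outs D"
  by (induction k) auto

lemma wf_tensor_power [simp]: "wf_zx D \<Longrightarrow> wf_zx (tensor_power k D)"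
  by (induction k) auto

lemma arity_pass [simp]: "ins (pass k) = Suc k" "outs (pass k) = Suc k"
  by (induction k) auto

lemma wf_pass [simp]: "wf_zx (pass k)"
  by (induction k) auto

lemma arity_block_swap [simp]: "ins (block_swap k l) = k + l" "outs (block_swap k l) = k + l"
  by (induction l) auto

lemma wf_block_swap [simp]: "wf_zx (block_swap k l)"
  by (induction l) auto

lemma arity_interleave [simp]:
  "ins (interleave n m) = n + n * m" "outs (interleave n m) = n + n * m"
  by (induction n) auto

lemma wf_interleave [simp]: "wf_zx (interleave n m)"
  by (induction n) auto

lemma arity_transposition [simp]:
  "ins (transposition m n) = m * n" "outs (transposition m n) = n * m"
  by (induction m) auto

lemma wf_transposition [simp]: "wf_zx (transposition m n)"
  by (induction m) auto

lemma arity_spider_nest [simp]: "ins (spider_nest n) = 1" "outs (spider_nest n) = n"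
  by (induction n) auto

lemma wf_spider_nest [simp]: "wf_zx (spider_nest n)"
  by (induction n) auto

lemma clifford_rule_wf:
  "clifford_rule D E \<Longrightarrow> wf_zx D \<and> wf_zx E \<and> ins D = ins E \<and> outs D = outs E"
  by (induction rule: clifford_rule.induct) auto

lemma S4_rule_wf:
  "S4_rule D E \<Longrightarrow> wf_zx D \<and> wf_zx E \<and> ins D = ins E \<and> outs D = outs E"
  by (induction rule: S4_rule.induct) auto

lemma gate_diagram_wf:
  assumes "valid_gate n g"
  shows "wf_zx (gate_diagram n g) \<and> ins (gate_diagram n g) = n \<and> outs (gate_diagram n g) = n"
  using assms by (cases g) (auto simp: link_def)

lemma circuit_diagram_wf:
  assumes "is_circuit n gs"
  shows "wf_zx (circuit_diagram n gs) \<and> ins (circuit_diagram n gs) = n \<and>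
    outs (circuit_diagram n gs) = n"
  using assms by (induction gs) (auto simp: is_circuit_def gate_diagram_wf)

end

(*
  The diagrams modulo the rules form a symmetric strict monoidal category. In it the phase-free
  Z-spiders copy and the X-spiders add, so by strong complementarity and the Hopf law every
  phase-free circuit is a tuple of parities of its inputs, and the parities of n wires form an
  abelian group of exponent 2. A CNOT+T circuit thereby becomes a product of phase gadgets
  (a parity followed by the effect Z(pi/4)) paired with a tuple of parities. The tuple is determined
  by the denoted map, and so is the phase polynomial, that is, the sum of the parities modulo 8.
  Bending the outputs of the spider nest turns the rule S4 into the statement that the product
  of the gadgets on b + (sum over T), T ranging over the subsets of four parities, is trivial.
  Taking more than four parities, or some of them zero, gives for every nonempty S that the
  gadgets on all subsets of S, each repeated 2^(4 - |S|) times, cancel. These relations generate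
  all phase polynomials vanishing modulo 8: by Moebius inversion the coefficient at a maximal S
  is a multiple of 2^(4 - |S|) and can be removed.
*)
theory Submission
  imports Defs
begin

section \<open>Open graphs\<close>

text \<open>The category laws are the first obstacle. Diagrams are identified through open graphs
  with named wires, and every composition glues anew, so associativity would compare two nested
  quotients. Postponing all gluings to a single equivalence on the disjoint union of the wires
  (\<open>pre_graph\<close>) makes the data on both sides literally equal. The constants come from
  eighth roots of unity: equal gadgets fuse, and eight of them have phase 2 pi, so multiplicities
  count modulo 8. The sum of the parities of all subsets of a k-element S takes the values 0 and
  2^(k-1); four parities are the first case where this is 8. Conversely, divisibility by 8 of the
  whole polynomial only yields that 8 divides 2^(k-1) times the coefficient at a maximal S, which is
  exactly what 2^(4-k) repetitions can absorb. Circuits contain T but not its inverse, so phase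
  polynomials appear as lists of sets with nonnegative multiplicities. Seven copies of a gadget
  serve as its inverse, and this gives access to integer coefficients.\<close>

definition glued :: "(nat \<times> nat) set \<Rightarrow> nat \<Rightarrow> nat \<Rightarrow> bool" where
  "glued R = equivclp (\<lambda>u v. (u, v) \<in> R)"

abbreviation rename ::
  "(nat \<Rightarrow> nat) \<Rightarrow> (node \<times> nat multiset) multiset \<Rightarrow> (node \<times> nat multiset) multiset"
where
  "rename f \<equiv> image_mset (map_prod id (image_mset f))"

definition glues :: "nat set \<Rightarrow> (nat \<times> nat) set \<Rightarrow> (nat \<Rightarrow> nat) \<Rightarrow> bool" where
  "glues W R f \<longleftrightarrow> (\<forall>x \<in> W. \<forall>y \<in> W. f x = f y \<longleftrightarrow> glued R x y)"

lemma glued_refl [simp]: "glued R x x"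
  by (simp add: glued_def equivclp_def)

lemma glued_sym: "glued R x y \<Longrightarrow> glued R y x"
  unfolding glued_def by (rule equivclp_sym)

lemma glued_trans [trans]: "glued R x y \<Longrightarrow> glued R y z \<Longrightarrow> glued R x z"
  unfolding glued_def by (rule equivclp_trans)

lemma glued_edge: "(x, y) \<in> R \<Longrightarrow> glued R x y"
  unfolding glued_def by (rule r_into_equivclp)

lemma glued_induct [consumes 1, case_names base step, induct pred: glued]:
  assumes "glued R a b" "P a" "\<And>y z. glued R a y \<Longrightarrow> (y, z) \<in> R \<or> (z, y) \<in> R \<Longrightarrow> P y \<Longrightarrow> P z"
  shows "P b"
  using assms unfolding glued_def by (rule equivclp_induct)

lemma glued_mono: "glued R x y \<Longrightarrow> R \<subseteq> S \<Longrightarrow> glued S x y"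
proof (induction rule: glued_induct)
  case (step y z)
  then have "glued S y z"
    by (blast intro: glued_edge glued_sym)
  then show ?case
    using step glued_trans by blast
qed simp

lemma glued_const:
  assumes "glued R x y" and eq: "\<And>u v. (u, v) \<in> R \<Longrightarrow> f u = f v"
  shows "f x = f y"
  using assms(1)
proof (induction rule: glued_induct)
  case (step y z)
  from step(2) have "f y = f z"
    using eq[of y z] eq[of z y] by (elim disjE) simp_all
  with step(3) show ?case
    by simp
qed simp

text \<open>Such an f chooses representatives: f x = f y links x to f x = f y and then to y.
  Explicit renamings can thus serve as gluing maps without computing any class.\<close>

lemma glues_retract:
  assumes "\<And>u v. (u, v) \<in> R \<Longrightarrow> f u = f v" "\<And>x. x \<in> W \<Longrightarrow> glued R x (f x)"
  shows "glues W R f"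
  unfolding glues_def
proof (intro ballI iffI)
  fix x y assume xy: "x \<in> W" "y \<in> W" "f x = f y"
  then have "glued R x (f y)"
    using assms(2)[of x] by simp
  then show "glued R x y"
    by (rule glued_trans[OF _ glued_sym[OF assms(2)[OF xy(2)]]])
qed (rule glued_const[OF _ assms(1)])

text \<open>The least name of a class gives a concrete gluing map that never leaves the given set of
  wires, so disjoint parts stay disjoint after gluing.\<close>

definition class_rep :: "(nat \<times> nat) set \<Rightarrow> nat \<Rightarrow> nat" where
  "class_rep R x = (LEAST y. glued R x y)"

lemma glued_class_rep: "glued R x (class_rep R x)"
  unfolding class_rep_def by (rule LeastI[of _ x]) simp

lemma class_rep_eq_iff: "class_rep R x = class_rep R y \<longleftrightarrow> glued R x y"
proof
  assume "glued R x y"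
  then have "glued R x = glued R y"
    by (intro ext) (metis glued_sym glued_trans)
  then show "class_rep R x = class_rep R y"
    by (simp add: class_rep_def)
next
  assume "class_rep R x = class_rep R y"
  then have "glued R x (class_rep R y)"
    using glued_class_rep[of R x] by simp
  then show "glued R x y"
    by (rule glued_trans[OF _ glued_sym[OF glued_class_rep]])
qed

lemma class_rep_idem [simp]: "class_rep R (class_rep R x) = class_rep R x"
  unfolding class_rep_eq_iff by (rule glued_sym[OF glued_class_rep])

lemma glued_closed:
  assumes "glued R x y" "x \<in> W" "R \<subseteq> W \<times> W"
  shows "y \<in> W"
  using assms by (induction rule: glued_induct) auto

lemma class_rep_in: "x \<in> W \<Longrightarrow> R \<subseteq> W \<times> W \<Longrightarrow> class_rep R x \<in> W"
  using glued_closed glued_class_rep by blast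

text \<open>A path starting in W cannot leave it, because an edge of R' has both ends in W'. Gluing
  two disjoint parts together therefore restricts to the gluing of each.\<close>

lemma glued_Un_disjoint:
  assumes "R \<subseteq> W \<times> W" "R' \<subseteq> W' \<times> W'" "W \<inter> W' = {}" "x \<in> W"
  shows "glued (R \<union> R') x y \<longleftrightarrow> glued R x y"
proof
  assume "glued (R \<union> R') x y"
  then have "glued R x y \<and> y \<in> W"
  proof (induction rule: glued_induct)
    case (step y z)
    then have "(y, z) \<in> R \<or> (z, y) \<in> R"
      using assms by blast
    then show ?case
      using step assms(1) by (blast intro: glued_trans glued_edge glued_sym)
  qed (use assms in auto)
  then show "glued R x y" ..
qed (blast intro: glued_mono)

section \<open>Nodes and renaming of wires\<close>

definition nodes_over :: "nat set \<Rightarrow> (node \<times> nat multiset) multiset \<Rightarrow> bool" where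
  "nodes_over W N \<longleftrightarrow> (\<forall>p \<in># N. set_mset (snd p) \<subseteq> W)"

lemma nodes_over_add [simp]: "nodes_over W (N + N') \<longleftrightarrow> nodes_over W N \<and> nodes_over W N'"
  by (auto simp: nodes_over_def)

lemma nodes_over_mono: "nodes_over W N \<Longrightarrow> W \<subseteq> W' \<Longrightarrow> nodes_over W' N"
  by (auto simp: nodes_over_def)

lemma nodes_over_image: "nodes_over W N \<Longrightarrow> nodes_over (f ` W) (rename f N)"
  by (fastforce simp: nodes_over_def)

lemma rename_nodes_cong:
  assumes "nodes_over W N" "\<And>x. x \<in> W \<Longrightarrow> f x = g x"
  shows "rename f N = rename g N"
proof (rule image_mset_cong)
  fix p assume "p \<in># N"
  then have "image_mset f (snd p) = image_mset g (snd p)"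
    using assms by (intro image_mset_cong) (auto simp: nodes_over_def)
  then show "map_prod id (image_mset f) p = map_prod id (image_mset g) p"
    by (cases p) auto
qed

lemma rename_nodes_comp:
  "rename f (rename g N) = rename (\<lambda>x. f (g x)) N"
  by (simp add: multiset.map_comp o_def map_prod_def split_def)

lemma rename_nodes_id:
  assumes "nodes_over W N" "\<And>x. x \<in> W \<Longrightarrow> f x = x"
  shows "rename f N = N"
  using rename_nodes_cong[OF assms(1), of f id] assms(2) by (simp add: map_prod.id)

lemma open_graph_wf:
  assumes "open_graph D W N I J"
  shows "wf_zx D" "length I = ins D" "length J = outs D" "finite W" "set I \<subseteq> W" "set J \<subseteq> W"
    "nodes_over W N"
proof -
  have "wf_zx D \<and> length I = ins D \<and> length J = outs D \<and> finite W \<and> set I \<subseteq> W \<and> set J \<subseteq> W \<and>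
    nodes_over W N"
    using assms
  proof (induction rule: open_graph.induct)
    case (Comp D W N I J E W' N' I' J' f)
    then have "nodes_over (W \<union> W') (N + N')"
      by (auto intro: nodes_over_mono)
    from nodes_over_image[OF this, of f] Comp show ?case
      by auto
  next
    case Tensor
    then show ?case
      by (auto intro: nodes_over_mono)
  qed (auto simp: nodes_over_def)
  then show "wf_zx D" "length I = ins D" "length J = outs D" "finite W" "set I \<subseteq> W" "set J \<subseteq> W"
    "nodes_over W N"
    by auto
qed

text \<open>In a composite, g is absorbed into the gluing map: being injective on the image of f, it
  does not change which wires are identified.\<close>

lemma open_graph_rename:
  assumes "open_graph D W N I J" "inj_on g W"
  shows "open_graph D (g ` W) (rename g N) (map g I) (map g J)"
  using assms
proof (induction arbitrary: g rule: open_graph.induct)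
  case (Spider xs m ys n c \<alpha>)
  have "distinct (map g (xs @ ys))"
    using Spider by (metis distinct_map)
  with open_graph.Spider[of "map g xs" m "map g ys" n c \<alpha>] Spider show ?case
    by (simp add: image_Un)
next
  case (Hadamard x y)
  then show ?case
    using open_graph.Hadamard[of "g x" "g y"] by (simp add: inj_on_def)
next
  case (Wires xs n)
  then show ?case
    using open_graph.Wires[of "map g xs" n] by (simp add: distinct_map)
next
  case (Swap x y)
  then show ?case
    using open_graph.Swap[of "g x" "g y"] by (simp add: inj_on_def)
next
  case (Cup x)
  then show ?case
    using open_graph.Cup[of "g x"] by simp
next
  case (Cap x)
  then show ?case
    using open_graph.Cap[of "g x"] by simp
next
  case (Comp D W N I J E W' N' I' J' f)
  have "\<forall>x \<in> W \<union> W'. \<forall>y \<in> W \<union> W'. (g \<circ> f) x = (g \<circ> f) y \<longleftrightarrow> glued (set (zip J I')) x y"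
  proof (intro ballI)
    fix x y assume "x \<in> W \<union> W'" "y \<in> W \<union> W'"
    then have "(g \<circ> f) x = (g \<circ> f) y \<longleftrightarrow> f x = f y"
      using Comp.prems by (auto dest: inj_onD)
    then show "(g \<circ> f) x = (g \<circ> f) y \<longleftrightarrow> glued (set (zip J I')) x y"
      using Comp.hyps(5)[folded glued_def] \<open>x \<in> _\<close> \<open>y \<in> _\<close> by blast
  qed
  from open_graph.Comp[OF Comp.hyps(1-4) this[unfolded glued_def]] show ?case
    by (simp only: image_comp map_map rename_nodes_comp o_def)
next
  case (Tensor D W N I J E W' N' I' J')
  then have "inj_on g W" "inj_on g W'" "g ` W \<inter> g ` W' = {}"
    by (auto simp: inj_on_Un inj_on_def disjoint_iff) (metis Un_iff)+
  with open_graph.Tensor[OF Tensor.IH(1)[of g] Tensor.IH(2)[of g]] show ?case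
    by (simp add: image_Un)
qed

text \<open>
  A preliminary open graph still has to be glued along the pairs of wires in \<open>R\<close>; the gluings of
  nested composites may be postponed and performed all at once.
\<close>

definition pre_graph ::
  "zx \<Rightarrow> nat set \<Rightarrow> (nat \<times> nat) set \<Rightarrow> (node \<times> nat multiset) multiset \<Rightarrow> nat list \<Rightarrow> nat list \<Rightarrow> bool"
where
  "pre_graph D W R N I J \<longleftrightarrow> R \<subseteq> W \<times> W \<and> set I \<subseteq> W \<and> set J \<subseteq> W \<and> nodes_over W N \<and>
     length I = ins D \<and> length J = outs D \<and> finite W \<and>
     (\<forall>f. glues W R f \<longrightarrow>
       open_graph D (f ` W) (rename f N) (map f I) (map f J))"

text \<open>With nothing to glue, the equivalence is equality, so a gluing map is an injective
  renaming.\<close>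

lemma pre_graph_base:
  assumes "open_graph D W N I J"
  shows "pre_graph D W {} N I J"
proof -
  have "inj_on f W" if "glues W {} f" for f
  proof (rule inj_onI)
    fix x y assume "x \<in> W" "y \<in> W" "f x = f y"
    then have "glued {} x y"
      using that by (auto simp: glues_def)
    then show "x = y"
      using glued_const[of "{}" x y id] by auto
  qed
  then show ?thesis
    using assms open_graph_wf[OF assms] by (auto simp: pre_graph_def intro: open_graph_rename)
qed

lemma class_rep_gluing: "glues W R (class_rep R)"
  by (simp add: glues_def class_rep_eq_iff)

text \<open>A gluing map f of the union of all three relations factors through the inner gluings.
  After these, f identifies exactly the wires joined by plugging J into I', which is what the
  \<open>Comp\<close> clause asks for.\<close>

lemma pre_graph_comp:
  assumes D: "pre_graph D W R N I J" and E: "pre_graph E W' R' N' I' J'"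
    and disj: "W \<inter> W' = {}" and len: "length J = length I'"
  shows "pre_graph (D ;; E) (W \<union> W') (R \<union> R' \<union> set (zip J I')) (N + N') I J'"
proof -
  let ?S = "R \<union> R'" and ?Q = "set (zip J I')"
  \<comment> \<open>g performs the inner gluings of both parts at once. It maps W into W and W' into
    W', so the glued parts remain disjoint.\<close>
  define g where "g = class_rep ?S"
  note subs = D[unfolded pre_graph_def] E[unfolded pre_graph_def]
  have nodes: "nodes_over (W \<union> W') (N + N')"
    using subs nodes_over_mono[of W N "W \<union> W'"] nodes_over_mono[of W' N' "W \<union> W'"] by simp
  have RW: "R \<subseteq> W \<times> W" "R' \<subseteq> W' \<times> W'"
    using subs by auto
  have S: "?S \<subseteq> (W \<union> W') \<times> (W \<union> W')" and Q: "?Q \<subseteq> W \<times> W'"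
    using subs by (auto dest: set_zip_leftD set_zip_rightD)
  have SW: "glued ?S x y \<longleftrightarrow> glued R x y" if "x \<in> W" for x y
    using glued_Un_disjoint[of R W R' W'] subs disj that by blast
  have SW': "glued ?S x y \<longleftrightarrow> glued R' x y" if "x \<in> W'" for x y
    using glued_Un_disjoint[of R' W' R W] subs disj that by (simp add: Un_commute Int_commute)
  have gW: "g ` W \<subseteq> W"
    using SW glued_closed[OF _ _ RW(1)] glued_class_rep[of ?S] unfolding g_def by blast
  have gW': "g ` W' \<subseteq> W'"
    using SW' glued_closed[OF _ _ RW(2)] glued_class_rep[of ?S] unfolding g_def by blast
  have "glues W R g" "glues W' R' g"
    by (auto simp: glues_def g_def class_rep_eq_iff SW SW')
  then have gD: "open_graph D (g ` W) (rename g N) (map g I) (map g J)"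
    and gE: "open_graph E (g ` W') (rename g N') (map g I') (map g J')"
    using subs by auto
  have "open_graph (D ;; E) (f ` (W \<union> W')) (rename f (N + N')) (map f I) (map f J')"
    if f: "glues (W \<union> W') (?S \<union> ?Q) f" for f
  proof -
    have fg: "f (g x) = f x" if "x \<in> W \<union> W'" for x
    proof -
      have "g x \<in> W \<union> W'"
        using that gW gW' by blast
      moreover have "glued (?S \<union> ?Q) (g x) x"
        unfolding g_def by (rule glued_mono[OF glued_sym[OF glued_class_rep]]) blast
      ultimately show ?thesis
        using f that by (simp add: glues_def)
    qed
    let ?gQ = "set (zip (map g J) (map g I'))"
    have gQ: "?gQ = map_prod g g ` ?Q"
      by (simp add: zip_map_map map_prod_def)
    \<comment> \<open>Inner edges collapse under g and outer edges become edges between the glued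
      lists. In the other direction, an edge between glued lists is lifted by inserting the inner
      paths from g a to a.\<close>
    have 1: "glued ?gQ (g x) (g y)" if "glued (?S \<union> ?Q) x y" for x y
      using that
    proof (induction rule: glued_induct)
      case (step y z)
      have "glued ?gQ (g y) (g z)"
      proof (cases "(y, z) \<in> ?S \<or> (z, y) \<in> ?S")
        case True
        then have "g y = g z"
          unfolding g_def class_rep_eq_iff by (blast intro: glued_edge glued_sym)
        then show ?thesis
          by simp
      next
        case False
        then have "(y, z) \<in> ?Q \<or> (z, y) \<in> ?Q"
          using step by blast
        then have "(g y, g z) \<in> ?gQ \<or> (g z, g y) \<in> ?gQ"
          unfolding gQ by (metis image_eqI map_prod_simp)
        then show ?thesis
          by (blast intro: glued_edge glued_sym)
      qed
      then show ?case
        using step glued_trans by blast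
    qed simp
    have 2: "glued (?S \<union> ?Q) x y" if "glued ?gQ x y" for x y
      using that
    proof (induction rule: glued_induct)
      case (step y z)
      have rep: "glued (?S \<union> ?Q) (g a) a" for a
        unfolding g_def by (rule glued_mono[OF glued_sym[OF glued_class_rep]]) blast
      have *: "glued (?S \<union> ?Q) u v" if "(u, v) \<in> ?gQ" for u v
      proof -
        have "\<exists>a b. (a, b) \<in> ?Q \<and> u = g a \<and> v = g b"
          using that unfolding gQ by force
        then obtain a b where ab: "(a, b) \<in> ?Q" "u = g a" "v = g b"
          by blast
        then have "glued (?S \<union> ?Q) a b"
          by (blast intro: glued_edge)
        then show ?thesis
          unfolding ab by (rule glued_trans[OF rep glued_trans[OF _ glued_sym[OF rep]]])
      qed
      then show ?case
        using step by (blast intro: glued_trans glued_sym)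
    qed simp
    have "\<forall>x \<in> g ` W \<union> g ` W'. \<forall>y \<in> g ` W \<union> g ` W'. f x = f y \<longleftrightarrow> glued ?gQ x y"
    proof (intro ballI)
      fix x y assume xy: "x \<in> g ` W \<union> g ` W'" "y \<in> g ` W \<union> g ` W'"
      then have "x \<in> W \<union> W'" "y \<in> W \<union> W'"
        using gW gW' by blast+
      then have "f x = f y \<longleftrightarrow> glued (?S \<union> ?Q) x y"
        using f by (simp add: glues_def)
      moreover have "g x = x" "g y = y"
        using xy by (auto simp: g_def)
      ultimately show "f x = f y \<longleftrightarrow> glued ?gQ x y"
        using 1[of x y] 2[of x y] by metis
    qed
    moreover have "g ` W \<inter> g ` W' = {}"
      using gW gW' disj by blast
    ultimately have *: "open_graph (D ;; E) (f ` (g ` W \<union> g ` W'))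
      (rename f (rename g N + rename g N'))
      (map f (map g I)) (map f (map g J'))"
      using open_graph.Comp[OF gD gE] len unfolding glued_def by simp
    have "f ` (g ` W \<union> g ` W') = f ` (W \<union> W')"
    proof -
      have "f ` (g ` W \<union> g ` W') = (\<lambda>x. f (g x)) ` (W \<union> W')"
        by (simp add: image_Un image_image)
      then show ?thesis
        using fg by simp
    qed
    moreover have "map f (map g I) = map f I" "map f (map g J') = map f J'"
      using fg subs by (auto simp: subset_iff)
    moreover have "rename f (rename g N + rename g N')
      = rename f (N + N')"
      unfolding image_mset_union[symmetric] rename_nodes_comp
      using nodes by (rule rename_nodes_cong) (rule fg)
    ultimately show ?thesis
      using * by metis
  qed
  then show ?thesis
    using subs S Q nodes unfolding pre_graph_def by auto
qed

lemma pre_graph_tensor: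
  assumes D: "pre_graph D W R N I J" and E: "pre_graph E W' R' N' I' J'" and disj: "W \<inter> W' = {}"
  shows "pre_graph (D \<otimes> E) (W \<union> W') (R \<union> R') (N + N') (I @ I') (J @ J')"
proof -
  note subs = D[unfolded pre_graph_def] E[unfolded pre_graph_def]
  have SW: "glued (R \<union> R') x y \<longleftrightarrow> glued R x y" if "x \<in> W" for x y
    using glued_Un_disjoint[of R W R' W'] subs disj that by blast
  have SW': "glued (R \<union> R') x y \<longleftrightarrow> glued R' x y" if "x \<in> W'" for x y
    using glued_Un_disjoint[of R' W' R W] subs disj that by (simp add: Un_commute Int_commute)
  have "open_graph (D \<otimes> E) (f ` (W \<union> W')) (rename f (N + N')) (map f (I @ I')) (map f (J @ J'))"
    if f: "glues (W \<union> W') (R \<union> R') f" for f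
  proof -
    have "glues W R f" "glues W' R' f"
      using f by (auto simp: glues_def SW SW')
    then have "open_graph D (f ` W) (rename f N) (map f I) (map f J)"
      "open_graph E (f ` W') (rename f N') (map f I') (map f J')"
      using subs by auto
    moreover have "f ` W \<inter> f ` W' = {}"
    proof -
      have "f x \<noteq> f y" if "x \<in> W" "y \<in> W'" for x y
        using f that SW[of x y] glued_closed[of R x y W] subs disj by (auto simp: glues_def)
      then show ?thesis
        by blast
    qed
    ultimately show ?thesis
      using open_graph.Tensor by (simp add: image_Un)
  qed
  then show ?thesis
    using subs by (auto simp: pre_graph_def intro: nodes_over_mono)
qed

lemma pre_graph_realise:
  assumes "pre_graph D W R N I J" "glues W R f"
  shows "open_graph D (f ` W) (rename f N) (map f I) (map f J)"
  using assms by (simp add: pre_graph_def)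

text \<open>Equality before gluing suffices, since the same map \<open>class_rep R\<close> realises
  both diagrams.\<close>

lemma same_graph_pre:
  assumes "pre_graph D W R N I J" "pre_graph E W R N I J"
  shows "same_graph D E"
  unfolding same_graph_def
  using assms[THEN pre_graph_realise, OF class_rep_gluing] by blast

section \<open>Existence of open graphs on fresh wires\<close>

lemma fresh_list: "finite A \<Longrightarrow> \<exists>xs :: nat list. length xs = n \<and> distinct xs \<and> set xs \<inter> A = {}"
proof -
  assume "finite A"
  then obtain B where "B \<subseteq> - A" "card B = n" "finite B"
    using infinite_arbitrarily_large[of "- A" n] by (auto simp: finite_compl)
  then show ?thesis
    using finite_distinct_list[of B] by (metis disjoint_eq_subset_Compl distinct_card)
qed

lemma fresh_pair: "finite A \<Longrightarrow> \<exists>x y :: nat. x \<noteq> y \<and> x \<notin> A \<and> y \<notin> A"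
  by (metis ex_new_if_finite finite_insert infinite_UNIV_nat insertCI)

lemma open_graph_comp_exists:
  assumes "open_graph D W N I J" "open_graph E W' N' I' J'" "W \<inter> W' = {}" "length J = length I'"
  obtains W'' N'' I'' J'' where "open_graph (D ;; E) W'' N'' I'' J''" "W'' \<subseteq> W \<union> W'"
proof -
  let ?R = "{} \<union> {} \<union> set (zip J I')"
  have p: "pre_graph (D ;; E) (W \<union> W') ?R (N + N') I J'"
    by (rule pre_graph_comp[OF pre_graph_base[OF assms(1)] pre_graph_base[OF assms(2)] assms(3,4)])
  then have "?R \<subseteq> (W \<union> W') \<times> (W \<union> W')"
    unfolding pre_graph_def by (rule conjunct1)
  then have "class_rep ?R ` (W \<union> W') \<subseteq> W \<union> W'"
    by (intro image_subsetI class_rep_in)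
  with pre_graph_realise[OF p class_rep_gluing] that show ?thesis
    by blast
qed

text \<open>Both \<open>Comp\<close> and \<open>Tensor\<close> demand parts with disjoint wires, so
  the names must be avoidable. Gluing by least representatives creates no new names, hence avoidance
  of A is inherited by composites.\<close>

lemma open_graph_fresh:
  assumes "wf_zx D" "finite A"
  obtains W N I J where "open_graph D W N I J" "W \<inter> A = {}"
proof -
  have "\<exists>W N I J. open_graph D W N I J \<and> W \<inter> A = {}"
    using assms
  proof (induction D arbitrary: A)
    case (Spider c m n \<alpha>)
    obtain xs :: "nat list" where "length xs = m + n" "distinct xs" "set xs \<inter> A = {}"
      using fresh_list Spider by blast
    then have "open_graph (Spider c m n \<alpha>) (set (take m xs @ drop m xs))
      {#(Spider_node c (\<alpha> rmod (2 * pi)), mset (take m xs @ drop m xs))#} (take m xs) (drop m xs)"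
      by (intro open_graph.Spider) auto
    then show ?case
      using \<open>set xs \<inter> A = {}\<close> by (metis append_take_drop_id)
  next
    case Hadamard
    then show ?case
      using fresh_pair[of A] open_graph.Hadamard by fastforce
  next
    case (Wires n)
    obtain xs :: "nat list" where xs: "length xs = n" "distinct xs" "set xs \<inter> A = {}"
      using fresh_list Wires by blast
    then show ?case
      using open_graph.Wires by blast
  next
    case Swap
    then show ?case
      using fresh_pair[of A] open_graph.Swap by fastforce
  next
    case Cup
    then show ?case
      using fresh_pair[of A] open_graph.Cup by fastforce
  next
    case Cap
    then show ?case
      using fresh_pair[of A] open_graph.Cap by fastforce
  next
    case (Comp D E)
    then obtain W N I J where D: "open_graph D W N I J" "W \<inter> A = {}"
      by (metis wf_zx.simps(7,8))
    then obtain W' N' I' J' where E: "open_graph E W' N' I' J'" "W' \<inter> (A \<union> W) = {}"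
      using Comp open_graph_wf(4)[OF D(1)] by (metis finite_Un wf_zx.simps(7))
    have "length J = length I'"
      using open_graph_wf[OF D(1)] open_graph_wf[OF E(1)] Comp.prems by simp
    with open_graph_comp_exists[OF D(1) E(1)] E obtain W'' N'' I'' J'' where
      "open_graph (D ;; E) W'' N'' I'' J''" "W'' \<subseteq> W \<union> W'"
      by blast
    then show ?case
      using D E by blast
  next
    case (Tensor D E)
    then obtain W N I J where D: "open_graph D W N I J" "W \<inter> A = {}"
      by (metis wf_zx.simps(7,8))
    then obtain W' N' I' J' where E: "open_graph E W' N' I' J'" "W' \<inter> (A \<union> W) = {}"
      using Tensor open_graph_wf(4)[OF D(1)] by (metis finite_Un wf_zx.simps(8))
    then show ?case
      using open_graph.Tensor[OF D(1) E(1)] D E by blast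
  qed
  then show ?thesis
    using that by blast
qed

lemma open_graphs3:
  assumes "wf_zx D" "wf_zx E" "wf_zx F"
  obtains W N I J W' N' I' J' W'' N'' I'' J'' where "open_graph D W N I J" "open_graph E W' N' I' J'"
    "open_graph F W'' N'' I'' J''" "W \<inter> W' = {}" "W \<inter> W'' = {}" "W' \<inter> W'' = {}"
proof -
  obtain W N I J where D: "open_graph D W N I J"
    by (metis open_graph_fresh[OF assms(1)] finite.emptyI)
  obtain W' N' I' J' where E: "open_graph E W' N' I' J'" "W' \<inter> W = {}"
    by (rule open_graph_fresh[OF assms(2) open_graph_wf(4)[OF D]])
  obtain W'' N'' I'' J'' where F: "open_graph F W'' N'' I'' J''" "W'' \<inter> (W \<union> W') = {}"
    by (rule open_graph_fresh[OF assms(3) finite_UnI[OF open_graph_wf(4)[OF D] open_graph_wf(4)[OF E(1)]]])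
  have "W \<inter> W' = {}" "W \<inter> W'' = {}" "W' \<inter> W'' = {}"
    using E(2) F(2) by blast+
  then show ?thesis
    by (rule that[OF D E(1) F(1)])
qed

section \<open>Associativity and interchange\<close>

lemma same_graph_assoc:
  assumes "wf_zx (D ;; E ;; F)"
  shows "same_graph (D ;; E ;; F) (D ;; (E ;; F))"
proof -
  obtain W N I J W' N' I' J' W'' N'' I'' J'' where og: "open_graph D W N I J" "open_graph E W' N' I' J'"
    "open_graph F W'' N'' I'' J''" and disj: "W \<inter> W' = {}" "W \<inter> W'' = {}" "W' \<inter> W'' = {}"
    using assms by (auto intro: open_graphs3[of D E F])
  note b = og[THEN pre_graph_base]
  have len: "length J = length I'" "length J' = length I''"
    using og[THEN open_graph_wf(2)] og[THEN open_graph_wf(3)] assms by auto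
  have p: "pre_graph (D ;; E ;; F) (W \<union> W' \<union> W'')
    ({} \<union> {} \<union> set (zip J I') \<union> {} \<union> set (zip J' I'')) (N + N' + N'') I J''"
    by (rule pre_graph_comp[OF pre_graph_comp[OF b(1,2)] b(3)]) (use disj len in auto)
  have q: "pre_graph (D ;; (E ;; F)) (W \<union> (W' \<union> W''))
    ({} \<union> ({} \<union> {} \<union> set (zip J' I'')) \<union> set (zip J I')) (N + (N' + N'')) I J''"
    by (rule pre_graph_comp[OF b(1) pre_graph_comp[OF b(2,3)]]) (use disj len in auto)
  \<comment> \<open>The two bracketings postpone the same gluings, so their data agree by
    associativity and commutativity of unions and sums.\<close>
  have "W \<union> (W' \<union> W'') = W \<union> W' \<union> W''"
    "{} \<union> ({} \<union> {} \<union> set (zip J' I'')) \<union> set (zip J I') = {} \<union> {} \<union> set (zip J I') \<union> {} \<union> set (zip J' I'')"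
    "N + (N' + N'') = N + N' + N''"
    by auto
  with q show ?thesis
    by (intro same_graph_pre[OF p]) metis
qed

lemma same_graph_tensor_assoc:
  assumes "wf_zx ((D \<otimes> E) \<otimes> F)"
  shows "same_graph ((D \<otimes> E) \<otimes> F) (D \<otimes> (E \<otimes> F))"
proof -
  obtain W N I J W' N' I' J' W'' N'' I'' J'' where og: "open_graph D W N I J" "open_graph E W' N' I' J'"
    "open_graph F W'' N'' I'' J''" and disj: "W \<inter> W' = {}" "W \<inter> W'' = {}" "W' \<inter> W'' = {}"
    using assms by (auto intro: open_graphs3[of D E F])
  have "open_graph ((D \<otimes> E) \<otimes> F) (W \<union> W' \<union> W'') (N + N' + N'') ((I @ I') @ I'') ((J @ J') @ J'')"
    by (intro open_graph.Tensor og) (use disj in auto)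
  moreover have "open_graph (D \<otimes> (E \<otimes> F)) (W \<union> (W' \<union> W'')) (N + (N' + N'')) (I @ (I' @ I'')) (J @ (J' @ J''))"
    by (intro open_graph.Tensor og) (use disj in auto)
  then have "open_graph (D \<otimes> (E \<otimes> F)) (W \<union> W' \<union> W'') (N + N' + N'') ((I @ I') @ I'') ((J @ J') @ J'')"
    by (simp only: Un_assoc add.assoc append_assoc)
  ultimately show ?thesis
    unfolding same_graph_def by blast
qed

text \<open>The condition on \<open>outs C\<close> aligns the lists: the zip of the concatenated
  boundaries then splits into the two separate zips.\<close>

lemma same_graph_interchange:
  assumes "wf_zx (C \<otimes> D ;; E \<otimes> F)" "outs C = ins E"
  shows "same_graph (C \<otimes> D ;; E \<otimes> F) ((C ;; E) \<otimes> (D ;; F))"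
proof -
  obtain W N I J where C: "open_graph C W N I J"
    using assms(1) by (metis open_graph_fresh finite.emptyI wf_zx.simps(7,8))
  have fin: "finite W"
    by (rule open_graph_wf(4)[OF C])
  have wf: "wf_zx D" "wf_zx E" "wf_zx F"
    using assms by auto
  obtain W1 N1 I1 J1 where D: "open_graph D W1 N1 I1 J1" "W1 \<inter> W = {}"
    using open_graph_fresh[OF wf(1) fin] by blast
  obtain W2 N2 I2 J2 where E: "open_graph E W2 N2 I2 J2" "W2 \<inter> (W \<union> W1) = {}"
    using open_graph_fresh[OF wf(2), of "W \<union> W1"] fin open_graph_wf(4)[OF D(1)] by blast
  obtain W3 N3 I3 J3 where F: "open_graph F W3 N3 I3 J3" "W3 \<inter> (W \<union> W1 \<union> W2) = {}"
    using open_graph_fresh[OF wf(3), of "W \<union> W1 \<union> W2"] fin open_graph_wf(4)[OF D(1)]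
      open_graph_wf(4)[OF E(1)] by blast
  have disj: "W \<inter> W1 = {}" "W \<inter> W2 = {}" "W \<inter> W3 = {}" "W1 \<inter> W2 = {}" "W1 \<inter> W3 = {}" "W2 \<inter> W3 = {}"
    using D(2) E(2) F(2) by blast+
  note og = C D(1) E(1) F(1)
  note b = og[THEN pre_graph_base]
  have len: "length J = length I2" "length J1 = length I3"
    using og[THEN open_graph_wf(2)] og[THEN open_graph_wf(3)] assms by auto
  have p: "pre_graph (C \<otimes> D ;; E \<otimes> F) (W \<union> W1 \<union> (W2 \<union> W3))
    (({} \<union> {}) \<union> ({} \<union> {}) \<union> set (zip (J @ J1) (I2 @ I3))) (N + N1 + (N2 + N3)) (I @ I1) (J2 @ J3)"
    by (rule pre_graph_comp[OF pre_graph_tensor[OF b(1,2)] pre_graph_tensor[OF b(3,4)]])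
      (use disj len in auto)
  have q: "pre_graph ((C ;; E) \<otimes> (D ;; F)) (W \<union> W2 \<union> (W1 \<union> W3))
    (({} \<union> {} \<union> set (zip J I2)) \<union> ({} \<union> {} \<union> set (zip J1 I3))) (N + N2 + (N1 + N3)) (I @ I1) (J2 @ J3)"
    by (rule pre_graph_tensor[OF pre_graph_comp[OF b(1,3)] pre_graph_comp[OF b(2,4)]])
      (use disj len in auto)
  have "W \<union> W2 \<union> (W1 \<union> W3) = W \<union> W1 \<union> (W2 \<union> W3)"
    "({} \<union> {} \<union> set (zip J I2)) \<union> ({} \<union> {} \<union> set (zip J1 I3)) = ({} \<union> {}) \<union> ({} \<union> {}) \<union> set (zip (J @ J1) (I2 @ I3))"
    "N + N2 + (N1 + N3) = N + N1 + (N2 + N3)"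
    using len by auto
  with q show ?thesis
    by (intro same_graph_pre[OF p]) metis
qed

text \<open>A version with an explicit gluing map, for composites in which one part keeps its wire
  names.\<close>

lemma open_graph_comp_retract:
  assumes D: "open_graph D W N I J" and E: "open_graph E W' N' I' J'"
    and disj: "W \<inter> W' = {}" and len: "length J = length I'"
    and f: "map f J = map f I'" and g: "\<And>x. x \<in> W \<union> W' \<Longrightarrow> glued (set (zip J I')) x (f x)"
  shows "open_graph (D ;; E) (f ` (W \<union> W')) (rename f (N + N')) (map f I) (map f J')"
proof -
  have p: "pre_graph (D ;; E) (W \<union> W') (set (zip J I')) (N + N') I J'"
    using pre_graph_comp[OF pre_graph_base[OF D] pre_graph_base[OF E] disj len] by simp
  have "f u = f v" if uv: "(u, v) \<in> set (zip J I')" for u v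
  proof -
    obtain i where "i < length J" "u = J ! i" "v = I' ! i"
      using uv len by (auto simp: set_zip)
    then show ?thesis
      using f len by (metis nth_map)
  qed
  then have "glues (W \<union> W') (set (zip J I')) f"
    using g by (rule glues_retract)
  then show ?thesis
    by (rule pre_graph_realise[OF p])
qed

text \<open>Simultaneous substitution, the identity outside \<open>us\<close>. It is the gluing map
  when the fresh wires \<open>us\<close> of a wiring are plugged onto existing wires
  \<open>vs\<close>.\<close>

definition replace_wires :: "nat list \<Rightarrow> nat list \<Rightarrow> nat \<Rightarrow> nat" where
  "replace_wires us vs x = (case map_of (zip us vs) x of None \<Rightarrow> x | Some y \<Rightarrow> y)"

lemma replace_wires_nth:
  assumes "distinct us" "length us = length vs" "i < length us"
  shows "replace_wires us vs (us ! i) = vs ! i"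
  using assms by (simp add: replace_wires_def map_of_zip_nth)

lemma replace_wires_notin: "x \<notin> set us \<Longrightarrow> length us = length vs \<Longrightarrow> replace_wires us vs x = x"
  unfolding replace_wires_def by (subst iffD2[OF map_of_zip_is_None]) simp_all

lemma map_replace_wires:
  assumes "distinct us" "length us = length vs"
  shows "map (replace_wires us vs) us = vs"
  using assms by (intro nth_equalityI) (simp_all add: replace_wires_nth)

lemma map_replace_wires_notin:
  "set xs \<inter> set us = {} \<Longrightarrow> length us = length vs \<Longrightarrow> map (replace_wires us vs) xs = xs"
  by (rule map_idI) (auto intro: replace_wires_notin)

section \<open>Wirings\<close>

primrec is_wiring :: "zx \<Rightarrow> bool" where
  "is_wiring (Spider c m n \<alpha>) = False"
| "is_wiring Hadamard = False"
| "is_wiring (Wires n) = True"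
| "is_wiring Swap = True"
| "is_wiring Cup = False"
| "is_wiring Cap = False"
| "is_wiring (D ;; E) = (is_wiring D \<and> is_wiring E)"
| "is_wiring (D \<otimes> E) = (is_wiring D \<and> is_wiring E)"

text \<open>Polymorphic because it acts both on names of wires, in open graphs, and on bit strings,
  in the denoted linear map.\<close>

primrec permuted :: "zx \<Rightarrow> 'a list \<Rightarrow> 'a list" where
  "permuted (Spider c m n \<alpha>) xs = xs"
| "permuted Hadamard xs = xs"
| "permuted (Wires n) xs = xs"
| "permuted Swap xs = [xs ! 1, xs ! 0]"
| "permuted Cup xs = xs"
| "permuted Cap xs = xs"
| "permuted (D ;; E) xs = permuted E (permuted D xs)"
| "permuted (D \<otimes> E) xs = permuted D (take (ins D) xs) @ permuted E (drop (ins D) xs)"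

lemma is_wiring_outs: "is_wiring D \<Longrightarrow> wf_zx D \<Longrightarrow> outs D = ins D"
  by (induction D) auto

lemma mset_permuted: "is_wiring D \<Longrightarrow> wf_zx D \<Longrightarrow> length xs = ins D \<Longrightarrow> mset (permuted D xs) = mset xs"
proof (induction D arbitrary: xs)
  case Swap
  then obtain a b where "xs = [a, b]"
    by (auto simp: numeral_2_eq_2 length_Suc_conv)
  then show ?case
    by simp
next
  case (Comp D E)
  then have "mset (permuted D xs) = mset xs"
    by simp
  moreover have "length (permuted D xs) = ins E"
    using calculation Comp.prems is_wiring_outs by (metis is_wiring.simps(7) ins.simps(7) size_mset wf_zx.simps(7))
  ultimately show ?case
    using Comp by simp
next
  case (Tensor D E)
  then have "mset (permuted (D \<otimes> E) xs) = mset (take (ins D) xs) + mset (drop (ins D) xs)"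
    by simp
  then show ?case
    by (metis append_take_drop_id mset_append)
qed auto

lemma length_permuted [simp]:
  "is_wiring D \<Longrightarrow> wf_zx D \<Longrightarrow> length xs = ins D \<Longrightarrow> length (permuted D xs) = length xs"
  using mset_permuted mset_eq_length by blast

lemma permuted_map:
  "is_wiring D \<Longrightarrow> wf_zx D \<Longrightarrow> length xs = ins D \<Longrightarrow> permuted D (map f xs) = map f (permuted D xs)"
proof (induction D arbitrary: xs)
  case (Comp D E)
  then have "length (permuted D xs) = ins E"
    by (metis is_wiring_outs length_permuted is_wiring.simps(7) ins.simps(7) wf_zx.simps(7))
  with Comp show ?case
    by simp
qed (auto simp: take_map drop_map)

text \<open>A wiring has no nodes, so plugging it in only reorders the list of outputs. The graph of
  K is an assumption here because the lemma is used inside the induction that constructs it.\<close>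

lemma open_graph_wiring_after_aux:
  assumes A: "open_graph A W N I J" and K: "open_graph K (set us) {#} us (permuted K us)"
    and us: "distinct us" "set us \<inter> W = {}" "length us = length J"
    and w: "is_wiring K" "wf_zx K"
  shows "open_graph (A ;; K) W N I (permuted K J)"
proof -
  let ?f = "replace_wires us J"
  note wf = open_graph_wf[OF A]
  have len: "ins K = length J"
    using open_graph_wf(2)[OF K] us by simp
  have fW: "?f x = x" if "x \<in> W" for x
    using that us by (intro replace_wires_notin) auto
  have fJ: "map ?f J = J" and fI: "map ?f I = I"
    using us wf by (auto intro!: map_replace_wires_notin)
  have fus: "map ?f us = J"
    using us by (simp add: map_replace_wires)
  have fK: "map ?f (permuted K us) = permuted K J"
    using permuted_map[OF w, of us ?f] len us fus by simp
  have glue: "glued (set (zip J us)) x (?f x)" if "x \<in> W \<union> set us" for x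
  proof (cases "x \<in> W")
    case True
    then show ?thesis
      by (simp add: fW)
  next
    case False
    then obtain i where i: "i < length us" "x = us ! i"
      using \<open>x \<in> W \<union> set us\<close> by (auto simp: in_set_conv_nth)
    then have "(J ! i, x) \<in> set (zip J us)"
      using us(3) by (metis in_set_zip fst_conv snd_conv)
    moreover have "?f x = J ! i"
      using i us by (simp add: replace_wires_nth)
    ultimately show ?thesis
      using glued_edge glued_sym by metis
  qed
  have "open_graph (A ;; K) (?f ` (W \<union> set us)) (rename ?f (N + {#})) (map ?f I)
    (map ?f (permuted K us))"
    by (rule open_graph_comp_retract[OF A K]) (use us fJ fus glue in auto)
  moreover have "?f ` (W \<union> set us) = W"
  proof -
    have "?f ` set us = set J"
      using fus by (metis set_map)
    then show ?thesis
      using wf fW by (auto simp: image_Un)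
  qed
  moreover have "rename ?f (N + {#}) = N"
    using rename_nodes_id[OF wf(7) fW] by simp
  ultimately show ?thesis
    by (simp only: fI fK)
qed

lemma open_graph_wiring:
  "is_wiring K \<Longrightarrow> wf_zx K \<Longrightarrow> length xs = ins K \<Longrightarrow> distinct xs \<Longrightarrow>
    open_graph K (set xs) {#} xs (permuted K xs)"
proof (induction K arbitrary: xs)
  case (Wires n)
  then show ?case
    by (auto intro: open_graph.Wires)
next
  case Swap
  then obtain a b where ab: "xs = [a, b]"
    by (auto simp: numeral_2_eq_2 length_Suc_conv)
  then show ?case
    using open_graph.Swap[of a b] Swap by simp
next
  case (Comp D E)
  then have D: "open_graph D (set xs) {#} xs (permuted D xs)"
    by simp
  obtain us :: "nat list" where us: "length us = ins E" "distinct us" "set us \<inter> set xs = {}"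
    using fresh_list[of "set xs"] by auto
  have "length (permuted D xs) = ins E"
    using open_graph_wf(3)[OF D] Comp.prems by simp
  then show ?case
    using open_graph_wiring_after_aux[OF D Comp.IH(2)[of us]] us Comp.prems by simp
next
  case (Tensor D E)
  let ?a = "take (ins D) xs" and ?b = "drop (ins D) xs"
  have "distinct (?a @ ?b)"
    using Tensor.prems by simp
  then have disj: "set ?a \<inter> set ?b = {}"
    by (simp only: distinct_append)
  have "open_graph D (set ?a) {#} ?a (permuted D ?a)" "open_graph E (set ?b) {#} ?b (permuted E ?b)"
    using Tensor by auto
  from open_graph.Tensor[OF this disj] show ?case
    by (simp flip: set_append)
qed auto

lemma open_graph_wiring_after:
  assumes A: "open_graph A W N I J" and w: "is_wiring K" "wf_zx K" "ins K = length J"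
  shows "open_graph (A ;; K) W N I (permuted K J)"
proof -
  obtain us :: "nat list" where us: "length us = ins K" "distinct us" "set us \<inter> W = {}"
    using fresh_list[of W] open_graph_wf(4)[OF A] by auto
  show ?thesis
    by (rule open_graph_wiring_after_aux[OF A open_graph_wiring us(2) us(3) _ w(1,2)]) (use us w in auto)
qed

text \<open>The input list of A is given as a permuted list, so that no inverse permutation has to
  be named.\<close>

lemma open_graph_wiring_before:
  assumes A: "open_graph A W N (permuted K xs) J" and w: "is_wiring K" "wf_zx K" "ins K = length xs"
  shows "open_graph (K ;; A) W N xs J"
proof -
  let ?I = "permuted K xs"
  obtain us :: "nat list" where us: "length us = ins K" "distinct us" "set us \<inter> W = {}"
    using fresh_list[of W] open_graph_wf(4)[OF A] by auto
  have K: "open_graph K (set us) {#} us (permuted K us)"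
    by (rule open_graph_wiring) (use us w in auto)
  let ?f = "replace_wires us xs"
  note wf = open_graph_wf[OF A]
  have fW: "?f x = x" if "x \<in> W" for x
    using that us w by (intro replace_wires_notin) auto
  have fI: "map ?f ?I = ?I" and fJ: "map ?f J = J"
    using us wf w by (auto intro!: map_replace_wires_notin)
  have fus: "map ?f us = xs"
    using us w by (simp add: map_replace_wires)
  have fK: "map ?f (permuted K us) = ?I"
    using permuted_map[OF w(1,2), of us ?f] us fus by simp
  have set_us: "set (permuted K us) = set us"
    using mset_permuted[OF w(1,2), of us] us by (metis mset_eq_setD)
  have glue: "glued (set (zip (permuted K us) ?I)) x (?f x)" if "x \<in> set us \<union> W" for x
  proof (cases "x \<in> W")
    case True
    then show ?thesis
      by (simp add: fW)
  next
    case False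
    then obtain i where i: "i < length (permuted K us)" "x = permuted K us ! i"
      using \<open>x \<in> set us \<union> W\<close> set_us by (metis Un_iff in_set_conv_nth)
    then have "(x, ?f x) \<in> set (zip (permuted K us) ?I)"
      unfolding fK[symmetric] by (force simp: in_set_zip)
    then show ?thesis
      by (rule glued_edge)
  qed
  have "open_graph (K ;; A) (?f ` (set us \<union> W)) (rename ?f ({#} + N)) (map ?f us)
    (map ?f J)"
  proof (rule open_graph_comp_retract[OF K A us(3) _ _ glue])
    show "length (permuted K us) = length ?I"
      using us w by simp
  qed (simp_all add: fI fK)
  moreover have "?f ` (set us \<union> W) = W"
  proof -
    have "mset ?I = mset xs"
      using w by (intro mset_permuted) auto
    then have "set xs \<subseteq> W"
      using wf(5) by (metis mset_eq_setD)
    moreover have "?f ` set us = set xs"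
      using fus by (metis set_map)
    ultimately show ?thesis
      using fW by (auto simp: image_Un)
  qed
  moreover have "rename ?f ({#} + N) = N"
    using rename_nodes_id[OF wf(7) fW] by simp
  ultimately show ?thesis
    by (simp only: fus fJ)
qed

text \<open>Reduces coherence of symmetries to a computation with lists: on the same input names
  both graphs have no nodes and equal outputs.\<close>

lemma same_graph_wiring:
  assumes "is_wiring D" "wf_zx D" "is_wiring E" "wf_zx E" "ins D = ins E"
    and "\<And>xs :: nat list. length xs = ins E \<Longrightarrow> permuted D xs = permuted E xs"
  shows "same_graph D E"
proof -
  obtain us :: "nat list" where us: "length us = ins E" "distinct us"
    using fresh_list[of "{}"] by auto
  show ?thesis
    unfolding same_graph_def
    using open_graph_wiring[of D us] open_graph_wiring[of E us] assms us by metis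
qed

lemma is_wiring_pass [simp]: "is_wiring (pass k)"
  by (induction k) auto

lemma permuted_pass [simp]: "length xs = Suc k \<Longrightarrow> permuted (pass k) xs = drop k xs @ take k xs"
proof (induction k arbitrary: xs)
  case (Suc k)
  then obtain x ys where "xs = x # ys" "length ys = Suc k"
    by (auto simp: length_Suc_conv)
  moreover then obtain y where "drop k ys = [y]"
    by (metis Cons_nth_drop_Suc drop_all lessI order_refl)
  ultimately show ?case
    using Suc.IH[of ys] by (simp add: numeral_2_eq_2)
qed simp

lemma is_wiring_block_swap [simp]: "is_wiring (block_swap k l)"
  by (induction l) auto

lemma permuted_block_swap [simp]:
  "length xs = k + l \<Longrightarrow> permuted (block_swap k l) xs = drop k xs @ take k xs"
proof (induction l arbitrary: xs)
  case (Suc l)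
  define a b where "a = take k xs" and "b = drop k xs"
  have ab: "xs = a @ b" "length a = k" "length b = Suc l"
    using Suc.prems by (auto simp: a_def b_def)
  then obtain y c where "b = y # c" "length c = l"
    by (auto simp: length_Suc_conv)
  then show ?case
    using ab Suc.IH[of "a @ c"] by simp
qed simp

lemma is_wiring_interleave [simp]: "is_wiring (interleave n m)"
  by (induction n) auto

lemma is_wiring_transposition [simp]: "is_wiring (transposition m n)"
  by (induction m) auto

section \<open>Naturality of swaps, units and symmetry of spiders\<close>

lemma same_graph_swap_natural:
  assumes "wf_zx A" "wf_zx B"
  shows "same_graph ((A \<otimes> B) ;; block_swap (outs A) (outs B)) (block_swap (ins A) (ins B) ;; (B \<otimes> A))"
proof -
  obtain W N I J W' N' I' J' where A: "open_graph A W N I J" and B: "open_graph B W' N' I' J'"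
    and disj: "W \<inter> W' = {}"
    using open_graphs3[of A B B] assms by metis
  note wf = open_graph_wf[OF A] open_graph_wf[OF B]
  have 1: "open_graph (A \<otimes> B) (W \<union> W') (N + N') (I @ I') (J @ J')"
    by (rule open_graph.Tensor[OF A B disj])
  have 2: "open_graph (B \<otimes> A) (W \<union> W') (N + N') (permuted (block_swap (ins A) (ins B)) (I @ I')) (J' @ J)"
    using open_graph.Tensor[OF B A] disj wf by (simp add: Un_commute Int_commute add.commute)
  have "open_graph ((A \<otimes> B) ;; block_swap (outs A) (outs B)) (W \<union> W') (N + N') (I @ I') (J' @ J)"
    using open_graph_wiring_after[OF 1, of "block_swap (outs A) (outs B)"] wf by simp
  moreover have "open_graph (block_swap (ins A) (ins B) ;; (B \<otimes> A)) (W \<union> W') (N + N') (I @ I') (J' @ J)"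
    by (rule open_graph_wiring_before[OF 2]) (use wf in simp_all)
  ultimately show ?thesis
    unfolding same_graph_def by blast
qed

lemma same_graph_wires_before:
  assumes "wf_zx D"
  shows "same_graph (Wires (ins D) ;; D) D"
proof -
  obtain W N I J where D: "open_graph D W N I J"
    by (metis open_graph_fresh[OF assms] finite.emptyI)
  have "open_graph (Wires (ins D) ;; D) W N I J"
    by (rule open_graph_wiring_before) (use D open_graph_wf(2)[OF D] in simp_all)
  with D show ?thesis
    unfolding same_graph_def by blast
qed

lemma same_graph_wires_after:
  assumes "wf_zx D"
  shows "same_graph (D ;; Wires (outs D)) D"
proof -
  obtain W N I J where D: "open_graph D W N I J"
    by (metis open_graph_fresh[OF assms] finite.emptyI)
  have "open_graph (D ;; Wires (outs D)) W N I J"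
    using open_graph_wiring_after[OF D, of "Wires (outs D)"] open_graph_wf(3)[OF D] by simp
  with D show ?thesis
    unfolding same_graph_def by blast
qed

lemma same_graph_tensor_empty:
  assumes "wf_zx D"
  shows "same_graph (Wires 0 \<otimes> D) D" "same_graph (D \<otimes> Wires 0) D"
proof -
  obtain W N I J where D: "open_graph D W N I J"
    by (metis open_graph_fresh[OF assms] finite.emptyI)
  have E: "open_graph (Wires 0) {} {#} [] []"
    using open_graph.Wires[of "[]" 0] by simp
  show "same_graph (Wires 0 \<otimes> D) D" "same_graph (D \<otimes> Wires 0) D"
    unfolding same_graph_def using open_graph.Tensor[OF E D] open_graph.Tensor[OF D E] D by auto
qed

lemma open_graph_spider:
  assumes "length xs = m" "length ys = n" "distinct (xs @ ys)"
    and "mset (xs @ ys) = M" "\<alpha> rmod (2 * pi) = \<beta>"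
  shows "open_graph (Spider c m n \<alpha>) (set_mset M) {#(Spider_node c \<beta>, M)#} xs ys"
  using open_graph.Spider[OF assms(1-3), of c \<alpha>] assms(4,5) by (metis set_mset_mset)

text \<open>The legs of a node form a multiset, so a permutation of inputs or of outputs is
  invisible in the graph.\<close>

lemma same_graph_spider_wiring:
  assumes "is_wiring K" "wf_zx K"
  shows "ins K = n \<Longrightarrow> same_graph (Spider c m n \<alpha> ;; K) (Spider c m n \<alpha>)"
    and "ins K = m \<Longrightarrow> same_graph (K ;; Spider c m n \<alpha>) (Spider c m n \<alpha>)"
proof -
  obtain zs :: "nat list" where zs: "length zs = m + n" "distinct zs"
    using fresh_list[of "{}"] by auto
  define xs ys where "xs = take m zs" and "ys = drop m zs"
  have xy: "length xs = m" "length ys = n" "distinct (xs @ ys)"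
    using zs by (auto simp: xs_def ys_def)
  let ?p = "\<alpha> rmod (2 * pi)"
  show "same_graph (Spider c m n \<alpha> ;; K) (Spider c m n \<alpha>)" if "ins K = n"
  proof -
    have ms: "mset (permuted K ys) = mset ys"
      using assms xy that by (intro mset_permuted) auto
    have "open_graph (Spider c m n \<alpha>) (set_mset (mset (xs @ ys))) {#(Spider_node c ?p, mset (xs @ ys))#} xs ys"
      by (rule open_graph_spider) (use xy in auto)
    from open_graph_wiring_after[OF this assms] have
      "open_graph (Spider c m n \<alpha> ;; K) (set_mset (mset (xs @ ys))) {#(Spider_node c ?p, mset (xs @ ys))#} xs
        (permuted K ys)"
      using that xy by simp
    moreover have "open_graph (Spider c m n \<alpha>) (set_mset (mset (xs @ ys)))
      {#(Spider_node c ?p, mset (xs @ ys))#} xs (permuted K ys)"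
    proof (rule open_graph_spider)
      show "distinct (xs @ permuted K ys)"
        using xy ms by (metis distinct_append mset_eq_imp_distinct_iff mset_eq_setD)
      show "length (permuted K ys) = n"
        using ms xy by (metis size_mset)
    qed (use xy ms in auto)
    ultimately show ?thesis
      unfolding same_graph_def by blast
  qed
  show "same_graph (K ;; Spider c m n \<alpha>) (Spider c m n \<alpha>)" if "ins K = m"
  proof -
    have ms: "mset (permuted K xs) = mset xs"
      using assms xy that by (intro mset_permuted) auto
    have "open_graph (Spider c m n \<alpha>) (set_mset (mset (xs @ ys))) {#(Spider_node c ?p, mset (xs @ ys))#}
      (permuted K xs) ys"
    proof (rule open_graph_spider)
      show "distinct (permuted K xs @ ys)"
        using xy ms by (metis distinct_append mset_eq_imp_distinct_iff mset_eq_setD)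
      show "length (permuted K xs) = m"
        using ms xy by (metis size_mset)
    qed (use xy ms in auto)
    from open_graph_wiring_before[OF this assms] have
      "open_graph (K ;; Spider c m n \<alpha>) (set_mset (mset (xs @ ys))) {#(Spider_node c ?p, mset (xs @ ys))#} xs ys"
      using that xy by simp
    moreover have "open_graph (Spider c m n \<alpha>) (set_mset (mset (xs @ ys)))
      {#(Spider_node c ?p, mset (xs @ ys))#} xs ys"
      by (rule open_graph_spider) (use xy in auto)
    ultimately show ?thesis
      unfolding same_graph_def by blast
  qed
qed

lemma same_graph_phase:
  assumes "\<alpha> rmod (2 * pi) = \<beta> rmod (2 * pi)"
  shows "same_graph (Spider c m n \<alpha>) (Spider c m n \<beta>)"
proof -
  obtain zs :: "nat list" where zs: "length zs = m + n" "distinct zs"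
    using fresh_list[of "{}"] by auto
  then have xy: "length (take m zs) = m" "length (drop m zs) = n" "distinct (take m zs @ drop m zs)"
    by auto
  show ?thesis
    unfolding same_graph_def using open_graph.Spider[OF xy] assms by metis
qed

text \<open>With phase 0 the spider on the left is a wire by the identity rule. The cup is therefore
  a two-legged spider of either colour, and this is how the two colours exchange bent wires.\<close>

lemma same_graph_cup: "same_graph (Cup ;; (Wires 1 \<otimes> Spider c 1 1 \<alpha>)) (Spider c 0 2 \<alpha>)"
proof -
  let ?n = "Spider_node c (\<alpha> rmod (2 * pi))"
  have S: "open_graph (Spider c 1 1 \<alpha>) {2, 3} {#(?n, {#2, 3#})#} [2] [3]"
    using open_graph.Spider[of "[2]" 1 "[3]" 1 c \<alpha>] by simp
  have W: "open_graph (Wires 1) {1} {#} [1] [1]"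
    using open_graph.Wires[of "[1]" 1] by simp
  have T: "open_graph (Wires 1 \<otimes> Spider c 1 1 \<alpha>) {1, 2, 3} {#(?n, {#2, 3#})#} [1, 2] [1, 3]"
    using open_graph.Tensor[OF W S] by (simp add: insert_commute)
  \<comment> \<open>Plugging the cup's only wire 0 into the identity wire 1 and the spider's input 2
    makes 0, 1 and 2 one class.\<close>
  let ?f = "\<lambda>x :: nat. if x = 3 then 3 else 0"
  have C: "open_graph Cup {0} {#} [] [0, 0]"
    by (rule open_graph.Cup)
  have "open_graph (Cup ;; (Wires 1 \<otimes> Spider c 1 1 \<alpha>)) (?f ` ({0} \<union> {1, 2, 3}))
    (rename ?f ({#} + {#(?n, {#2, 3#})#})) (map ?f []) (map ?f [1, 3])"
    by (rule open_graph_comp_retract[OF C T]) (auto intro: glued_edge glued_sym)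
  moreover have "open_graph (Spider c 0 2 \<alpha>) {0, 3} {#(?n, {#0, 3#})#} [] [0, 3]"
    using open_graph.Spider[of "[]" 0 "[0, 3]" 2 c \<alpha>] by simp
  ultimately show ?thesis
    unfolding same_graph_def by (auto simp: insert_commute)
qed

lemma same_graph_cap: "same_graph ((Wires 1 \<otimes> Spider c 1 1 \<alpha>) ;; Cap) (Spider c 2 0 \<alpha>)"
proof -
  let ?n = "Spider_node c (\<alpha> rmod (2 * pi))"
  have S: "open_graph (Spider c 1 1 \<alpha>) {3, 2} {#(?n, {#3, 2#})#} [3] [2]"
    using open_graph.Spider[of "[3]" 1 "[2]" 1 c \<alpha>] by simp
  have W: "open_graph (Wires 1) {1} {#} [1] [1]"
    using open_graph.Wires[of "[1]" 1] by simp
  have T: "open_graph (Wires 1 \<otimes> Spider c 1 1 \<alpha>) {1, 2, 3} {#(?n, {#3, 2#})#} [1, 3] [1, 2]"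
    using open_graph.Tensor[OF W S] by (simp add: insert_commute)
  let ?f = "\<lambda>x :: nat. if x = 3 then 3 else 0"
  have C: "open_graph Cap {0} {#} [0, 0] []"
    by (rule open_graph.Cap)
  have "open_graph ((Wires 1 \<otimes> Spider c 1 1 \<alpha>) ;; Cap) (?f ` ({1, 2, 3} \<union> {0}))
    (rename ?f ({#(?n, {#3, 2#})#} + {#})) (map ?f [1, 3]) (map ?f [])"
    by (rule open_graph_comp_retract[OF T C]) (auto intro: glued_edge glued_sym)
  moreover have "open_graph (Spider c 2 0 \<alpha>) {0, 3} {#(?n, {#3, 0#})#} [0, 3] []"
    using open_graph.Spider[of "[0, 3]" 2 "[]" 0 c \<alpha>] by (simp add: add_mset_commute)
  ultimately show ?thesis
    unfolding same_graph_def by (auto simp: insert_commute)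
qed

declare One_nat_def [simp del] add_2_eq_Suc [simp del] add_2_eq_Suc' [simp del]

section \<open>Diagrams modulo the rules\<close>

abbreviation rules :: "zx \<Rightarrow> zx \<Rightarrow> bool" where
  "rules \<equiv> \<lambda>D E. clifford_rule D E \<or> S4_rule D E"

lemma same_graph_wf:
  "same_graph D E \<Longrightarrow> wf_zx D \<and> wf_zx E \<and> ins D = ins E \<and> outs D = outs E"
  unfolding same_graph_def by (metis open_graph_wf(1-3))

lemma transforms_wf:
  "transforms rules D E \<Longrightarrow> wf_zx D \<and> wf_zx E \<and> ins D = ins E \<and> outs D = outs E"
  by (induction rule: transforms.induct)
    (auto dest: clifford_rule_wf S4_rule_wf same_graph_wf)

text \<open>Ill-formed diagrams are only distinguished by their arities.\<close>

definition zx_eq :: "zx \<Rightarrow> zx \<Rightarrow> bool" where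
  "zx_eq D E \<longleftrightarrow> ins D = ins E \<and> outs D = outs E \<and> wf_zx D = wf_zx E \<and>
     (wf_zx D \<longrightarrow> transforms rules D E)"

lemma equivp_zx_eq: "equivp zx_eq"
  by (rule equivpI)
    (auto simp: reflp_def symp_def transp_def zx_eq_def intro: transforms.refl transforms.sym transforms.trans)

quotient_type mor = zx / zx_eq
  by (rule equivp_zx_eq)

lift_definition cls :: "zx \<Rightarrow> mor" is "\<lambda>D. D" .

lift_definition cmp :: "mor \<Rightarrow> mor \<Rightarrow> mor" (infixl \<open>>>\<close> 60) is Comp
  by (auto simp: zx_eq_def intro: transforms.comp)

lift_definition tns :: "mor \<Rightarrow> mor \<Rightarrow> mor" (infixr \<open>||\<close> 70) is Tensor
  by (auto simp: zx_eq_def intro: transforms.tensor)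

lift_definition dom :: "mor \<Rightarrow> nat" is ins
  by (simp add: zx_eq_def)

lift_definition cod :: "mor \<Rightarrow> nat" is outs
  by (simp add: zx_eq_def)

lemma cls_comp: "cls (D ;; E) = cls D >> cls E"
  by transfer (simp add: equivp_reflp[OF equivp_zx_eq])

lemma cls_tensor: "cls (D \<otimes> E) = cls D || cls E"
  by transfer (simp add: equivp_reflp[OF equivp_zx_eq])

lemma dom_cls [simp]: "dom (cls D) = ins D"
  by transfer simp

lemma cod_cls [simp]: "cod (cls D) = outs D"
  by transfer simp

lemma dom_cmp [simp]: "dom (a >> b) = dom a"
  by transfer simp

lemma cod_cmp [simp]: "cod (a >> b) = cod b"
  by transfer simp

lemma dom_tns [simp]: "dom (a || b) = dom a + dom b"
  by transfer simp

lemma cod_tns [simp]: "cod (a || b) = cod a + cod b"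
  by transfer simp

lemma cls_eq_iff: "cls D = cls E \<longleftrightarrow> zx_eq D E"
  by transfer simp

lemma cls_transforms: "cls D = cls E \<Longrightarrow> wf_zx D \<Longrightarrow> transforms rules D E"
  by (simp add: cls_eq_iff zx_eq_def)

lemma cls_eqI: "transforms rules D E \<Longrightarrow> cls D = cls E"
  using transforms_wf[of D E] by (auto simp: cls_eq_iff zx_eq_def)

lemma cls_same_graph: "same_graph D E \<Longrightarrow> cls D = cls E"
  by (intro cls_eqI transforms.connectivity)

lemma cls_clifford: "clifford_rule D E \<Longrightarrow> cls D = cls E"
  by (intro cls_eqI transforms.rule disjI1)

lemma cls_S4: "S4_rule D E \<Longrightarrow> cls D = cls E"
  by (intro cls_eqI transforms.rule disjI2)

section \<open>The laws of a symmetric strict monoidal category\<close>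

definition idm :: "nat \<Rightarrow> mor" where
  "idm n = cls (Wires n)"

definition sp :: "colour \<Rightarrow> nat \<Rightarrow> nat \<Rightarrow> real \<Rightarrow> mor" where
  "sp c m n \<alpha> = cls (Spider c m n \<alpha>)"

definition sw :: "nat \<Rightarrow> nat \<Rightarrow> mor" where
  "sw k l = cls (block_swap k l)"

lemma arity_idm [simp]: "dom (idm n) = n" "cod (idm n) = n"
  by (simp_all add: idm_def)

lemma arity_sp [simp]: "dom (sp c m n \<alpha>) = m" "cod (sp c m n \<alpha>) = n"
  by (simp_all add: sp_def)

lemma arity_sw [simp]: "dom (sw k l) = k + l" "cod (sw k l) = k + l"
  by (simp_all add: sw_def)

text \<open>Ill-formed diagrams of equal arities are already equal in the quotient, so graphs are
  compared only for well-formed ones and the laws below carry no well-formedness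
  assumptions.\<close>

lemma cls_zx_eqI:
  assumes "ins D = ins E" "outs D = outs E" "wf_zx D = wf_zx E" "wf_zx D \<Longrightarrow> same_graph D E"
  shows "cls D = cls E"
  using assms by (auto simp: cls_eq_iff zx_eq_def intro: transforms.connectivity)

lemma cls_surj: "\<exists>D. a = cls D"
  by transfer (use equivp_reflp[OF equivp_zx_eq] in blast)

lemma cmp_assoc: "(a >> b) >> c = a >> (b >> c)"
proof -
  obtain A B C where [simp]: "a = cls A" "b = cls B" "c = cls C"
    using cls_surj by metis
  show ?thesis
    unfolding \<open>a = _\<close> \<open>b = _\<close> \<open>c = _\<close> cls_comp[symmetric]
    by (rule cls_zx_eqI) (auto intro!: same_graph_assoc)
qed

lemma tns_assoc: "(a || b) || c = a || b || c"
proof -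
  obtain A B C where [simp]: "a = cls A" "b = cls B" "c = cls C"
    using cls_surj by metis
  show ?thesis
    unfolding \<open>a = _\<close> \<open>b = _\<close> \<open>c = _\<close> cls_tensor[symmetric]
    by (rule cls_zx_eqI) (auto intro!: same_graph_tensor_assoc)
qed

lemma interchange: "cod a = dom c \<Longrightarrow> (a || b) >> (c || d) = (a >> c) || (b >> d)"
proof -
  assume *: "cod a = dom c"
  obtain A B C D where [simp]: "a = cls A" "b = cls B" "c = cls C" "d = cls D"
    using cls_surj by metis
  show ?thesis
    unfolding \<open>a = _\<close> \<open>b = _\<close> \<open>c = _\<close> \<open>d = _\<close> cls_tensor[symmetric] cls_comp[symmetric]
    by (rule cls_zx_eqI) (use * in \<open>auto intro!: same_graph_interchange\<close>)
qed

lemma idm_cmp [simp]: "n = dom a \<Longrightarrow> idm n >> a = a"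
proof -
  assume *: "n = dom a"
  obtain A where [simp]: "a = cls A"
    using cls_surj by metis
  show ?thesis
    unfolding \<open>a = _\<close> idm_def cls_comp[symmetric] using *
    by (intro cls_zx_eqI) (auto intro!: same_graph_wires_before)
qed

lemma cmp_idm [simp]: "n = cod a \<Longrightarrow> a >> idm n = a"
proof -
  assume *: "n = cod a"
  obtain A where [simp]: "a = cls A"
    using cls_surj by metis
  show ?thesis
    unfolding \<open>a = _\<close> idm_def cls_comp[symmetric] using *
    by (intro cls_zx_eqI) (auto intro!: same_graph_wires_after)
qed

lemma tns_idm_0 [simp]: "idm 0 || a = a" "a || idm 0 = a"
proof -
  obtain A where [simp]: "a = cls A"
    using cls_surj by metis
  show "idm 0 || a = a" "a || idm 0 = a"
    unfolding \<open>a = _\<close> idm_def cls_tensor[symmetric]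
    by (rule cls_zx_eqI; auto intro!: same_graph_tensor_empty)+
qed

lemma sw_natural: "(a || b) >> sw (cod a) (cod b) = sw (dom a) (dom b) >> (b || a)"
proof -
  obtain A B where [simp]: "a = cls A" "b = cls B"
    using cls_surj by metis
  show ?thesis
    unfolding \<open>a = _\<close> \<open>b = _\<close> sw_def cls_tensor[symmetric] cls_comp[symmetric] dom_cls cod_cls
    by (rule cls_zx_eqI) (auto intro!: same_graph_swap_natural)
qed

lemma sw_slide:
  assumes "cod a = k" "cod b = l" "dom a = k'" "dom b = l'"
  shows "(a || b) >> sw k l = sw k' l' >> (b || a)"
  using sw_natural[of a b] assms by simp

lemma wiring_eqI:
  assumes "is_wiring D" "wf_zx D" "is_wiring E" "wf_zx E" "ins D = ins E"
    and "\<And>xs :: nat list. length xs = ins E \<Longrightarrow> permuted D xs = permuted E xs"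
  shows "cls D = cls E"
  by (rule cls_same_graph[OF same_graph_wiring]) (use assms in auto)

lemmas wiring_defs = idm_def sw_def cls_comp[symmetric] cls_tensor[symmetric]

lemma idm_tns: "idm m || idm n = idm (m + n)"
  unfolding wiring_defs by (rule wiring_eqI) auto

lemma sw_0 [simp]: "sw k 0 = idm k" "sw 0 k = idm k"
  unfolding wiring_defs by (rule wiring_eqI; simp)+

lemma sw_sw [simp]: "sw k l >> sw l k = idm (k + l)"
  unfolding wiring_defs by (rule wiring_eqI) auto

lemma cls_pass: "cls (pass k) = sw k 1"
  unfolding wiring_defs by (rule wiring_eqI) auto

lemma take_append_drop_take: "take m xs @ drop m (take (m + n) xs) = take (m + n) xs"
  by (metis append_take_drop_id le_add1 min.absorb1 take_take)

lemma drop_take_append_drop: "drop m (take (m + n) xs) @ drop (m + n) xs = drop m xs"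
  by (metis add.commute append_take_drop_id drop_drop drop_take add_diff_cancel_right')

lemma sw_add_left: "sw (a + b) c = (idm a || sw b c) >> (sw a c || idm b)"
  unfolding wiring_defs
  by (rule wiring_eqI) (auto simp: take_drop add_ac take_append_drop_take)

lemma sw_add_right: "sw a (b + c) = (sw a b || idm c) >> (idm b || sw a c)"
  unfolding wiring_defs
  by (rule wiring_eqI) (auto simp: take_drop add_ac drop_take_append_drop)

lemma sp_wiring_after:
  assumes "is_wiring K" "wf_zx K" "ins K = n"
  shows "sp c m n \<alpha> >> cls K = sp c m n \<alpha>"
  unfolding sp_def cls_comp[symmetric] by (rule cls_same_graph[OF same_graph_spider_wiring(1)]) (use assms in auto)

lemma sp_wiring_before:
  assumes "is_wiring K" "wf_zx K" "ins K = m"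
  shows "cls K >> sp c m n \<alpha> = sp c m n \<alpha>"
  unfolding sp_def cls_comp[symmetric] by (rule cls_same_graph[OF same_graph_spider_wiring(2)]) (use assms in auto)

lemma sp_sw_after: "sp c m (k + l) \<alpha> >> sw k l = sp c m (k + l) \<alpha>"
  unfolding sw_def by (rule sp_wiring_after) auto

lemma sp_sw_before: "sw k l >> sp c (k + l) n \<alpha> = sp c (k + l) n \<alpha>"
  unfolding sw_def by (rule sp_wiring_before) auto

section \<open>Spider laws in the quotient\<close>

lemma sp_fusion:
  assumes "k \<ge> 1"
  shows "(sp c m\<^sub>1 (n\<^sub>1 + k) \<alpha> || idm m\<^sub>2) >> (idm n\<^sub>1 || sp c (k + m\<^sub>2) n\<^sub>2 \<beta>) =
    sp c (m\<^sub>1 + m\<^sub>2) (n\<^sub>1 + n\<^sub>2) (\<alpha> + \<beta>)"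
  using cls_clifford[OF spider_fusion[OF assms, of c m\<^sub>1 n\<^sub>1 \<alpha> m\<^sub>2 n\<^sub>2 \<beta>]]
  by (simp add: cls_comp cls_tensor sp_def idm_def)

lemma sp_identity [simp]: "sp c 1 1 0 = idm 1"
  using cls_clifford[OF identity] by (simp add: sp_def idm_def)

primrec tpw :: "nat \<Rightarrow> mor \<Rightarrow> mor" where
  "tpw 0 a = idm 0"
| "tpw (Suc k) a = a || tpw k a"

lemma tpw_2: "tpw 2 a = a || a"
  by (simp add: numeral_2_eq_2)

lemma cls_tensor_power: "cls (tensor_power k D) = tpw k (cls D)"
  by (induction k) (simp_all add: cls_tensor idm_def)

lemma sp_strong:
  "sp (opp c) m 1 0 >> sp c 1 n 0 = tpw m (sp c 1 n 0) >> cls (transposition m n) >> tpw n (sp (opp c) m 1 0)"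
  using cls_clifford[OF strong_complementarity[of c m n]] by (simp add: cls_comp cls_tensor_power sp_def)

lemma sp_phase: "\<alpha> rmod (2 * pi) = \<beta> rmod (2 * pi) \<Longrightarrow> sp c m n \<alpha> = sp c m n \<beta>"
  unfolding sp_def by (rule cls_same_graph[OF same_graph_phase])

text \<open>Mirror image of the rule: here the first outputs of the upper spider meet the last
  inputs of the lower one. It follows by conjugating with block swaps, which spiders absorb.\<close>

lemma sp_fusion':
  assumes "k \<ge> 1"
  shows "(idm m\<^sub>2 || sp c m\<^sub>1 (k + n\<^sub>1) \<alpha>) >> (sp c (m\<^sub>2 + k) n\<^sub>2 \<beta> || idm n\<^sub>1) =
    sp c (m\<^sub>2 + m\<^sub>1) (n\<^sub>2 + n\<^sub>1) (\<alpha> + \<beta>)"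
proof -
  let ?S = "sp c m\<^sub>1 (k + n\<^sub>1) \<alpha>" and ?T = "sp c (m\<^sub>2 + k) n\<^sub>2 \<beta>"
  have 1: "idm m\<^sub>2 || ?S = sw m\<^sub>2 m\<^sub>1 >> (?S || idm m\<^sub>2) >> sw (k + n\<^sub>1) m\<^sub>2"
    by (simp add: sw_slide[of ?S _ "idm m\<^sub>2" _ m\<^sub>1 m\<^sub>2] cmp_assoc) (simp flip: cmp_assoc)
  have 2: "?T || idm n\<^sub>1 = sw (m\<^sub>2 + k) n\<^sub>1 >> (idm n\<^sub>1 || ?T) >> sw n\<^sub>1 n\<^sub>2"
    by (simp add: sw_slide[of "idm n\<^sub>1" _ ?T _ n\<^sub>1 "m\<^sub>2 + k"] cmp_assoc) (simp flip: cmp_assoc)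
  have 3: "sw (k + n\<^sub>1) m\<^sub>2 >> sw (m\<^sub>2 + k) n\<^sub>1 = (sw k n\<^sub>1 || idm m\<^sub>2) >> (idm n\<^sub>1 || sw k m\<^sub>2)"
    unfolding wiring_defs by (rule wiring_eqI) (auto simp: take_drop add_ac)
  have 4: "(?S || idm m\<^sub>2) >> (sw k n\<^sub>1 || idm m\<^sub>2) = sp c m\<^sub>1 (n\<^sub>1 + k) \<alpha> || idm m\<^sub>2"
    by (simp add: interchange sp_sw_after) (simp add: add.commute)
  have 5: "(idm n\<^sub>1 || sw k m\<^sub>2) >> (idm n\<^sub>1 || ?T) = idm n\<^sub>1 || sp c (k + m\<^sub>2) n\<^sub>2 \<beta>"
    using sp_sw_before[of k m\<^sub>2 c n\<^sub>2 \<beta>] by (simp add: interchange add.commute)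
  have "(idm m\<^sub>2 || ?S) >> (?T || idm n\<^sub>1) = sw m\<^sub>2 m\<^sub>1 >> ((?S || idm m\<^sub>2) >> (sw k n\<^sub>1 || idm m\<^sub>2) >>
      ((idm n\<^sub>1 || sw k m\<^sub>2) >> (idm n\<^sub>1 || ?T))) >> sw n\<^sub>1 n\<^sub>2"
    unfolding 1 2 using 3 by (simp add: cmp_assoc) (simp flip: cmp_assoc)
  also have "\<dots> = sw m\<^sub>2 m\<^sub>1 >> sp c (m\<^sub>1 + m\<^sub>2) (n\<^sub>1 + n\<^sub>2) (\<alpha> + \<beta>) >> sw n\<^sub>1 n\<^sub>2"
    unfolding 4 5 by (simp add: sp_fusion[OF assms])
  also have "\<dots> = sp c (m\<^sub>2 + m\<^sub>1) (n\<^sub>2 + n\<^sub>1) (\<alpha> + \<beta>)"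
    using sp_sw_before[of m\<^sub>2 m\<^sub>1] by (simp add: add.commute cmp_assoc sp_sw_after)
  finally show ?thesis .
qed

text \<open>Valid for both colours, so a bent wire may be fused with Z-spiders or with X-spiders at
  will.\<close>

lemma sp_cup: "sp c 0 2 0 = cls Cup"
  using cls_same_graph[OF same_graph_cup[of c 0]] sp_identity[of c]
  by (simp add: cls_comp cls_tensor sp_def idm_tns flip: idm_def)

lemma sp_cap: "sp c 2 0 0 = cls Cap"
  using cls_same_graph[OF same_graph_cap[of c 0]] sp_identity[of c]
  by (simp add: cls_comp cls_tensor sp_def idm_tns flip: idm_def)

section \<open>The bialgebra of copying and adding\<close>

abbreviation dup :: mor where "dup \<equiv> sp Z 1 2 0"
abbreviation del :: mor where "del \<equiv> sp Z 1 0 0"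
abbreviation add :: mor where "add \<equiv> sp X 2 1 0"
abbreviation zero :: mor where "zero \<equiv> sp X 0 1 0"

lemma dup_coassoc: "dup >> (dup || idm 1) = dup >> (idm 1 || dup)"
proof -
  have "dup >> (idm 1 || dup) = sp Z 1 3 0"
    using sp_fusion[of 1 Z 1 1 0 0 2 0] by simp
  moreover have "dup >> (dup || idm 1) = sp Z 1 3 0"
    using sp_fusion'[of 1 0 Z 1 1 0 2 0] by simp
  ultimately show ?thesis
    by simp
qed

lemma dup_counit: "dup >> (del || idm 1) = idm 1" "dup >> (idm 1 || del) = idm 1"
  using sp_fusion'[of 1 0 Z 1 1 0 0 0] sp_fusion[of 1 Z 1 1 0 0 0 0] sp_identity
  by simp_all

lemma dup_comm: "dup >> sw 1 1 = dup"
  using sp_sw_after[of Z 1 1 1 0] by simp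

lemma add_assoc: "(add || idm 1) >> add = (idm 1 || add) >> add"
proof -
  have "(add || idm 1) >> add = sp X 3 1 0"
    using sp_fusion[of 1 X 2 0 0 1 1 0] by simp
  moreover have "(idm 1 || add) >> add = sp X 3 1 0"
    using sp_fusion'[of 1 1 X 2 0 0 1 0] by simp
  ultimately show ?thesis
    by simp
qed

lemma add_unit: "(zero || idm 1) >> add = idm 1" "(idm 1 || zero) >> add = idm 1"
  using sp_fusion[of 1 X 0 0 0 1 1 0] sp_fusion'[of 1 1 X 0 0 0 1 0] sp_identity
  by simp_all

lemma add_comm: "sw 1 1 >> add = add"
  using sp_sw_before[of 1 1 X 1 0] by simp

lemma transposition_2_2: "cls (transposition 2 2) = idm 1 || sw 1 1 || idm 1"
  unfolding wiring_defs
proof (rule wiring_eqI)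
  fix xs :: "nat list"
  assume "length xs = ins (Wires 1 \<otimes> block_swap 1 1 \<otimes> Wires 1)"
  then obtain a b c d where "xs = [a, b, c, d]"
    by (auto simp: One_nat_def length_Suc_conv)
  then show "permuted (transposition 2 2) xs = permuted (Wires 1 \<otimes> block_swap 1 1 \<otimes> Wires 1) xs"
    by (simp add: numeral_2_eq_2 One_nat_def)
qed auto

lemma transposition_0: "cls (transposition 0 n) = idm 0" "cls (transposition n 0) = idm 0"
proof -
  have "permuted (transposition n 0) xs = []" if "length xs = 0" for xs :: "nat list"
    using length_permuted[of "transposition n 0" xs] that by (simp del: length_permuted)
  then show "cls (transposition 0 n) = idm 0" "cls (transposition n 0) = idm 0"
    unfolding wiring_defs by (auto intro!: wiring_eqI)
qed

text \<open>Strong complementarity with two inputs and two outputs; the cases (2,0) and (0,2) give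
  the compatibility with units below.\<close>

lemma add_dup: "add >> dup = (dup || dup) >> (idm 1 || sw 1 1 || idm 1) >> (add || add)"
  using sp_strong[of Z 2 2] unfolding transposition_2_2 by (simp add: tpw_2)

lemma add_del: "add >> del = del || del"
  using sp_strong[of Z 2 0] unfolding transposition_0 by (simp add: tpw_2)

lemma zero_dup: "zero >> dup = zero || zero"
  using sp_strong[of Z 0 2] unfolding transposition_0 by (simp add: tpw_2)

lemma cls_scalar:
  "wf_zx D \<Longrightarrow> ins D = 0 \<Longrightarrow> outs D = 0 \<Longrightarrow> interp D [] [] \<noteq> 0 \<Longrightarrow> cls D = idm 0"
  unfolding idm_def by (intro cls_eqI transforms.scalar)

lemma lists_length_Suc: "{z :: bool list. length z = Suc n} =
    (#) False ` {z. length z = n} \<union> (#) True ` {z. length z = n}"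
  by (auto simp: length_Suc_conv)

text \<open>The state \<open>zero\<close> denotes |+> + |-> = sqrt 2 |0>, on which the effect has
  value sqrt 2 whatever the phase. This is where the scalar rule enters.\<close>

lemma zero_phase: "zero >> sp Z 1 0 \<alpha> = idm 0"
  unfolding sp_def cls_comp[symmetric]
proof (rule cls_scalar)
  have "{z :: bool list. length z = 1} = {[False], [True]}"
    unfolding One_nat_def lists_length_Suc by auto
  then show "interp (Spider X 0 1 0 ;; Spider Z 1 0 \<alpha>) [] [] \<noteq> 0"
    by (simp add: ket_power_def bra_power_def)
qed auto

text \<open>
  The composite \<open>h = dup >> add\<close> preserves addition and sends the Z-state \<open>u\<close> to \<open>zero\<close>, and
  \<open>x + u = u\<close>. Hence \<open>h\<close> maps \<open>x + u\<close> to \<open>h x\<close> on the one hand and to \<open>zero\<close> on the other.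
\<close>

lemma hopf: "dup >> add = del >> zero"
proof -
  let ?u = "sp Z 0 1 0" and ?h = "dup >> add"
  have X41: "(add || add) >> add = sp X 4 1 0"
  proof -
    have "(add || add) >> add = (add || idm 2) >> ((idm 1 || add) >> add)"
      by (simp add: interchange flip: cmp_assoc)
    also have "(idm 1 || add) >> add = sp X 3 1 0"
      using sp_fusion'[of 1 1 X 2 0 0 1 0] by simp
    also have "(add || idm 2) >> sp X 3 1 0 = sp X 4 1 0"
      using sp_fusion[of 1 X 2 0 0 2 1 0] by simp
    finally show ?thesis .
  qed
  have "(idm 1 || sw 1 1 || idm 1) >> sp X 4 1 0 = sp X 4 1 0"
    unfolding wiring_defs by (rule sp_wiring_before) auto
  then have "add >> ?h = (dup || dup) >> ((add || add) >> add)"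
    by (simp only: cmp_assoc[symmetric] add_dup) (simp only: cmp_assoc X41)
  then have "add >> ?h = (?h || ?h) >> add"
    by (simp only: cmp_assoc[symmetric]) (simp add: interchange)
  \<comment> \<open>The homomorphism property of h, with u plugged in as second summand.\<close>
  then have 1: "(idm 1 || ?u) >> add >> ?h = (?h || (?u >> ?h)) >> add"
    by (simp add: cmp_assoc) (simp add: interchange flip: cmp_assoc)
  \<comment> \<open>The X-spider copies u, by strong complementarity with the colours exchanged.
    Writing \<open>add\<close> with one leg bent, the two copies of u become a discarded input and a
    fresh u.\<close>
  have "?u >> sp X 1 2 0 = ?u || ?u"
    using sp_strong[of X 0 2] unfolding transposition_0 by (simp add: tpw_2)
  moreover have "add = (idm 1 || sp X 1 2 0) >> (sp X 2 0 0 || idm 1)"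
    using sp_fusion'[of 1 1 X 1 1 0 0 0] by simp
  ultimately have "(idm 1 || ?u) >> add = (idm 1 || ?u || ?u) >> (sp X 2 0 0 || idm 1)"
    by (simp add: interchange flip: cmp_assoc)
  also have "\<dots> = ((idm 1 || ?u) || ?u) >> (sp X 2 0 0 || idm 1)"
    by (simp add: tns_assoc)
  also have "\<dots> = ((idm 1 || ?u) >> sp Z 2 0 0) || ?u"
    by (subst interchange) (simp_all add: sp_cap)
  also have "(idm 1 || ?u) >> sp Z 2 0 0 = del"
    using sp_fusion'[of 1 1 Z 0 0 0 0 0] by simp
  also have "del || ?u = del >> ?u"
    using interchange[of del "idm 0" "idm 0" ?u] by simp
  finally have 2: "(idm 1 || ?u) >> add = del >> ?u" .
  \<comment> \<open>Copying the Z-state gives the cup, which is also an X-spider and fuses with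
    \<open>add\<close> along both wires.\<close>
  have "?u >> dup = sp X 0 2 0"
    using sp_fusion[of 1 Z 0 0 0 0 2 0] by (simp add: sp_cup)
  moreover have "sp X 0 2 0 >> add = zero"
    using sp_fusion[of 2 X 0 0 0 0 1 0] by simp
  ultimately have 3: "?u >> ?h = zero"
    by (simp flip: cmp_assoc)
  have "del >> zero = (?h || zero) >> add"
    using 1 unfolding 2 3 by (simp add: cmp_assoc 3[simplified cmp_assoc])
  also have "\<dots> = ?h >> ((idm 1 || zero) >> add)"
    using interchange[of ?h "idm 1" "idm 0" zero] by (simp flip: cmp_assoc)
  also have "\<dots> = ?h"
    by (simp add: add_unit)
  finally show ?thesis ..
qed

section \<open>Copying bundles of wires\<close>

text \<open>The swap carries the second copy of the first wire past the first copy of the others, so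
  the result is two consecutive copies of the whole bundle.\<close>

primrec Dup :: "nat \<Rightarrow> mor" where
  "Dup 0 = idm 0"
| "Dup (Suc n) = (dup || Dup n) >> (idm 1 || sw 1 n || idm n)"

primrec Del :: "nat \<Rightarrow> mor" where
  "Del 0 = idm 0"
| "Del (Suc n) = del || Del n"

lemma arity_Dup [simp]: "dom (Dup n) = n" "cod (Dup n) = n + n"
  by (induction n) auto

lemma arity_Del [simp]: "dom (Del n) = n" "cod (Del n) = 0"
  by (induction n) auto

lemma length_add_conv:
  "length xs = m + n \<longleftrightarrow> (\<exists>ys zs. xs = ys @ zs \<and> length ys = m \<and> length zs = n)"
proof
  assume "length xs = m + n"
  then show "\<exists>ys zs. xs = ys @ zs \<and> length ys = m \<and> length zs = n"
    by (intro exI[of _ "take m xs"] exI[of _ "drop m xs"]) simp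
qed auto

text \<open>With the arity written as a nested sum, \<open>length_add_conv\<close> splits the list
  into blocks, and equality of two block permutations becomes a matter of simplification.\<close>

lemma wiring_blocksI:
  assumes "is_wiring D" "wf_zx D" "is_wiring E" "wf_zx E" "ins D = k" "ins E = k"
    and "\<And>xs :: nat list. length xs = k \<Longrightarrow> permuted D xs = permuted E xs"
  shows "cls D = cls E"
  by (rule wiring_eqI) (use assms in auto)

lemma Dup_Suc: "Dup (1 + n) = (dup || Dup n) >> (idm 1 || sw 1 n || idm n)"
  using Dup.simps(2)[of n] by (simp only: Suc_eq_plus1_left)

lemma Dup_1 [simp]: "Dup 1 = dup"
  using Dup_Suc[of 0] by (simp add: idm_tns)

lemma Del_add: "Del (m + n) = Del m || Del n"
  by (induction m) (simp_all add: tns_assoc)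

lemma Del_1 [simp]: "Del 1 = del"
  by (simp add: One_nat_def)

lemma Dup_add: "Dup (m + n) = (Dup m || Dup n) >> (idm m || sw m n || idm n)"
proof (induction m)
  case 0
  then show ?case
    by (simp add: idm_tns)
next
  case (Suc m)
  let ?Q = "idm m || sw m n || idm n" and ?P = "idm 1 || sw 1 m || idm m"
  have w: "(idm 2 || ?Q) >> (idm 1 || sw 1 (m + n) || idm (m + n))
      = (?P || idm (n + n)) >> (idm (1 + m) || sw (1 + m) n || idm n)"
    unfolding wiring_defs
    by (rule wiring_blocksI[where k = "1 + (1 + (m + (m + (n + n))))"]; (simp only: length_add_conv, elim exE conjE)?; simp)
  have "Dup (Suc m + n) = ((dup >> idm 2) || ((Dup m || Dup n) >> ?Q)) >> (idm 1 || sw 1 (m + n) || idm (m + n))"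
    by (simp add: Suc)
  also have "\<dots> = (dup || Dup m || Dup n) >> ((idm 2 || ?Q) >> (idm 1 || sw 1 (m + n) || idm (m + n)))"
    by (simp only: interchange[symmetric] cod_tns arity_sp arity_idm cmp_assoc)
  also have "\<dots> = (((dup || Dup m) >> ?P) || Dup n) >> (idm (1 + m) || sw (1 + m) n || idm n)"
    unfolding w using interchange[of "dup || Dup m" ?P "Dup n" "idm (n + n)"]
    by (simp add: tns_assoc flip: cmp_assoc)
  finally show ?case
    by (simp add: plus_1_eq_Suc)
qed

lemma Dup_counit_left: "Dup n >> (Del n || idm n) = idm n"
proof (induction n)
  case 0
  then show ?case
    by simp
next
  case (Suc n)
  have 1: "sw 1 n >> (Del n || idm 1) = idm 1 || Del n"
    using sw_slide[of "idm 1" 1 "Del n" 0 1 n] by simp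
  have "(idm 1 || sw 1 n || idm n) >> (Del (Suc n) || idm (Suc n)) =
      (idm 1 || sw 1 n || idm n) >> (del || (Del n || idm 1) || idm n)"
    by (simp add: tns_assoc idm_tns plus_1_eq_Suc)
  also have "\<dots> = del || (idm 1 || Del n) || idm n"
    by (simp add: interchange 1)
  also have "\<dots> = (del || idm 1) || (Del n || idm n)"
    by (simp add: tns_assoc)
  finally have "Dup (Suc n) >> (Del (Suc n) || idm (Suc n)) =
      (dup || Dup n) >> ((del || idm 1) || (Del n || idm n))"
    by (simp add: cmp_assoc)
  also have "\<dots> = idm 1 || idm n"
    using dup_counit Suc by (simp add: interchange)
  finally show ?case
    by (simp add: idm_tns plus_1_eq_Suc)
qed

lemma Dup_comm: "Dup n >> sw n n = Dup n"
proof (induction n)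
  case 0
  then show ?case
    by simp
next
  case (Suc n)
  let ?P = "idm 1 || sw 1 n || idm n"
  have w: "?P >> sw (1 + n) (1 + n) = (sw 1 1 || sw n n) >> ?P"
    unfolding wiring_defs
    by (rule wiring_blocksI[where k = "1 + (1 + (n + n))"]; (simp only: length_add_conv, elim exE conjE)?; simp)
  have "Dup (Suc n) >> sw (Suc n) (Suc n) = (dup || Dup n) >> ((sw 1 1 || sw n n) >> ?P)"
    using w by (simp add: cmp_assoc plus_1_eq_Suc)
  also have "\<dots> = ((dup >> sw 1 1) || (Dup n >> sw n n)) >> ?P"
    by (simp add: interchange flip: cmp_assoc)
  finally show ?case
    by (simp add: Suc dup_comm)
qed

lemma Dup_counit_right: "Dup n >> (idm n || Del n) = idm n"
proof -
  have "(Del n || idm n) >> sw 0 n = sw n n >> (idm n || Del n)"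
    by (rule sw_slide) simp_all
  then have "sw n n >> (idm n || Del n) = Del n || idm n"
    by simp
  then have "Dup n >> sw n n >> (idm n || Del n) = idm n"
    by (simp add: cmp_assoc Dup_counit_left)
  then show ?thesis
    by (simp add: Dup_comm)
qed

text \<open>Coassociativity holds wire by wire; the induction only has to slide the copies past the
  swaps of \<open>Dup\<close> by naturality.\<close>

lemma Dup_coassoc: "Dup n >> (Dup n || idm n) = Dup n >> (idm n || Dup n)"
proof (induction n)
  case 0
  then show ?case
    by simp
next
  case (Suc n)
  let ?P = "idm 1 || sw 1 n || idm n"
  have s1: "sw 1 n >> (Dup n || idm 1) = (idm 1 || Dup n) >> sw 1 (n + n)"
    by (rule sw_slide[symmetric]) simp_all
  have s2: "sw 1 n >> (idm n || dup) = (dup || idm n) >> sw 2 n"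
    by (rule sw_slide[symmetric]) simp_all
  have 1: "?P >> (dup || Dup n || idm (1 + n)) = (dup || idm 1 || Dup n || idm n) >> (idm 2 || sw 1 (n + n) || idm n)"
  proof -
    have "?P >> (dup || (Dup n || idm 1) || idm n) = dup || (sw 1 n >> (Dup n || idm 1)) || idm n"
      by (simp add: interchange)
    also have "\<dots> = (dup || (idm 1 || Dup n) || idm n) >> (idm 2 || sw 1 (n + n) || idm n)"
      unfolding s1 by (simp add: interchange)
    finally show ?thesis
      by (simp add: tns_assoc flip: idm_tns)
  qed
  have 2: "?P >> (idm (1 + n) || dup || Dup n) = (idm 1 || dup || idm n || Dup n) >> (idm 1 || sw 2 n || idm (n + n))"
  proof -
    have "?P >> (idm 1 || (idm n || dup) || Dup n) = idm 1 || (sw 1 n >> (idm n || dup)) || Dup n"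
      by (simp add: interchange)
    also have "\<dots> = (idm 1 || (dup || idm n) || Dup n) >> (idm 1 || sw 2 n || idm (n + n))"
      unfolding s2 by (simp add: interchange)
    finally show ?thesis
      by (simp add: tns_assoc flip: idm_tns)
  qed
  \<comment> \<open>What remains after sliding is a single identity between permutations of the 3n +
    3 wires.\<close>
  have w: "(idm 2 || sw 1 (n + n) || idm n) >> (?P || idm (1 + n)) =
      (idm 1 || sw 2 n || idm (n + n)) >> (idm (1 + n) || ?P)"
    unfolding wiring_defs
    by (rule wiring_blocksI[where k = "1 + (1 + (1 + (n + (n + n))))"]; (simp only: length_add_conv, elim exE conjE)?; simp)
  have e1: "Dup (1 + n) || idm (1 + n) = (dup || Dup n || idm (1 + n)) >> (?P || idm (1 + n))"
    unfolding Dup_Suc using interchange[of "dup || Dup n" ?P "idm (1 + n)" "idm (1 + n)"]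
    by (simp add: tns_assoc)
  have e2: "idm (1 + n) || Dup (1 + n) = (idm (1 + n) || dup || Dup n) >> (idm (1 + n) || ?P)"
    unfolding Dup_Suc by (subst interchange) simp_all
  have "Dup (1 + n) >> (Dup (1 + n) || idm (1 + n)) =
      (dup || Dup n) >> (?P >> (dup || Dup n || idm (1 + n))) >> (?P || idm (1 + n))"
    unfolding e1 unfolding Dup_Suc by (simp only: cmp_assoc)
  also have "\<dots> = ((dup || Dup n) >> ((dup || idm 1) || (Dup n || idm n))) >>
      ((idm 2 || sw 1 (n + n) || idm n) >> (?P || idm (1 + n)))"
    unfolding 1 by (simp only: cmp_assoc tns_assoc)
  also have "\<dots> = ((dup || Dup n) >> ((idm 1 || dup) || (idm n || Dup n))) >>
      ((idm 1 || sw 2 n || idm (n + n)) >> (idm (1 + n) || ?P))"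
    unfolding w using Suc dup_coassoc by (simp add: interchange)
  also have "\<dots> = (dup || Dup n) >> (?P >> (idm (1 + n) || dup || Dup n)) >> (idm (1 + n) || ?P)"
    unfolding 2 by (simp only: cmp_assoc tns_assoc)
  also have "\<dots> = Dup (1 + n) >> (idm (1 + n) || Dup (1 + n))"
    unfolding e2 unfolding Dup_Suc by (simp only: cmp_assoc)
  finally show ?case
    by (simp add: plus_1_eq_Suc)
qed

section \<open>Pairing and copyable morphisms\<close>

text \<open>The pairing of a category with products, but for arbitrary f and g: phase gadgets, which
  are not assumed to be copyable, enter through it as well.\<close>

definition pair :: "nat \<Rightarrow> mor \<Rightarrow> mor \<Rightarrow> mor" where
  "pair n f g = Dup n >> (f || g)"

lemma arity_pair [simp]: "dom (pair n f g) = n" "cod (pair n f g) = cod f + cod g"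
  by (simp_all add: pair_def)

lemma pair_cmp: "cod f = dom a \<Longrightarrow> pair n f g >> (a || b) = pair n (f >> a) (g >> b)"
  by (simp add: pair_def cmp_assoc interchange)

lemma pair_assoc:
  assumes "dom f = n" "dom g = n" "dom h = n"
  shows "pair n (pair n f g) h = pair n f (pair n g h)"
proof -
  have "pair n (pair n f g) h = Dup n >> (Dup n || idm n) >> ((f || g) || h)"
    using assms by (simp add: pair_def cmp_assoc interchange)
  also have "\<dots> = Dup n >> ((idm n || Dup n) >> (f || g || h))"
    by (simp add: Dup_coassoc cmp_assoc tns_assoc)
  also have "\<dots> = pair n f (pair n g h)"
    using assms by (simp add: pair_def interchange)
  finally show ?thesis .
qed

lemma pair_swap:
  assumes "dom f = n" "dom g = n"
  shows "pair n f g >> sw (cod f) (cod g) = pair n g f"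
proof -
  have "pair n f g >> sw (cod f) (cod g) = Dup n >> sw n n >> (g || f)"
    using assms sw_natural[of f g] by (simp add: pair_def cmp_assoc)
  then show ?thesis
    by (simp add: Dup_comm pair_def)
qed

text \<open>Exchanging the components costs a swap with an empty block, that is, nothing.\<close>

lemma pair_comm0:
  assumes "dom f = n" "dom g = n" "cod f = 0"
  shows "pair n f g = pair n g f"
  using pair_swap[OF assms(1,2)] assms(3) by simp

lemma pair_Del [simp]:
  assumes "dom f = n"
  shows "pair n (Del n) f = f" "pair n f (Del n) = f"
proof -
  have "pair n (Del n) f = Dup n >> ((Del n || idm n) >> (idm 0 || f))"
    "pair n f (Del n) = Dup n >> ((idm n || Del n) >> (f || idm 0))"
    using assms by (simp_all only: interchange arity_Del arity_idm) (simp_all add: pair_def assms)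
  then show "pair n (Del n) f = f" "pair n f (Del n) = f"
    using assms Dup_counit_left Dup_counit_right by (simp_all flip: cmp_assoc)
qed

text \<open>Homomorphisms of the copying comonoids. They may be duplicated and discarded like
  classical values.\<close>

definition copyable :: "mor \<Rightarrow> bool" where
  "copyable f \<longleftrightarrow> f >> Dup (cod f) = Dup (dom f) >> (f || f) \<and> f >> Del (cod f) = Del (dom f)"

lemma copyable_Del: "copyable f \<Longrightarrow> cod f = k \<Longrightarrow> dom f = n \<Longrightarrow> f >> Del k = Del n"
  by (auto simp: copyable_def)

lemma copyable_dup: "copyable f \<Longrightarrow> cod f = 1 \<Longrightarrow> dom f = n \<Longrightarrow> f >> dup = pair n f f"
  by (auto simp: copyable_def pair_def)

lemma copyable_idm [simp]: "copyable (idm n)"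
  by (simp add: copyable_def idm_tns)

lemma copyable_cmp [intro]:
  assumes "copyable f" "copyable g" "cod f = dom g"
  shows "copyable (f >> g)"
proof -
  have f: "f >> Dup (dom g) = Dup (dom f) >> (f || f)" and g: "g >> Dup (cod g) = Dup (dom g) >> (g || g)"
    using assms by (simp_all add: copyable_def)
  have "f >> g >> Dup (cod g) = f >> Dup (dom g) >> (g || g)"
    by (simp only: cmp_assoc g)
  also have "\<dots> = Dup (dom f) >> ((f || f) >> (g || g))"
    by (simp only: cmp_assoc f)
  finally show ?thesis
    using assms by (auto simp: copyable_def interchange cmp_assoc)
qed

lemma copyable_tns [intro]:
  assumes "copyable f" "copyable g"
  shows "copyable (f || g)"
proof -
  let ?k = "cod f" and ?l = "cod g" and ?m = "dom f" and ?n = "dom g"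
  have s: "(f || g) >> sw ?k ?l = sw ?m ?n >> (g || f)"
    by (rule sw_natural)
  have s': "((f || f) || (g || g)) >> (idm ?k || sw ?k ?l || idm ?l) =
      (idm ?m || sw ?m ?n || idm ?n) >> (f || g) || (f || g)"
  proof -
    have "((f || f) || (g || g)) >> (idm ?k || sw ?k ?l || idm ?l) =
        (f || (f || g) || g) >> (idm ?k || sw ?k ?l || idm ?l)"
      by (simp add: tns_assoc)
    also have "\<dots> = f || ((f || g) >> sw ?k ?l) || g"
      by (simp add: interchange)
    also have "\<dots> = (idm ?m || sw ?m ?n || idm ?n) >> (f || (g || f) || g)"
      unfolding s by (simp add: interchange)
    finally show ?thesis
      by (simp add: tns_assoc)
  qed
  have "(f || g) >> Dup (?k + ?l) = ((f >> Dup ?k) || (g >> Dup ?l)) >> (idm ?k || sw ?k ?l || idm ?l)"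
    by (simp add: Dup_add interchange flip: cmp_assoc)
  also have "\<dots> = (Dup ?m || Dup ?n) >> (((f || f) || (g || g)) >> (idm ?k || sw ?k ?l || idm ?l))"
    using assms by (simp add: copyable_def interchange flip: cmp_assoc)
  also have "\<dots> = Dup (?m + ?n) >> (f || g) || (f || g)"
    unfolding s' by (simp add: Dup_add cmp_assoc)
  finally show ?thesis
    using assms by (simp add: copyable_def Del_add interchange)
qed

text \<open>Holds because the comonoid is coassociative and cocommutative: the four copies are
  rebracketed until the middle swap meets a single \<open>Dup\<close>, which absorbs it.\<close>

lemma copyable_Dup [simp]: "copyable (Dup n)"
proof -
  let ?D = "Dup n" and ?I = "idm n"
  have "?D >> (?D || ?D) = ?D >> (?D || ?I) >> ((?I || ?I) || ?D)"
    by (simp add: cmp_assoc interchange idm_tns)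
  also have "\<dots> = ?D >> ((?I || ?D) >> (?I || ?I || ?D))"
    by (simp add: Dup_coassoc cmp_assoc tns_assoc)
  also have "\<dots> = ?D >> (?I || (?D >> (?D || ?I)))"
    by (simp add: interchange Dup_coassoc)
  finally have 1: "?D >> (?D || ?D) = ?D >> (?I || (?D >> (?D || ?I)))" .
  have "?D >> Dup (n + n) = ?D >> (?D || ?D) >> (?I || sw n n || ?I)"
    by (simp add: Dup_add cmp_assoc)
  also have "\<dots> = ?D >> (?I || (?D >> ((?D >> sw n n) || ?I)))"
    unfolding 1 by (simp add: cmp_assoc interchange)
  also have "\<dots> = ?D >> (?D || ?D)"
    unfolding 1 Dup_comm ..
  finally have "?D >> Dup (n + n) = ?D >> (?D || ?D)" .
  moreover have "?D >> Del (n + n) = Del n"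
    using pair_Del[of "Del n" n] by (simp add: pair_def Del_add)
  ultimately show ?thesis
    by (simp add: copyable_def)
qed

lemma copyable_Del_self [simp]: "copyable (Del n)"
  using pair_Del[of "Del n" n] by (simp add: copyable_def pair_def)

lemma copyable_add [simp]: "copyable add"
proof -
  have "Dup 2 = (dup || dup) >> (idm 1 || sw 1 1 || idm 1)" "Del 2 = del || del"
    using Dup_add[of 1 1] Del_add[of 1 1] by simp_all
  then show ?thesis
    by (simp add: copyable_def add_dup add_del)
qed

lemma copyable_zero [simp]: "copyable zero"
  by (simp add: copyable_def zero_dup zero_phase)

lemma copyable_pairI [intro]:
  "copyable f \<Longrightarrow> copyable g \<Longrightarrow> dom f = n \<Longrightarrow> dom g = n \<Longrightarrow> copyable (pair n f g)"
  unfolding pair_def by (intro copyable_cmp copyable_tns copyable_Dup) simp_all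

section \<open>The group of parities\<close>

definition plus_par :: "nat \<Rightarrow> mor \<Rightarrow> mor \<Rightarrow> mor" where
  "plus_par n f g = pair n f g >> add"

definition zero_par :: "nat \<Rightarrow> mor" where
  "zero_par n = Del n >> zero"

definition par :: "nat \<Rightarrow> mor \<Rightarrow> bool" where
  "par n f \<longleftrightarrow> copyable f \<and> dom f = n \<and> cod f = 1"

lemma par_arity: "par n f \<Longrightarrow> dom f = n" "par n f \<Longrightarrow> cod f = 1"
  by (simp_all add: par_def)

lemma par_zero [simp]: "par n (zero_par n)"
  unfolding par_def zero_par_def by (auto intro!: copyable_cmp)

lemma par_plus [intro]: "par n f \<Longrightarrow> par n g \<Longrightarrow> par n (plus_par n f g)"
  unfolding par_def plus_par_def by (auto intro!: copyable_cmp copyable_pairI)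

lemma plus_par_comm: "par n f \<Longrightarrow> par n g \<Longrightarrow> plus_par n f g = plus_par n g f"
  using pair_swap[of f n g] add_comm
  by (simp add: par_def plus_par_def) (metis cmp_assoc)

lemma plus_par_assoc:
  assumes "par n f" "par n g" "par n h"
  shows "plus_par n (plus_par n f g) h = plus_par n f (plus_par n g h)"
proof -
  have "plus_par n (plus_par n f g) h = pair n (pair n f g) h >> ((add || idm 1) >> add)"
    using assms by (simp add: par_def plus_par_def pair_cmp flip: cmp_assoc)
  also have "\<dots> = pair n f (pair n g h) >> ((idm 1 || add) >> add)"
    using assms by (simp add: par_def pair_assoc add_assoc)
  also have "\<dots> = plus_par n f (plus_par n g h)"
    using assms by (simp add: par_def plus_par_def pair_cmp flip: cmp_assoc)
  finally show ?thesis .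
qed

lemma plus_par_zero:
  assumes "par n f"
  shows "plus_par n f (zero_par n) = f" "plus_par n (zero_par n) f = f"
proof -
  have "plus_par n f (zero_par n) = pair n f (Del n) >> (idm 1 || zero) >> add"
    using assms by (simp add: par_def plus_par_def pair_cmp zero_par_def del: pair_Del)
  then show 1: "plus_par n f (zero_par n) = f"
    using assms by (simp add: par_def cmp_assoc add_unit)
  show "plus_par n (zero_par n) f = f"
    using plus_par_comm[of n f "zero_par n"] assms 1 by simp
qed

text \<open>The Hopf law, once copyability has pulled f in front of the duplication.\<close>

lemma plus_par_self: "par n f \<Longrightarrow> plus_par n f f = zero_par n"
  using copyable_dup[of f n] copyable_Del[of f 1 n]
  by (auto simp: par_def plus_par_def zero_par_def hopf cmp_assoc simp flip: cmp_assoc)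
    (metis cmp_assoc hopf)

lemma cmp_reassoc: "a >> b = c \<Longrightarrow> a >> (b >> d) = c >> d"
  by (simp flip: cmp_assoc)

section \<open>Spider nests\<close>

abbreviation mrg :: mor where "mrg \<equiv> sp Z 2 1 0"
abbreviation bend :: mor where "bend \<equiv> sp Z 2 0 0"

primrec Mrg :: "nat \<Rightarrow> mor" where
  "Mrg 0 = idm 0"
| "Mrg (Suc k) = (idm 1 || sw k 1 || idm k) >> (mrg || Mrg k)"

text \<open>Joins the i-th wires of two blocks by caps. Both blocks keep the same order, unlike in
  nested caps, hence the swaps.\<close>

primrec Bend :: "nat \<Rightarrow> mor" where
  "Bend 0 = idm 0"
| "Bend (Suc k) = (idm 1 || sw k 1 || idm k) >> (bend || Bend k)"

lemma arity_Mrg [simp]: "dom (Mrg k) = k + k" "cod (Mrg k) = k"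
  by (induction k) auto

lemma arity_Bend [simp]: "dom (Bend k) = k + k" "cod (Bend k) = 0"
  by (induction k) auto

lemma permuted_interleave_0: "length xs = n \<Longrightarrow> permuted (interleave n 0) xs = xs"
  by (induction n arbitrary: xs) (auto simp: One_nat_def length_Suc_conv)

lemma cls_transposition_2: "cls (transposition 2 n) >> tpw n mrg = Mrg n"
proof -
  have "cls (transposition 2 n) = cls (interleave n 1)"
    by (rule wiring_eqI) (auto simp: numeral_2_eq_2 One_nat_def permuted_interleave_0 length_permuted)
  moreover have "cls (interleave n 1) >> tpw n mrg = Mrg n"
  proof (induction n)
    case 0
    then show ?case
      by (simp flip: idm_def)
  next
    case (Suc n)
    have "cls (interleave (Suc n) 1) = (idm 1 || sw n 1 || idm n) >> (idm 2 || cls (interleave n 1))"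
      by (simp add: cls_comp cls_tensor idm_def sw_def)
    then show ?case
      using Suc by (simp add: cmp_assoc interchange)
  qed
  ultimately show ?thesis
    by simp
qed

definition nest :: "nat \<Rightarrow> mor" where
  "nest k = cls (spider_nest k)"

abbreviation tee :: mor where "tee \<equiv> sp Z 1 0 (pi / 4)"

lemma arity_nest [simp]: "dom (nest k) = 1" "cod (nest k) = k"
  by (simp_all add: nest_def)

lemma nest_0 [simp]: "nest 0 = tee"
  by (simp add: nest_def sp_def)

text \<open>Regrouped so that the two smaller nests stand side by side and are merged at once, the
  form to which \<open>Mrg_Bend\<close> applies.\<close>

lemma nest_Suc:
  "nest (Suc k) = dup >> (idm 1 || sp X 1 2 0) >> (((nest k || nest k) >> Mrg k) || idm 1)"
proof -
  have "nest (Suc k) = dup >> (nest k || (sp X 1 2 0 >> (nest k || idm 1))) >> (Mrg k || idm 1)"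
    using cls_transposition_2[of k]
    by (simp add: nest_def sp_def cls_comp cls_tensor cls_tensor_power flip: idm_def)
  also have "nest k || (sp X 1 2 0 >> (nest k || idm 1)) =
      (idm 1 || sp X 1 2 0) >> ((nest k || nest k) || idm 1)"
    by (simp add: interchange tns_assoc)
  finally show ?thesis
    by (simp add: cmp_assoc interchange)
qed

text \<open>Both sides are the three-legged Z-effect: seen from the bent side, merging two wires is
  copying one.\<close>

lemma mrg_bend: "(mrg || idm 1) >> bend = (idm 2 || dup) >> ((idm 1 || sw 1 1 || idm 1) >> (bend || bend))"
proof -
  have a: "(idm 1 || dup) >> (bend || idm 1) = mrg"
    using sp_fusion'[of 1 1 Z 1 1 0 0 0] by simp
  have b: "bend || idm 1 = sw 2 1 >> (idm 1 || bend)"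
    using sw_slide[of bend 0 "idm 1" 1 2 1] by simp
  have c: "sw 2 1 = (idm 1 || sw 1 1) >> (sw 1 1 || idm 1)"
    using sw_add_left[of 1 1 1] by simp
  have d: "(idm 1 || dup) >> (idm 1 || sw 1 1) = idm 1 || dup"
    by (simp add: interchange dup_comm)
  have e: "(idm 1 || dup) >> (bend || idm 1) = (idm 1 || dup) >> ((sw 1 1 || idm 1) >> (idm 1 || bend))"
    unfolding b c cmp_assoc by (rule cmp_reassoc[OF d])
  have "(mrg || idm 1) >> bend = sp Z 3 0 0"
    using sp_fusion[of 1 Z 2 0 0 1 0 0] by simp
  also have "\<dots> = (idm 1 || mrg) >> bend"
    using sp_fusion'[of 1 1 Z 2 0 0 0 0] by simp
  also have "\<dots> = (idm 1 || (idm 1 || dup)) >> (idm 1 || sw 1 1 || idm 1) >> ((idm 1 || (idm 1 || bend)) >> bend)"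
    unfolding a[symmetric] e by (simp add: interchange flip: cmp_assoc)
  also have "(idm 1 || (idm 1 || bend)) >> bend = bend || bend"
    using interchange[of "idm 2" bend bend "idm 0"] by (simp flip: tns_assoc add: idm_tns)
  finally show ?thesis
    by (simp add: cmp_assoc idm_tns flip: tns_assoc)
qed

text \<open>The bundle version of \<open>mrg_bend\<close>: transposing the merging of two blocks
  gives their duplication. The induction separates the first wires from the rest by naturality of
  swaps.\<close>

lemma Mrg_Bend:
  "(Mrg k || idm k) >> Bend k = (idm (k + k) || Dup k) >> ((idm k || sw k k || idm k) >> (Bend k || Bend k))"
proof (induction k)
  case 0
  then show ?case
    by simp
next
  case (Suc k)
  let ?M = "Mrg k" and ?C = "Bend k" and ?P = "idm 1 || sw k 1 || idm k"
  have M: "Mrg (1 + k) = ?P >> (mrg || ?M)" and C: "Bend (1 + k) = ?P >> (bend || ?C)"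
    by (simp_all add: plus_1_eq_Suc)
  have s1: "(?M || idm 1) >> sw k 1 = sw (k + k) 1 >> (idm 1 || ?M)"
    by (rule sw_slide) simp_all
  have s2: "sw (k + k) 1 >> (dup || idm (k + k)) = (idm (k + k) || dup) >> sw (k + k) 2"
    by (rule sw_slide[symmetric]) simp_all
  have s3: "?C || bend = sw (k + k) 2 >> (bend || ?C)"
    using sw_slide[of ?C 0 bend 0 "k + k" 2] by simp
  let ?w0 = "idm 1 || sw k 1 || idm (k + (1 + k))"
  let ?w0' = "idm 1 || sw k 1 || idm (k + (1 + 1 + (k + k)))"
  let ?w = "(idm 1 || sw 1 1 || idm 1) || (idm k || sw k k || idm k)"
  have "(Mrg (1 + k) || idm (1 + k)) >> Bend (1 + k) =
      (?P || idm (1 + k)) >> ((mrg || ?M) || idm (1 + k)) >> (?P >> (bend || ?C))"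
    unfolding M C using interchange[of ?P "mrg || ?M" "idm (1 + k)" "idm (1 + k)"] by simp
  also have "\<dots> = (?P || idm (1 + k)) >> (mrg || ((?M || idm 1) >> sw k 1) || idm k) >> (bend || ?C)"
  proof -
    have "((mrg || ?M) || idm (1 + k)) >> ?P = (mrg || (?M || idm 1) || idm k) >> ?P"
      by (simp add: tns_assoc flip: idm_tns)
    also have "\<dots> = mrg || ((?M || idm 1) >> sw k 1) || idm k"
      by (simp add: interchange)
    finally have c: "((mrg || ?M) || idm (1 + k)) >> ?P = mrg || ((?M || idm 1) >> sw k 1) || idm k" .
    show ?thesis
      unfolding cmp_assoc cmp_reassoc[OF c] ..
  qed
  also have "\<dots> = (?P || idm (1 + k)) >> (idm 2 || sw (k + k) 1 || idm k) >> ((mrg || (idm 1 || ?M) || idm k) >> (bend || ?C))"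
  proof -
    have "mrg || (sw (k + k) 1 >> (idm 1 || ?M)) || idm k = (idm 2 || sw (k + k) 1 || idm k) >> (mrg || (idm 1 || ?M) || idm k)"
      by (simp add: interchange)
    then show ?thesis
      unfolding s1 by (simp only: cmp_assoc)
  qed
  also have "(mrg || (idm 1 || ?M) || idm k) >> (bend || ?C) = ((mrg || idm 1) >> bend) || ((?M || idm k) >> ?C)"
    using interchange[of "mrg || idm 1" bend "?M || idm k" ?C] by (simp add: tns_assoc)
  also have "\<dots> = ((idm 2 || dup) || (idm (k + k) || Dup k)) >> (?w >> ((bend || bend) || (?C || ?C)))"
    unfolding mrg_bend Suc by (simp add: interchange)
  also have "(?P || idm (1 + k)) >> (idm 2 || sw (k + k) 1 || idm k) >> \<dots> =
     (?P || idm (1 + k)) >> ((idm 2 || (sw (k + k) 1 >> (dup || idm (k + k))) || Dup k) >> (?w >> ((bend || bend) || (?C || ?C))))"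
  proof -
    have "(idm 2 || sw (k + k) 1 || idm k) >> ((idm 2 || dup) || (idm (k + k) || Dup k)) =
        (idm 2 || sw (k + k) 1 || idm k) >> (idm 2 || (dup || idm (k + k)) || Dup k)"
      by (simp add: tns_assoc)
    also have "\<dots> = idm 2 || (sw (k + k) 1 >> (dup || idm (k + k))) || Dup k"
      by (simp add: interchange)
    finally show ?thesis
      by (simp only: cmp_assoc[symmetric])  (simp only: cmp_assoc)
  qed
  also have "\<dots> = ((?P || idm (1 + k)) >> (idm (2 + (k + k)) || (dup || Dup k))) >>
      ((idm 2 || sw (k + k) 2 || idm (k + k)) >> (?w >> ((bend || bend) || (?C || ?C))))"
  proof -
    have "idm 2 || ((idm (k + k) || dup) >> sw (k + k) 2) || Dup k =
        (idm 2 || (idm (k + k) || dup) || Dup k) >> (idm 2 || sw (k + k) 2 || idm (k + k))"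
      by (simp add: interchange)
    also have "idm 2 || (idm (k + k) || dup) || Dup k = idm (2 + (k + k)) || (dup || Dup k)"
      by (simp only: tns_assoc idm_tns[of 2 "k + k", symmetric])
    finally show ?thesis
      unfolding s2 by (simp only: cmp_assoc)
  qed
  also have "(?P || idm (1 + k)) >> (idm (2 + (k + k)) || (dup || Dup k)) =
     (idm (2 + (k + k)) || (dup || Dup k)) >> (?P || idm (2 + (k + k)))"
    by (simp add: interchange)
  finally have L: "(Mrg (1 + k) || idm (1 + k)) >> Bend (1 + k) =
     (idm (2 + (k + k)) || (dup || Dup k)) >> (((?P || idm (2 + (k + k))) >>
       (idm 2 || sw (k + k) 2 || idm (k + k)) >> ?w) >> ((bend || bend) || (?C || ?C)))"
    by (simp only: cmp_assoc)
  have CC: "Bend (1 + k) || Bend (1 + k) = (?P || ?P) >> ((idm 2 || sw (k + k) 2 || idm (k + k)) >> ((bend || bend) || (?C || ?C)))"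
  proof -
    have "Bend (1 + k) || Bend (1 + k) = (?P || ?P) >> (bend || (?C || bend) || ?C)"
      unfolding C using interchange[of ?P "bend || ?C" ?P "bend || ?C"] by (simp add: tns_assoc)
    also have "bend || (?C || bend) || ?C = (idm 2 || sw (k + k) 2 || idm (k + k)) >> (bend || (bend || ?C) || ?C)"
      unfolding s3 by (simp add: interchange)
    finally show ?thesis
      by (simp add: tns_assoc)
  qed
  have D: "idm (1 + k + (1 + k)) || Dup (1 + k) =
      (idm (2 + (k + k)) || (dup || Dup k)) >> (idm (2 + (k + k)) || (idm 1 || sw 1 k || idm k))"
  proof -
    have e: "1 + k + (1 + k) = 2 + (k + k)"
      by simp
    show ?thesis
      unfolding Dup_Suc e by (simp add: interchange)
  qed
  \<comment> \<open>The whole bookkeeping of the induction step, as one permutation of 4k + 4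
    wires.\<close>
  have w: "(?P || idm (2 + (k + k))) >> (idm 2 || sw (k + k) 2 || idm (k + k)) >> ?w =
     (idm (2 + (k + k)) || (idm 1 || sw 1 k || idm k)) >> (idm (1 + k) || sw (1 + k) (1 + k) || idm (1 + k)) >>
     (?P || ?P) >> (idm 2 || sw (k + k) 2 || idm (k + k))"
    unfolding wiring_defs
    by (rule wiring_blocksI[where k = "1 + (k + (1 + (k + (1 + (1 + (k + k))))))"];
        (simp only: length_add_conv, elim exE conjE)?; simp)
  show ?case
    using L unfolding w by (simp only: plus_1_eq_Suc[symmetric] D CC cmp_assoc)
qed

text \<open>As an effect on 1 + k inputs the nest can be precomposed with parities: the first input
  receives the base b, the others the summands.\<close>

definition bent_nest :: "nat \<Rightarrow> mor" where
  "bent_nest k = (nest k || idm k) >> Bend k"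

lemma arity_bent_nest [simp]: "dom (bent_nest k) = 1 + k" "cod (bent_nest k) = 0"
  by (simp_all add: bent_nest_def)

lemma Bend_add: "Bend (m + n) = (idm m || sw n m || idm n) >> (Bend m || Bend n)"
proof (induction m)
  case 0
  then show ?case
    by (simp add: idm_tns)
next
  case (Suc m)
  let ?P = "idm 1 || sw m 1 || idm m" and ?Q = "idm m || sw n m || idm n"
  have w: "(idm 1 || sw (m + n) 1 || idm (m + n)) >> (idm 2 || ?Q) =
     (idm (1 + m) || sw n (1 + m) || idm n) >> (?P || idm (n + n))"
    unfolding wiring_defs
    by (rule wiring_blocksI[where k = "1 + (m + (n + (1 + (m + n))))"];
        (simp only: length_add_conv, elim exE conjE)?; simp)
  have "Bend (1 + m + n) = (idm 1 || sw (m + n) 1 || idm (m + n)) >> (bend || (?Q >> (Bend m || Bend n)))"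
    using Suc by (simp add: add.assoc) (simp add: plus_1_eq_Suc)
  also have "bend || (?Q >> (Bend m || Bend n)) = (idm 2 || ?Q) >> (bend || Bend m || Bend n)"
    by (simp add: interchange)
  also have "(idm 1 || sw (m + n) 1 || idm (m + n)) >> \<dots> =
     (idm (1 + m) || sw n (1 + m) || idm n) >> ((?P || idm (n + n)) >> ((bend || Bend m) || Bend n))"
    using w by (simp add: tns_assoc flip: cmp_assoc)
  also have "(?P || idm (n + n)) >> ((bend || Bend m) || Bend n) = Bend (1 + m) || Bend n"
    by (simp add: interchange) (simp add: plus_1_eq_Suc)
  finally show ?case
    by (simp add: plus_1_eq_Suc)
qed

lemma Bend_1: "Bend 1 = bend"
  by (simp add: One_nat_def) (simp add: idm_tns flip: One_nat_def)

text \<open>Bending turns the merges into copies and the X-spider with its free output into an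
  addition. The effect thus copies the base wire, adds the last bent wire to one copy, and applies
  the smaller effect to both copies with the remaining bent wires shared.\<close>

lemma bent_nest_Suc:
  "bent_nest (k + 1) = (dup || sw k 1) >> (idm 1 || add || idm k) >>
     ((idm 2 || Dup k) >> ((idm 1 || sw 1 k || idm k) >> (bent_nest k || bent_nest k)))"
proof -
  let ?C = "Bend k" and ?s = "nest k"
  let ?K = "(?s || ?s) >> Mrg k"
  let ?H = "dup >> (idm 1 || sp X 1 2 0)"
  have nest: "nest (k + 1) = ?H >> (?K || idm 1)"
    using nest_Suc[of k] by (simp only: Suc_eq_plus1)
  \<comment> \<open>The cap is also an X-spider, so bending an output leg of an X-spider is
    fusion.\<close>
  have add: "(sp X 1 2 0 || idm 1) >> (idm 1 || bend) = add"
    using sp_fusion[of 1 X 1 1 0 1 0 0] by (simp add: sp_cap)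
  have s0: "bend || idm k = (idm 1 || sw 1 k) >> (sw 1 k || idm 1) >> (idm k || bend)"
    using sw_slide[of bend 0 "idm k" k 2 k] sw_add_left[of 1 1 k] by simp
  have s1: "(sw 1 k || idm 1) >> (idm k || bend) = (idm 1 || sw k 1) >> (bend || idm k)"
  proof -
    have "(idm 1 || sw k 1) >> (idm 1 || sw 1 k) = idm (1 + (k + 1))"
      by (simp add: interchange idm_tns)
    then show ?thesis
      unfolding s0 by (simp flip: cmp_assoc)
  qed
  have s2: "(?K || idm 1 || idm k || idm 1) >> (idm k || sw 1 k || idm 1) =
      (idm 2 || sw 1 k || idm 1) >> ((?K || idm k) || idm 2)"
  proof -
    have "(?K || (idm 1 || idm k) || idm 1) >> (idm k || sw 1 k || idm 1) =
        (idm 2 || sw 1 k || idm 1) >> (?K || (idm k || idm 1) || idm 1)"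
      by (simp add: interchange idm_tns)
    then show ?thesis
      by (simp add: tns_assoc idm_tns add.assoc)
  qed
  have s3: "((?K || idm k) || idm 2) >> (?C || bend) = (idm (2 + k) || bend) >> ((?K || idm k) >> ?C)"
    using interchange[of "idm (2 + k)" "(?K || idm k) >> ?C" bend "idm 0"] by (simp add: interchange)
  have s4: "(idm 2 || sw 1 k || idm 1) >> (idm (2 + k) || bend) = (idm 2 || idm 1 || sw k 1) >> (idm 2 || bend || idm k)"
  proof -
    have "(idm 2 || sw 1 k || idm 1) >> (idm (2 + k) || bend) = idm 2 || ((sw 1 k || idm 1) >> (idm k || bend))"
      using interchange[of "idm 2" "idm 2" "sw 1 k || idm 1" "idm k || bend"] by (simp add: tns_assoc flip: idm_tns)
    then show ?thesis
      unfolding s1 by (simp add: interchange)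
  qed
  have s5: "(?H || idm k || idm 1) >> ((idm 2 || idm 1 || sw k 1) >> (idm 2 || bend || idm k)) =
      (dup || sw k 1) >> (idm 1 || add || idm k)"
  proof -
    have "(?H || (idm k || idm 1)) >> ((idm 2 || idm 1) || sw k 1) = (dup || sw k 1) >> ((idm 1 || sp X 1 2 0) || (idm 1 || idm k))"
      by (simp add: interchange idm_tns)
    then have "(?H || idm k || idm 1) >> ((idm 2 || idm 1 || sw k 1) >> (idm 2 || bend || idm k)) =
        (dup || sw k 1) >> ((idm 1 || (sp X 1 2 0 || idm 1) || idm k) >> (idm 2 || bend || idm k))"
      by (simp add: tns_assoc flip: cmp_assoc)
    also have "(idm 1 || (sp X 1 2 0 || idm 1) || idm k) >> (idm 2 || bend || idm k) = idm 1 || add || idm k"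
    proof -
      have "idm 2 || bend || idm k = idm 1 || (idm 1 || bend) || idm k"
        using idm_tns[of 1 1] by (simp flip: tns_assoc)
      then show ?thesis
        by (simp add: interchange add)
    qed
    finally show ?thesis .
  qed
  \<comment> \<open>\<open>Mrg_Bend\<close> replaces the merge of the two nests by a duplication of
    the bent wires, one copy for each nest.\<close>
  have s6: "(?K || idm k) >> ?C = (idm 2 || Dup k) >> ((idm 1 || sw 1 k || idm k) >> (bent_nest k || bent_nest k))"
  proof -
    have slide: "(?s || idm k) >> sw k k = sw 1 k >> (idm k || ?s)"
      by (rule sw_slide) simp_all
    have "(?K || idm k) >> ?C = ((?s || ?s) || idm k) >> ((Mrg k || idm k) >> ?C)"
      by (simp add: interchange flip: cmp_assoc)
    also have "\<dots> = (((?s || ?s) || idm k) >> (idm (k + k) || Dup k)) >> ((idm k || sw k k || idm k) >> (?C || ?C))"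
      unfolding Mrg_Bend by (simp only: cmp_assoc)
    also have "((?s || ?s) || idm k) >> (idm (k + k) || Dup k) = (idm 2 || Dup k) >> (?s || (?s || idm k) || idm k)"
    proof -
      have "((?s || ?s) || idm k) >> (idm (k + k) || Dup k) = (idm 2 || Dup k) >> ((?s || ?s) || (idm k || idm k))"
        by (simp add: interchange idm_tns)
      then show ?thesis
        by (simp add: tns_assoc)
    qed
    also have "\<dots> >> ((idm k || sw k k || idm k) >> (?C || ?C)) =
        (idm 2 || Dup k) >> ((?s || ((?s || idm k) >> sw k k) || idm k) >> (?C || ?C))"
      by (simp add: cmp_assoc interchange flip: cmp_assoc[of "?s || (?s || idm k) || idm k"])
    also have "\<dots> = (idm 2 || Dup k) >> ((idm 1 || sw 1 k || idm k) >> (((?s || idm k) || (?s || idm k)) >> (?C || ?C)))"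
    proof -
      have "?s || (sw 1 k >> (idm k || ?s)) || idm k = (idm 1 || sw 1 k || idm k) >> (?s || (idm k || ?s) || idm k)"
        by (simp add: interchange)
      then show ?thesis
        unfolding slide by (simp add: tns_assoc cmp_assoc)
    qed
    also have "((?s || idm k) || (?s || idm k)) >> (?C || ?C) = bent_nest k || bent_nest k"
      unfolding bent_nest_def by (simp add: interchange)
    finally show ?thesis .
  qed
  have "bent_nest (k + 1) = ((?H >> (?K || idm 1)) || idm k || idm 1) >> ((idm k || sw 1 k || idm 1) >> (?C || bend))"
    unfolding bent_nest_def nest by (simp add: Bend_add Bend_1 idm_tns)
  also have "(?H >> (?K || idm 1)) || idm k || idm 1 = (?H || idm k || idm 1) >> (?K || idm 1 || idm k || idm 1)"
    using interchange[of ?H "?K || idm 1" "idm k || idm 1" "idm k || idm 1"]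
    by (simp add: idm_tns tns_assoc)
  finally have "bent_nest (k + 1) = (?H || idm k || idm 1) >>
      (((?K || idm 1 || idm k || idm 1) >> (idm k || sw 1 k || idm 1)) >> (?C || bend))"
    by (simp only: cmp_assoc)
  also have "\<dots> = (?H || idm k || idm 1) >> ((idm 2 || sw 1 k || idm 1) >> (((?K || idm k) || idm 2) >> (?C || bend)))"
    unfolding s2 by (simp only: cmp_assoc)
  also have "\<dots> = (?H || idm k || idm 1) >> (((idm 2 || sw 1 k || idm 1) >> (idm (2 + k) || bend)) >> ((?K || idm k) >> ?C))"
    unfolding s3 by (simp only: cmp_assoc)
  also have "\<dots> = ((?H || idm k || idm 1) >> ((idm 2 || idm 1 || sw k 1) >> (idm 2 || bend || idm k))) >> ((?K || idm k) >> ?C)"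
    unfolding s4 by (simp only: cmp_assoc)
  finally show ?thesis
    unfolding s5 s6 .
qed

lemma tpw_Bend: "(tpw k (sp Z 0 1 0) || idm k) >> Bend k = Del k"
proof (induction k)
  case 0
  then show ?case
    by simp
next
  case (Suc k)
  let ?u = "sp Z 0 1 0" and ?U = "tpw k (sp Z 0 1 0)"
  have [simp]: "dom ?U = 0" "cod ?U = k"
    by (induction k) simp_all
  have s: "(?U || idm 1) >> sw k 1 = idm 1 || ?U"
    using sw_slide[of ?U k "idm 1" 1 0 1] by simp
  have u: "(?u || idm 1) >> bend = del"
    using sp_fusion[of 1 Z 0 0 0 1 0 0] by simp
  have "(tpw (Suc k) ?u || idm (1 + k)) >> Bend (Suc k) =
      (?u || (?U || idm 1) || idm k) >> (idm 1 || sw k 1 || idm k) >> (bend || Bend k)"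
    by (simp add: tns_assoc cmp_assoc flip: idm_tns)
  also have "\<dots> = ((?u || idm 1) || (?U || idm k)) >> (bend || Bend k)"
  proof -
    have "(?u || (?U || idm 1) || idm k) >> (idm 1 || sw k 1 || idm k) = ?u || (idm 1 || ?U) || idm k"
      by (simp add: interchange s)
    then show ?thesis
      by (simp add: tns_assoc)
  qed
  also have "\<dots> = del || Del k"
    using Suc by (simp add: interchange u)
  finally show ?case
    by (simp add: plus_1_eq_Suc)
qed

text \<open>The rule S4 enters here: bending the four Z-states on its right-hand side yields
  discards, one more than which is the discarded base wire.\<close>

lemma bent_nest_4: "bent_nest 4 = Del 5"
proof -
  have "nest 4 = del || tpw 4 (sp Z 0 1 0)"
    using cls_S4[OF S4] by (simp add: nest_def sp_def cls_tensor cls_tensor_power)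
  then have "bent_nest 4 = del || Del 4"
    using interchange[of del "idm 0" "tpw 4 (sp Z 0 1 0) || idm 4" "Bend 4"] tpw_Bend[of 4]
    by (simp add: bent_nest_def tns_assoc)
  then show ?thesis
    using Del_add[of 1 4] by simp
qed

section \<open>Phase polynomials vanishing modulo 8\<close>

text \<open>Integer valued, since the bits are added in the integers: the sum is the exponent of
  exp(i pi/4) and is read modulo 8.\<close>

definition parity :: "nat set \<Rightarrow> int" where
  "parity A = of_nat (card A mod 2)"

text \<open>Expansion of the product: every factor contributes either 1 or g i.\<close>

lemma sum_Pow_prod:
  fixes g :: "'a \<Rightarrow> int"
  assumes "finite S"
  shows "(\<Sum>x\<in>Pow S. \<Prod>i\<in>x. g i) = (\<Prod>i\<in>S. 1 + g i)"
  using assms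
proof (induction S)
  case (insert a S)
  have inj: "inj_on (insert a) (Pow S)"
    using insert.hyps by (auto simp: inj_on_def)
  have "(\<Sum>x\<in>insert a ` Pow S. \<Prod>i\<in>x. g i) = (\<Sum>x\<in>Pow S. \<Prod>i\<in>insert a x. g i)"
    by (simp add: sum.reindex[OF inj])
  also have "\<dots> = (\<Sum>x\<in>Pow S. g a * (\<Prod>i\<in>x. g i))"
  proof (rule sum.cong)
    fix x assume "x \<in> Pow S"
    then have "finite x" "a \<notin> x"
      using insert.hyps finite_subset by auto
    then show "(\<Prod>i\<in>insert a x. g i) = g a * (\<Prod>i\<in>x. g i)"
      by simp
  qed simp
  finally have "(\<Sum>x\<in>insert a ` Pow S. \<Prod>i\<in>x. g i) = g a * (\<Prod>i\<in>S. 1 + g i)"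
    using insert.IH by (simp flip: sum_distrib_left)
  moreover have "Pow S \<inter> insert a ` Pow S = {}"
    using insert.hyps by auto
  ultimately show ?case
    using insert by (simp add: Pow_insert sum.union_disjoint distrib_right)
qed simp

lemma parity_eq: "finite A \<Longrightarrow> 2 * parity A = 1 - (-1) ^ card A"
  by (cases "even (card A)") (auto simp: parity_def odd_iff_mod_2_eq_one)

lemma minus_one_card_Int:
  "finite x \<Longrightarrow> (-1 :: int) ^ card (T \<inter> x) = (\<Prod>i\<in>x. if i \<in> T then -1 else 1)"
  by (simp add: prod.If_cases Int_commute)

text \<open>If S meets x, exactly half of its subsets meet x oddly. In the product form of the sum
  of signs, each element of both S and x contributes a factor 1 - 1 = 0.\<close>

lemma sum_parity_subsets:
  assumes "finite S" "S \<noteq> {}"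
  shows "(\<Sum>T\<in>Pow S. parity (T \<inter> x)) = (if S \<inter> x = {} then 0 else 2 ^ (card S - 1))"
proof -
  have fin: "finite (T \<inter> x)" "finite T" if "T \<in> Pow S" for T
    using that assms(1) finite_subset by auto
  have "2 * (\<Sum>T\<in>Pow S. parity (T \<inter> x)) = (\<Sum>T\<in>Pow S. 1 - (-1) ^ card (x \<inter> T))"
    unfolding sum_distrib_left by (intro sum.cong) (simp_all add: parity_eq fin Int_commute)
  also have "\<dots> = 2 ^ card S - (\<Sum>T\<in>Pow S. \<Prod>i\<in>T. if i \<in> x then -1 else 1)"
    using assms(1) fin by (simp add: sum_subtractf card_Pow minus_one_card_Int)
  also have "\<dots> = 2 ^ card S - (\<Prod>i\<in>S. 1 + (if i \<in> x then -1 else 1))"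
    using sum_Pow_prod[OF assms(1), of "\<lambda>i. if i \<in> x then -1 else 1"] by simp
  also have "(\<Prod>i\<in>S. 1 + (if i \<in> x then -1 else (1 :: int))) = (if S \<inter> x = {} then 2 ^ card S else 0)"
  proof (cases "S \<inter> x = {}")
    case True
    then have "(\<Prod>i\<in>S. 1 + (if i \<in> x then -1 else (1 :: int))) = (\<Prod>i\<in>S. 2)"
      by (intro prod.cong) auto
    with True show ?thesis
      by simp
  next
    case False
    then show ?thesis
      using assms(1) by (auto simp: prod_zero_iff)
  qed
  finally have "2 * (\<Sum>T\<in>Pow S. parity (T \<inter> x)) = (if S \<inter> x = {} then 0 else 2 ^ card S)"
    by simp
  moreover have "(2 :: int) ^ card S = 2 * 2 ^ (card S - 1)"
    using assms by (simp add: card_gt_0_iff flip: power_Suc)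
  ultimately show ?thesis
    by (auto split: if_splits)
qed

text \<open>In sign form the summand is multiplicative, so the sum is a difference of two products
  over S. The factors of the second are 2 on T and 0 off T, so it vanishes unless S lies inside T.
  The signed sum over subsets of S thus extracts the coefficients of supersets of S.\<close>

lemma moebius_parity:
  assumes "finite S" "S \<noteq> {}"
  shows "(\<Sum>x\<in>Pow S. (-1) ^ card x * parity (T \<inter> x)) = (if S \<subseteq> T then - (2 ^ (card S - 1)) else 0)"
proof -
  have fin: "finite (T \<inter> x)" "finite x" if "x \<in> Pow S" for x
    using that assms(1) finite_subset by auto
  have p: "(-1 :: int) ^ card x = (\<Prod>i\<in>x. -1)" for x :: "nat set"
    by simp
  have "2 * (\<Sum>x\<in>Pow S. (-1) ^ card x * parity (T \<inter> x)) =
      (\<Sum>x\<in>Pow S. (-1) ^ card x * (1 - (-1) ^ card (T \<inter> x)))"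
    unfolding sum_distrib_left
  proof (rule sum.cong)
    fix x assume "x \<in> Pow S"
    then show "2 * ((-1) ^ card x * parity (T \<inter> x)) = (-1) ^ card x * (1 - (-1) ^ card (T \<inter> x))"
      using parity_eq[of "T \<inter> x"] fin by simp
  qed simp
  also have "\<dots> = (\<Sum>x\<in>Pow S. (\<Prod>i\<in>x. -1) - (\<Prod>i\<in>x. (-1) * (if i \<in> T then -1 else 1)))"
  proof (rule sum.cong)
    fix x assume "x \<in> Pow S"
    then have "(-1) ^ card (T \<inter> x) = (\<Prod>i\<in>x. if i \<in> T then -1 else (1 :: int))"
      using fin minus_one_card_Int by blast
    then show "(-1) ^ card x * (1 - (-1) ^ card (T \<inter> x)) =
        (\<Prod>i\<in>x. -1) - (\<Prod>i\<in>x. (-1 :: int) * (if i \<in> T then -1 else 1))"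
      unfolding prod.distrib p[symmetric] by (simp add: right_diff_distrib)
  qed simp
  also have "\<dots> = (\<Prod>i\<in>S. 1 + (-1)) - (\<Prod>i\<in>S. 1 + (-1) * (if i \<in> T then -1 else 1))"
    using sum_Pow_prod[OF assms(1), of "\<lambda>i. -1"]
      sum_Pow_prod[OF assms(1), of "\<lambda>i. (-1) * (if i \<in> T then -1 else 1)"]
    by (simp only: sum_subtractf)
  \<comment> \<open>Here S must be nonempty; the empty product would be 1.\<close>
  also have "(\<Prod>i\<in>S. 1 + (-1 :: int)) = 0"
    using assms by (simp add: card_gt_0_iff)
  also have "(\<Prod>i\<in>S. 1 + (-1) * (if i \<in> T then -1 else (1 :: int))) = (if S \<subseteq> T then 2 ^ card S else 0)"
  proof (cases "S \<subseteq> T")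
    case True
    then have "(\<Prod>i\<in>S. 1 + (-1) * (if i \<in> T then -1 else (1 :: int))) = (\<Prod>i\<in>S. 2)"
      by (intro prod.cong) auto
    with True show ?thesis
      by simp
  next
    case False
    then show ?thesis
      using assms(1) by (auto simp: prod_zero_iff)
  qed
  finally have "2 * (\<Sum>x\<in>Pow S. (-1) ^ card x * parity (T \<inter> x)) = (if S \<subseteq> T then - (2 ^ card S) else 0)"
    by simp
  moreover have "(2 :: int) ^ card S = 2 * 2 ^ (card S - 1)"
    using assms by (simp add: card_gt_0_iff flip: power_Suc)
  ultimately show ?thesis
    by (auto split: if_splits)
qed

text \<open>
  The sum of all \<open>parity (T \<inter> x)\<close> with \<open>T \<subseteq> S\<close> is \<open>0\<close> or \<open>2 ^ (card S - 1)\<close>; the factor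
  \<open>2 ^ (4 - card S)\<close>, which is \<open>1\<close> from four elements on, makes it a multiple of \<open>8\<close>.
\<close>

definition nest_coeff :: "nat set \<Rightarrow> nat set \<Rightarrow> int" where
  "nest_coeff S T = (if T \<subseteq> S then 2 ^ (4 - card S) else 0)"

text \<open>
  Eliminates the maximal sets one at a time: by Moebius inversion the coefficient at a maximal
  \<open>S\<close> is divisible by the factor in \<open>nest_coeff S\<close>.
\<close>

lemma phase_polynomial_generated:
  fixes K :: "(nat set \<Rightarrow> int) set"
  assumes add: "\<And>c d. c \<in> K \<Longrightarrow> d \<in> K \<Longrightarrow> (\<lambda>S. c S + d S) \<in> K"
    and smult: "\<And>c k. c \<in> K \<Longrightarrow> (\<lambda>S. k * c S) \<in> K"
    and empty: "(\<lambda>S. if S = {} then 1 else 0) \<in> K"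
    and "finite F" "\<And>S. S \<in> F \<Longrightarrow> finite S" "\<And>S T. S \<in> F \<Longrightarrow> T \<subseteq> S \<Longrightarrow> T \<in> F"
    and "\<And>S. S \<in> F \<Longrightarrow> S \<noteq> {} \<Longrightarrow> nest_coeff S \<in> K"
    and "\<And>S. S \<notin> F \<Longrightarrow> c S = 0"
    and "\<And>x. finite x \<Longrightarrow> 8 dvd (\<Sum>S\<in>F. c S * parity (S \<inter> x))"
  shows "c \<in> K"
  using assms(4-)
proof (induction "card F" arbitrary: F c rule: less_induct)
  case less
  note fin = less.prems(2) and down = less.prems(3) and supp = less.prems(5) and ker = less.prems(6)
  show ?case
  proof (cases "\<exists>S\<in>F. S \<noteq> {}")
    case False
    have "c S = c {} * (if S = {} then 1 else 0)" for S
      using False supp[of S] by (cases "S = {}") auto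
    then have "c = (\<lambda>S. c {} * (if S = {} then 1 else 0))"
      by (rule ext)
    then show ?thesis
      using smult[OF empty] by metis
  next
    case True
    then obtain S0 where S0: "S0 \<in> F" "S0 \<noteq> {}"
      by blast
    obtain S where S: "S \<in> F" "S0 \<subseteq> S" and max: "\<And>T. T \<in> F \<Longrightarrow> S \<subseteq> T \<Longrightarrow> T = S"
      using finite_has_maximal2[OF less.prems(1) S0(1)] by metis
    have Sne: "S \<noteq> {}" and fS: "finite S"
      using S S0 fin by auto
    define k where "k = card S"
    have k: "k \<ge> 1"
      using Sne fS by (simp add: k_def One_nat_def Suc_leI card_gt_0_iff)
    \<comment> \<open>After exchanging the sums each T in F carries a Moebius sum over S, which
      vanishes unless S lies inside T, hence by maximality unless T = S.\<close>
    have "(\<Sum>x\<in>Pow S. (-1) ^ card x * (\<Sum>T\<in>F. c T * parity (T \<inter> x))) =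
        (\<Sum>T\<in>F. c T * (\<Sum>x\<in>Pow S. (-1) ^ card x * parity (T \<inter> x)))"
      unfolding sum_distrib_left by (subst sum.swap) (simp add: mult_ac)
    also have "\<dots> = (\<Sum>T\<in>F. if T = S then - (2 ^ (k - 1)) * c S else 0)"
      by (rule sum.cong) (use max in \<open>auto simp: moebius_parity[OF fS Sne] k_def\<close>)
    also have "\<dots> = - (2 ^ (k - 1)) * c S"
      using less.prems(1) S by simp
    finally have "- (2 ^ (k - 1)) * c S = (\<Sum>x\<in>Pow S. (-1) ^ card x * (\<Sum>T\<in>F. c T * parity (T \<inter> x)))" ..
    moreover have "8 dvd (\<Sum>x\<in>Pow S. (-1) ^ card x * (\<Sum>T\<in>F. c T * parity (T \<inter> x)))"
    proof (rule dvd_sum)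
      fix x assume "x \<in> Pow S"
      then have "finite x"
        using fS finite_subset by auto
      then show "8 dvd (-1) ^ card x * (\<Sum>T\<in>F. c T * parity (T \<inter> x))"
        by (intro dvd_mult ker)
    qed
    ultimately have div8: "8 dvd 2 ^ (k - 1) * c S"
      by (metis dvd_minus_iff mult_minus_left)
    have "2 ^ (4 - k) dvd c S"
    proof (cases "k \<ge> 4")
      case False
      \<comment> \<open>The exponents k - 1 and 4 - k add up to 3, so the factor 2^(k-1) cancels.
        From four elements on the claim is divisibility by 1.\<close>
      then have eq: "(8 :: int) = 2 ^ (k - 1) * 2 ^ (4 - k)"
        using k by (simp flip: power_add)
      then show ?thesis
        using div8 unfolding eq by simp
    qed simp
    then obtain q where q: "c S = q * 2 ^ (4 - k)"
      by (metis dvd_def mult.commute)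
    \<comment> \<open>Subtracting q copies of the generator clears the coefficient at S and touches
      only subsets of S. Removing S from F keeps it closed under subsets, as S is maximal.\<close>
    define d where "d = (\<lambda>T. c T + - q * nest_coeff S T)"
    have "d \<in> K"
    proof (rule less.hyps[of "F - {S}"])
      show "card (F - {S}) < card F"
        using S less.prems(1) by (intro psubset_card_mono) auto
      show "finite (F - {S})"
        using less.prems(1) by simp
      show "finite T" if "T \<in> F - {S}" for T
        using that fin by simp
      show "T' \<in> F - {S}" if "T \<in> F - {S}" "T' \<subseteq> T" for T T'
        using that down max by blast
      show "nest_coeff T \<in> K" if "T \<in> F - {S}" "T \<noteq> {}" for T
        using that less.prems(4) by simp
      have dS: "d S = 0"
        by (simp add: d_def q nest_coeff_def k_def)
      show "d T = 0" if "T \<notin> F - {S}" for T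
      proof (cases "T = S")
        case False
        then have "T \<notin> F" "\<not> T \<subseteq> S"
          using that down[OF S(1)] by auto
        then show ?thesis
          by (simp add: d_def supp nest_coeff_def)
      qed (simp add: dS)
      show "8 dvd (\<Sum>T\<in>F - {S}. d T * parity (T \<inter> x))" if "finite x" for x
      proof -
        have "(\<Sum>T\<in>F - {S}. d T * parity (T \<inter> x)) = (\<Sum>T\<in>F. d T * parity (T \<inter> x))"
          using S less.prems(1) dS by (simp add: sum_diff1)
        also have "\<dots> = (\<Sum>T\<in>F. c T * parity (T \<inter> x)) + - q * (\<Sum>T\<in>F. nest_coeff S T * parity (T \<inter> x))"
          unfolding d_def sum_distrib_left sum.distrib[symmetric]
          by (rule sum.cong) (simp_all add: algebra_simps)
        also have "(\<Sum>T\<in>F. nest_coeff S T * parity (T \<inter> x)) = (\<Sum>T\<in>Pow S. nest_coeff S T * parity (T \<inter> x))"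
          by (rule sum.mono_neutral_right) (use less.prems(1) down[OF S(1)] in \<open>auto simp: nest_coeff_def\<close>)
        also have "\<dots> = 2 ^ (4 - k) * (\<Sum>T\<in>Pow S. parity (T \<inter> x))"
          unfolding sum_distrib_left by (rule sum.cong) (auto simp: nest_coeff_def k_def)
        finally have *: "(\<Sum>T\<in>F - {S}. d T * parity (T \<inter> x)) = (\<Sum>T\<in>F. c T * parity (T \<inter> x)) +
          - q * (2 ^ (4 - k) * (\<Sum>T\<in>Pow S. parity (T \<inter> x)))" .
        \<comment> \<open>The generator itself vanishes modulo 8. For k > 4 the truncated difference
          4 - k is 0 and the exponent k - 1 alone exceeds 3.\<close>
        have "(8 :: int) dvd 2 ^ (4 - k) * 2 ^ (k - 1)"
        proof -
          have "(2 :: int) ^ 3 dvd 2 ^ (4 - k + (k - 1))"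
            by (rule le_imp_power_dvd) (use k in linarith)
          then show ?thesis
            by (simp add: power_add)
        qed
        then have nest8: "8 dvd 2 ^ (4 - k) * (\<Sum>T\<in>Pow S. parity (T \<inter> x))"
          by (simp add: sum_parity_subsets[OF fS Sne] k_def)
        show ?thesis
          unfolding * by (rule dvd_add[OF ker[OF that] dvd_mult[OF nest8]])
      qed
    qed
    then have "(\<lambda>T. d T + q * nest_coeff S T) \<in> K"
      using add smult less.prems(4)[OF S(1) Sne] by metis
    then show ?thesis
      by (simp add: d_def)
  qed
qed

section \<open>Tuples of parities\<close>

primrec Tup :: "nat \<Rightarrow> mor list \<Rightarrow> mor" where
  "Tup n [] = Del n"
| "Tup n (p # ps) = pair n p (Tup n ps)"

lemma dom_Tup [simp]: "dom (Tup n ps) = n"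
  by (cases ps) simp_all

lemma cod_Tup: "\<forall>p\<in>set ps. par n p \<Longrightarrow> cod (Tup n ps) = length ps"
  by (induction ps) (auto simp: par_arity)

lemma copyable_Tup: "\<forall>p\<in>set ps. par n p \<Longrightarrow> copyable (Tup n ps)"
  by (induction ps) (auto simp: par_def)

lemma Tup_append:
  "\<forall>p\<in>set ps. par n p \<Longrightarrow> Tup n (ps @ qs) = pair n (Tup n ps) (Tup n qs)"
  by (induction ps) (auto simp: par_arity pair_assoc)

text \<open>The gadgets on b plus the sum of T, for all sublists T of the list, produced by the same
  branching as in \<open>bent_nest_Suc\<close>.\<close>

primrec nest_phase :: "nat \<Rightarrow> mor \<Rightarrow> mor list \<Rightarrow> mor" where
  "nest_phase n b [] = b >> tee"
| "nest_phase n b (x # xs) = pair n (nest_phase n b xs) (nest_phase n (plus_par n b x) xs)"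

text \<open>The list is reversed because the recursion of the bent nest consumes its last wire
  first.\<close>

lemma bent_nest_elements:
  assumes "par n b" "\<forall>x\<in>set xs. par n x"
  shows "pair n b (Tup n (rev xs)) >> bent_nest (length xs) = nest_phase n b xs"
  using assms
proof (induction xs arbitrary: b)
  case Nil
  then show ?case
    by (simp add: par_arity bent_nest_def)
next
  case (Cons x xs)
  let ?k = "length xs" and ?c = "plus_par n b x" and ?T = "Tup n (rev xs)"
  have p: "par n b" "par n x" "par n ?c" and T: "cod ?T = ?k" "copyable ?T"
    using Cons.prems cod_Tup[of "rev xs" n] copyable_Tup[of "rev xs" n] by auto
  note a = p[THEN par_arity(1)] p[THEN par_arity(2)] T(1)
  \<comment> \<open>The equations 1 to 5 push the tuple through the five layers of
    \<open>bent_nest_Suc\<close> in order.\<close>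
  have "pair n b (Tup n (rev (x # xs))) = pair n b (pair n ?T x)"
    using Cons.prems by (simp add: Tup_append a)
  also have "\<dots> >> (dup || sw ?k 1) = pair n (b >> dup) (pair n ?T x >> sw ?k 1)"
    by (simp add: pair_cmp a)
  also have "b >> dup = pair n b b"
    using p by (intro copyable_dup) (auto simp: par_def)
  also have "pair n ?T x >> sw ?k 1 = pair n x ?T"
    using pair_swap[of ?T n x] by (simp add: a)
  also have "pair n (pair n b b) (pair n x ?T) = pair n b (pair n (pair n b x) ?T)"
    by (simp add: pair_assoc a)
  finally have 1: "pair n b (Tup n (rev (x # xs))) >> (dup || sw ?k 1) = pair n b (pair n (pair n b x) ?T)" .
  have "pair n b (pair n (pair n b x) ?T) >> (idm 1 || add || idm ?k) = pair n b (pair n ?c ?T)"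
    by (simp add: pair_cmp a plus_par_def)
  then have 2: "pair n b (pair n (pair n b x) ?T) >> (idm 1 || add || idm ?k) = pair n (pair n b ?c) ?T"
    by (simp add: pair_assoc a)
  have "?T >> Dup ?k = pair n ?T ?T"
    using T by (metis dom_Tup copyable_def pair_def)
  then have "pair n (pair n b ?c) ?T >> (idm 2 || Dup ?k) = pair n (pair n b ?c) (pair n ?T ?T)"
    by (simp add: pair_cmp a)
  then have 3: "pair n (pair n b ?c) ?T >> (idm 2 || Dup ?k) = pair n b (pair n (pair n ?c ?T) ?T)"
    by (simp add: pair_assoc a)
  have "pair n b (pair n (pair n ?c ?T) ?T) >> (idm 1 || sw 1 ?k || idm ?k) = pair n b (pair n (pair n ?T ?c) ?T)"
    using pair_swap[of ?c n ?T] by (simp add: pair_cmp a)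
  then have 4: "pair n b (pair n (pair n ?c ?T) ?T) >> (idm 1 || sw 1 ?k || idm ?k) =
      pair n (pair n b ?T) (pair n ?c ?T)"
    by (simp add: pair_assoc a)
  have 5: "pair n (pair n b ?T) (pair n ?c ?T) >> (bent_nest ?k || bent_nest ?k) =
      pair n (nest_phase n b xs) (nest_phase n ?c xs)"
    using Cons p by (simp add: pair_cmp a)
  have "pair n b (Tup n (rev (x # xs))) >> bent_nest (?k + 1) =
      ((((pair n b (Tup n (rev (x # xs))) >> (dup || sw ?k 1)) >> (idm 1 || add || idm ?k)) >> (idm 2 || Dup ?k)) >>
      (idm 1 || sw 1 ?k || idm ?k)) >> (bent_nest ?k || bent_nest ?k)"
    unfolding bent_nest_Suc by (simp only: cmp_assoc)
  then show ?case
    unfolding 1 2 3 4 5 by (simp flip: Suc_eq_plus1)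
qed

text \<open>With more than four parities both branches are trivial by induction. With exactly four
  the effect is S4, and discarding the copyable base and tuple leaves \<open>Del n\<close>.\<close>

lemma nest_phase_trivial:
  assumes "length xs \<ge> 4" "par n b" "\<forall>x\<in>set xs. par n x"
  shows "nest_phase n b xs = Del n"
  using assms
proof (induction xs arbitrary: b)
  case (Cons x xs)
  show ?case
  proof (cases "length xs \<ge> 4")
    case True
    then show ?thesis
      using Cons par_plus by simp
  next
    case False
    then have l: "length (x # xs) = 4"
      using Cons.prems by simp
    have "nest_phase n b (x # xs) = pair n b (Tup n (rev (x # xs))) >> Del 5"
      using bent_nest_elements[of n b "x # xs"] Cons.prems unfolding l bent_nest_4 by simp
    also have "Del 5 = Del 1 || Del 4"
      using Del_add[of 1 4] by simp
    also have "pair n b (Tup n (rev (x # xs))) >> (Del 1 || Del 4) =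
        pair n (b >> Del 1) (Tup n (rev (x # xs)) >> Del 4)"
      using Cons.prems by (subst pair_cmp) (simp_all add: par_arity)
    also have "b >> Del 1 = Del n"
      using Cons.prems by (intro copyable_Del) (auto simp: par_def)
    also have "Tup n (rev (x # xs)) >> Del 4 = Del n"
      using Cons.prems l copyable_Tup[of "rev (x # xs)" n] cod_Tup[of "rev (x # xs)" n]
      by (intro copyable_Del) auto
    finally show ?thesis
      by simp
  qed
qed simp

section \<open>Parities of the inputs\<close>

definition proj :: "nat \<Rightarrow> nat \<Rightarrow> mor" where
  "proj n i = Del i || idm 1 || Del (n - i - 1)"

lemma par_proj: "i < n \<Longrightarrow> par n (proj n i)"
  unfolding par_def proj_def by (auto intro!: copyable_tns)

text \<open>Recursion over the indices fixes an order of summation for the set S; elements of S not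
  below k are ignored.\<close>

primrec par_upto :: "nat \<Rightarrow> nat set \<Rightarrow> nat \<Rightarrow> mor" where
  "par_upto n S 0 = zero_par n"
| "par_upto n S (Suc k) = (if k \<in> S then plus_par n (par_upto n S k) (proj n k) else par_upto n S k)"

definition par_of :: "nat \<Rightarrow> nat set \<Rightarrow> mor" where
  "par_of n S = par_upto n S n"

lemma par_par_upto: "k \<le> n \<Longrightarrow> par n (par_upto n S k)"
  by (induction k) (auto intro!: par_plus par_proj)

lemma par_par_of [simp]: "par n (par_of n S)"
  by (simp add: par_of_def par_par_upto)

lemma plus_par_cancel:
  assumes "par n f" "par n g"
  shows "plus_par n f (plus_par n f g) = g"
  using assms plus_par_assoc[of n f f g] by (simp add: plus_par_self plus_par_zero)

text \<open>An index lying in both sets is added twice and cancels, since parities have exponent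
  2.\<close>

lemma par_upto_sym_diff:
  "k \<le> n \<Longrightarrow> par_upto n (sym_diff S T) k = plus_par n (par_upto n S k) (par_upto n T k)"
proof (induction k)
  case 0
  then show ?case
    by (simp add: plus_par_zero)
next
  case (Suc k)
  let ?s = "par_upto n S k" and ?t = "par_upto n T k" and ?p = "proj n k"
  have p: "par n ?s" "par n ?t" "par n ?p"
    using Suc.prems by (auto intro: par_par_upto par_proj)
  consider "k \<in> S" "k \<in> T" | "k \<in> S" "k \<notin> T" | "k \<notin> S" "k \<in> T" | "k \<notin> S" "k \<notin> T"
    by blast
  then show ?case
  proof cases
    case 1
    have "plus_par n (plus_par n ?s ?p) (plus_par n ?t ?p) = plus_par n ?s (plus_par n ?p (plus_par n ?p ?t))"
      using p par_plus plus_par_comm[of n ?t ?p] by (simp add: plus_par_assoc par_plus)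
    also have "\<dots> = plus_par n ?s ?t"
      using p by (simp add: plus_par_cancel)
    finally show ?thesis
      using 1 Suc by simp
  next
    case 2
    then show ?thesis
      using Suc p plus_par_comm[of n ?t ?p] by (simp add: plus_par_assoc)
  next
    case 3
    then show ?thesis
      using Suc p by (simp add: plus_par_assoc)
  next
    case 4
    then show ?thesis
      using Suc by simp
  qed
qed

lemma par_of_sym_diff: "par_of n (sym_diff S T) = plus_par n (par_of n S) (par_of n T)"
  by (simp add: par_of_def par_upto_sym_diff)

lemma par_of_empty: "par_of n {} = zero_par n"
proof -
  have "par_upto n {} k = zero_par n" for k
    by (induction k) auto
  then show ?thesis
    by (simp add: par_of_def)
qed

lemma par_of_singleton:
  assumes "i < n"
  shows "par_of n {i} = proj n i"
proof -
  have "par_upto n {i} k = (if i < k then proj n i else zero_par n)" for k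
    by (induction k) (use assms in \<open>auto simp: plus_par_zero par_proj\<close>)
  with assms show ?thesis
    by (simp add: par_of_def)
qed

text \<open>The middle components b and c have no outputs, so after interleaving the copies no
  output wires have to cross.\<close>

lemma pair_tns:
  assumes "dom a = m" "dom c = m" "dom b = n" "dom d = n" "cod b = 0" "cod c = 0"
  shows "pair (m + n) (a || b) (c || d) = pair m a c || pair n b d"
proof -
  have s: "sw m n >> (b || c) = c || b"
    using sw_slide[of c 0 b 0 m n] assms by simp
  have "pair (m + n) (a || b) (c || d) = (Dup m || Dup n) >> ((idm m || sw m n || idm n) >> (a || (b || c) || d))"
    by (simp add: pair_def Dup_add cmp_assoc tns_assoc)
  also have "(idm m || sw m n || idm n) >> (a || (b || c) || d) = a || (c || b) || d"
    using assms by (simp add: interchange s)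
  also have "(Dup m || Dup n) >> (a || (c || b) || d) = (Dup m || Dup n) >> ((a || c) || (b || d))"
    by (simp add: tns_assoc)
  also have "\<dots> = pair m a c || pair n b d"
    using assms by (simp add: interchange pair_def)
  finally show ?thesis .
qed

text \<open>Pairing with the next projection splits as a tensor product, because the tuple so far
  discards all wires from k on. For k = n this is the start of the symbolic execution.\<close>

lemma Tup_proj: "k \<le> n \<Longrightarrow> Tup n (map (proj n) [0..<k]) = idm k || Del (n - k)"
proof (induction k)
  case 0
  then show ?case
    by simp
next
  case (Suc k)
  define m where "m = n - k - 1"
  have n: "n = k + (1 + m)"
    using Suc.prems by (simp add: m_def)
  have "Tup n (map (proj n) [0..<Suc k]) = pair n (Tup n (map (proj n) [0..<k])) (Tup n [proj n k])"
  proof -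
    have "\<forall>p\<in>set (map (proj n) [0..<k]). par n p"
      using Suc.prems by (auto intro: par_proj)
    from Tup_append[OF this, of "[proj n k]"] show ?thesis
      by simp
  qed
  also have "Tup n [proj n k] = proj n k"
    using par_proj[of k n] Suc.prems by (simp add: par_arity)
  also have "Tup n (map (proj n) [0..<k]) = idm k || Del (1 + m)"
    using Suc by (simp add: n)
  also have "proj n k = Del k || (idm 1 || Del m)"
    by (simp add: proj_def n)
  also have "pair n (idm k || Del (1 + m)) (Del k || (idm 1 || Del m)) =
      pair k (idm k) (Del k) || pair (1 + m) (Del (1 + m)) (idm 1 || Del m)"
    unfolding n by (rule pair_tns) simp_all
  also have "\<dots> = idm k || (idm 1 || Del m)"
    by simp
  also have "\<dots> = (idm k || idm 1) || Del m"
    by (simp add: tns_assoc)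
  finally show ?case
    by (simp add: idm_tns m_def flip: Suc_eq_plus1)
qed

lemma Tup_identity: "Tup n (map (\<lambda>i. par_of n {i}) [0..<n]) = idm n"
proof -
  have "map (\<lambda>i. par_of n {i}) [0..<n] = map (proj n) [0..<n]"
    by (simp add: par_of_singleton)
  moreover have "Tup n (map (proj n) [0..<n]) = idm n"
    using Tup_proj[of n n] by simp
  ultimately show ?thesis
    by metis
qed

section \<open>Phases\<close>

definition gadget :: "nat \<Rightarrow> nat set \<Rightarrow> mor" where
  "gadget n S = par_of n S >> tee"

primrec phase :: "nat \<Rightarrow> nat set list \<Rightarrow> mor" where
  "phase n [] = Del n"
| "phase n (S # A) = pair n (gadget n S) (phase n A)"

lemma arity_gadget [simp]: "dom (gadget n S) = n" "cod (gadget n S) = 0"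
  by (simp_all add: gadget_def par_arity)

lemma arity_phase [simp]: "dom (phase n A) = n" "cod (phase n A) = 0"
  by (induction A) simp_all

lemma phase_append: "phase n (A @ B) = pair n (phase n A) (phase n B)"
  by (induction A) (simp_all add: pair_assoc)

text \<open>Gadgets have no outputs, so they commute in pairings and only multiplicities
  count.\<close>

lemma phase_mset: "mset A = mset B \<Longrightarrow> phase n A = phase n B"
proof (induction A arbitrary: B)
  case (Cons S A)
  then have "S \<in> set B"
    by (metis list.set_intros(1) mset_eq_setD)
  then obtain B1 B2 where B: "B = B1 @ S # B2"
    by (meson split_list)
  then have "mset A = mset (B1 @ B2)"
    using Cons.prems by simp
  then have "phase n (S # A) = pair n (gadget n S) (pair n (phase n B1) (phase n B2))"
    using Cons.IH[of "B1 @ B2"] by (simp add: phase_append)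
  also have "\<dots> = pair n (pair n (phase n B1) (gadget n S)) (phase n B2)"
    using pair_comm0[of "gadget n S" n "phase n B1"] by (simp flip: pair_assoc)
  also have "\<dots> = phase n B"
    unfolding B by (simp add: phase_append pair_assoc)
  finally show ?case .
qed simp

lemma dup_phases: "dup >> (sp Z 1 0 \<alpha> || sp Z 1 0 \<beta>) = sp Z 1 0 (\<alpha> + \<beta>)"
proof -
  have "dup >> (sp Z 1 0 \<alpha> || sp Z 1 0 \<beta>) = dup >> (idm 1 || sp Z 1 0 \<beta>) >> sp Z 1 0 \<alpha>"
    using interchange[of "idm 1" "sp Z 1 0 \<alpha>" "sp Z 1 0 \<beta>" "idm 0"] by (simp add: cmp_assoc)
  also have "dup >> (idm 1 || sp Z 1 0 \<beta>) = sp Z 1 1 \<beta>"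
    using sp_fusion[of 1 Z 1 1 0 0 0 \<beta>] by simp
  also have "sp Z 1 1 \<beta> >> sp Z 1 0 \<alpha> = sp Z 1 0 (\<beta> + \<alpha>)"
    using sp_fusion[of 1 Z 1 0 \<beta> 0 0 \<alpha>] by simp
  finally show ?thesis
    by (simp add: add.commute)
qed

text \<open>A parity is copyable, so the m gadgets are phases on copies of a single wire and fuse
  into one spider.\<close>

lemma phase_replicate: "phase n (replicate m S) = par_of n S >> sp Z 1 0 (real m * (pi / 4))"
proof (induction m)
  case 0
  then show ?case
    using copyable_Del[of "par_of n S" 1 n] par_par_of[of n S] by (simp add: par_def)
next
  case (Suc m)
  have l: "par_of n S >> dup = pair n (par_of n S) (par_of n S)"
    using par_par_of[of n S] by (intro copyable_dup) (auto simp: par_def)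
  have "phase n (replicate (Suc m) S) =
      pair n (par_of n S) (par_of n S) >> (tee || sp Z 1 0 (real m * (pi / 4)))"
    using Suc par_arity[OF par_par_of[of n S]] by (simp add: gadget_def pair_cmp)
  also have "\<dots> = par_of n S >> sp Z 1 0 (pi / 4 + real m * (pi / 4))"
    unfolding l[symmetric] cmp_assoc dup_phases ..
  also have "pi / 4 + real m * (pi / 4) = real (Suc m) * (pi / 4)"
    by (simp add: field_simps)
  finally show ?case .
qed

lemma phase_replicate_8: "phase n (replicate 8 S) = Del n"
proof -
  have "sp Z 1 0 (real 8 * (pi / 4)) = del"
    by (rule sp_phase) simp
  then show ?thesis
    using copyable_Del[of "par_of n S" 1 n] par_par_of[of n S] unfolding phase_replicate by (simp add: par_def)
qed

text \<open>Eight gadgets on one set form the phase 2 pi; they are removed in blocks, by induction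
  on the length.\<close>

lemma phase_multiples_of_8: "(\<And>S. 8 dvd count (mset A) S) \<Longrightarrow> phase n A = Del n"
proof (induction "length A" arbitrary: A rule: less_induct)
  case less
  show ?case
  proof (cases A)
    case (Cons S A')
    then have "count (mset A) S > 0"
      by simp
    then have "count (mset A) S \<ge> 8"
      using less.prems[of S] by (meson dvd_imp_le)
    then have sub: "replicate_mset 8 S \<subseteq># mset A"
      by (simp add: count_le_replicate_mset_subset_eq)
    obtain B where B: "mset B = mset A - replicate_mset 8 S"
      using ex_mset by blast
    have A: "mset A = mset (replicate 8 S @ B)"
      using sub B by simp
    have "8 dvd count (mset B) T" for T
      using less.prems[of T] unfolding B by (auto simp: dvd_diff_nat)
    moreover have "length B < length A"
      using arg_cong[OF A, of size] by simp
    ultimately have "phase n B = Del n"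
      using less.hyps by blast
    then show ?thesis
      using phase_mset[OF A, of n] by (simp add: phase_append phase_replicate_8)
  qed simp
qed

lemma gadget_empty: "gadget n {} = Del n"
  by (simp add: gadget_def par_of_empty zero_par_def cmp_assoc zero_phase)

primrec nest_sets :: "nat set \<Rightarrow> nat set list \<Rightarrow> nat set list" where
  "nest_sets B [] = [B]"
| "nest_sets B (S # Ss) = nest_sets B Ss @ nest_sets (sym_diff B S) Ss"

lemma phase_nest_sets: "phase n (nest_sets B Ss) = nest_phase n (par_of n B) (map (par_of n) Ss)"
  by (induction Ss arbitrary: B) (simp_all add: phase_append par_of_sym_diff gadget_def par_arity)

lemma phase_nest_sets_trivial: "length Ss \<ge> 4 \<Longrightarrow> phase n (nest_sets B Ss) = Del n"
  unfolding phase_nest_sets by (rule nest_phase_trivial) auto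

text \<open>Since the singletons are distinct and miss B, no cancellation occurs in the symmetric
  differences, and every set between B and its union with \<open>js\<close> arises from one branch
  only.\<close>

lemma count_nest_sets_singletons:
  "distinct js \<Longrightarrow> B \<inter> set js = {} \<Longrightarrow>
    count (mset (nest_sets B (map (\<lambda>i. {i}) js))) T = (if B \<subseteq> T \<and> T \<subseteq> B \<union> set js then 1 else 0)"
proof (induction js arbitrary: B)
  case (Cons i js)
  have "sym_diff B {i} = insert i B" "insert i B \<inter> set js = {}"
    using Cons.prems by auto
  then show ?case
    using Cons by (auto simp: subset_iff)
qed auto

text \<open>An empty parity leaves B unchanged in both branches, so each padding doubles all
  multiplicities.\<close>

lemma count_nest_sets_pad:
  "count (mset (nest_sets B (replicate m {} @ Ss))) T = 2 ^ m * count (mset (nest_sets B Ss)) T"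
  by (induction m) simp_all

text \<open>Lists only have nonnegative multiplicities, whereas
  \<open>phase_polynomial_generated\<close> works with integers; asking for agreement modulo 8
  bridges the two.\<close>

definition trivial_phases :: "nat \<Rightarrow> (nat set \<Rightarrow> int) set" where
  "trivial_phases n = {c. \<exists>A. (\<forall>S. int (count (mset A) S) mod 8 = c S mod 8) \<and> phase n A = Del n}"

lemma phase_concat_replicate: "phase n A = Del n \<Longrightarrow> phase n (concat (replicate m A)) = Del n"
  by (induction m) (simp_all add: phase_append)

lemma count_concat_replicate: "count (mset (concat (replicate m A))) S = m * count (mset A) S"
  by (induction m) simp_all

lemma trivial_phases_add:
  assumes "c \<in> trivial_phases n" "d \<in> trivial_phases n"
  shows "(\<lambda>S. c S + d S) \<in> trivial_phases n"
proof -
  obtain A B where A: "\<forall>S. int (count (mset A) S) mod 8 = c S mod 8" "phase n A = Del n"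
    and B: "\<forall>S. int (count (mset B) S) mod 8 = d S mod 8" "phase n B = Del n"
    using assms by (auto simp: trivial_phases_def)
  have "int (count (mset (A @ B)) S) mod 8 = (c S + d S) mod 8" for S
    unfolding mset_append count_union of_nat_add by (rule mod_add_cong) (use A(1) B(1) in blast)+
  moreover have "phase n (A @ B) = Del n"
    by (simp add: phase_append A B)
  ultimately show ?thesis
    unfolding trivial_phases_def by blast
qed

lemma trivial_phases_smult:
  assumes "c \<in> trivial_phases n"
  shows "(\<lambda>S. k * c S) \<in> trivial_phases n"
proof -
  obtain A where A: "\<forall>S. int (count (mset A) S) mod 8 = c S mod 8" "phase n A = Del n"
    using assms by (auto simp: trivial_phases_def)
  \<comment> \<open>The factor k may be negative; its residue modulo 8 serves as the number of
    copies.\<close>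
  have "int (count (mset (concat (replicate (nat (k mod 8)) A))) S) mod 8 = k * c S mod 8" for S
    unfolding count_concat_replicate of_nat_mult by (rule mod_mult_cong) (use A(1) in \<open>simp, blast\<close>)
  then show ?thesis
    using phase_concat_replicate[OF A(2)] unfolding trivial_phases_def by blast
qed

lemma trivial_phases_empty: "(\<lambda>S. if S = {} then 1 else 0) \<in> trivial_phases n"
proof -
  have "phase n [{}] = Del n"
    by (simp add: gadget_empty)
  moreover have "\<forall>S. int (count (mset [{}]) S) mod 8 = (if S = {} then 1 else 0) mod 8"
    by simp
  ultimately show ?thesis
    unfolding trivial_phases_def by blast
qed

text \<open>Padding with empty parities brings the list up to length four, where S4 applies, and the
  doublings produce the factor 2^(4 - card S).\<close>

lemma trivial_phases_nest:
  assumes "finite S"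
  shows "nest_coeff S \<in> trivial_phases n"
proof -
  obtain js where js: "set js = S" "distinct js"
    using finite_distinct_list[OF assms] by blast
  define A where "A = nest_sets {} (replicate (4 - card S) {} @ map (\<lambda>i. {i}) js)"
  have "length js = card S"
    using distinct_card[OF js(2)] js(1) by simp
  then have "phase n A = Del n"
    unfolding A_def by (intro phase_nest_sets_trivial) simp
  moreover have "int (count (mset A) T) = nest_coeff S T" for T
    using js unfolding A_def count_nest_sets_pad
    by (simp add: count_nest_sets_singletons nest_coeff_def)
  ultimately show ?thesis
    unfolding trivial_phases_def by (intro CollectI exI[of _ A]) simp
qed

lemma dvd_add_7_mult:
  fixes a b :: int
  assumes "a mod 8 = b mod 8"
  shows "8 dvd a + 7 * b"
proof -
  have "8 dvd a - b"
    using assms by (simp add: mod_eq_dvd_iff)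
  then have "8 dvd (a - b) + 8 * b"
    by (rule dvd_add) simp
  then show ?thesis
    by (simp add: add.commute)
qed

text \<open>Membership only provides some trivial B congruent to A. As 7 is -1 modulo 8, adding
  seven copies of B makes all multiplicities of A multiples of 8, while the copies themselves change
  nothing.\<close>

lemma phase_trivial_phases:
  assumes "(\<lambda>S. int (count (mset A) S)) \<in> trivial_phases n"
  shows "phase n A = Del n"
proof -
  obtain B where B: "\<And>S. int (count (mset B) S) mod 8 = int (count (mset A) S) mod 8" "phase n B = Del n"
    using assms by (auto simp: trivial_phases_def)
  have "8 dvd count (mset (A @ concat (replicate 7 B))) S" for S
  proof -
    have "int (count (mset (A @ concat (replicate 7 B))) S) = int (count (mset A) S) + 7 * int (count (mset B) S)"
      by (simp only: mset_append count_union count_concat_replicate of_nat_add of_nat_mult of_nat_numeral)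
    then have "8 dvd int (count (mset (A @ concat (replicate 7 B))) S)"
      using dvd_add_7_mult[OF B(1)[of S, symmetric]] by (simp only:)
    then show ?thesis
      by (metis int_dvd_int_iff of_nat_numeral)
  qed
  then have "phase n (A @ concat (replicate 7 B)) = Del n"
    by (rule phase_multiples_of_8)
  then show ?thesis
    using phase_concat_replicate[OF B(2)] by (simp add: phase_append)
qed

lemma sum_count_mset:
  fixes f :: "'a \<Rightarrow> int"
  assumes "finite F" "set A \<subseteq> F"
  shows "(\<Sum>S\<in>F. int (count (mset A) S) * f S) = (\<Sum>S\<leftarrow>A. f S)"
  using assms(2)
proof (induction A)
  case (Cons T A)
  have "(\<Sum>S\<in>F. int (count (mset (T # A)) S) * f S) =
      (\<Sum>S\<in>F. (if S = T then f S else 0) + int (count (mset A) S) * f S)"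
    by (rule sum.cong) (auto simp: algebra_simps)
  also have "\<dots> = f T + (\<Sum>S\<leftarrow>A. f S)"
    using Cons assms(1) by (simp add: sum.distrib)
  finally show ?case
    by simp
qed simp

lemma phase_trivial:
  assumes "\<forall>S\<in>set A. S \<subseteq> {..<n}" "\<And>x. finite x \<Longrightarrow> 8 dvd (\<Sum>S\<leftarrow>A. parity (S \<inter> x))"
  shows "phase n A = Del n"
proof (rule phase_trivial_phases)
  show "(\<lambda>S. int (count (mset A) S)) \<in> trivial_phases n"
  proof (rule phase_polynomial_generated[where F = "Pow {..<n}"])
    show "8 dvd (\<Sum>S\<in>Pow {..<n}. int (count (mset A) S) * parity (S \<inter> x))" if "finite x" for x
      using assms(2)[OF that] sum_count_mset[of "Pow {..<n}" A "\<lambda>S. parity (S \<inter> x)"] assms(1)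
      by (metis (no_types, lifting) PowI finite_Pow_iff finite_lessThan subsetI)
    show "nest_coeff S \<in> trivial_phases n" if "S \<in> Pow {..<n}" for S
      using that finite_subset by (intro trivial_phases_nest) auto
    show "int (count (mset A) S) = 0" if "S \<notin> Pow {..<n}" for S
      using that assms(1) by (auto simp: count_eq_zero_iff)
  qed (auto intro: trivial_phases_add trivial_phases_smult trivial_phases_empty finite_subset)
qed

text \<open>Seven copies of B invert B. Hence A may be extended by seven copies and one further copy
  of B, and the part without the last copy has a vanishing polynomial.\<close>

lemma phase_eq:
  assumes "\<forall>S\<in>set A \<union> set B. S \<subseteq> {..<n}"
    and "\<And>x. finite x \<Longrightarrow> (\<Sum>S\<leftarrow>A. parity (S \<inter> x)) mod 8 = (\<Sum>S\<leftarrow>B. parity (S \<inter> x)) mod 8"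
  shows "phase n A = phase n B"
proof -
  let ?C = "concat (replicate 7 B)"
  have C: "(\<Sum>S\<leftarrow>concat (replicate m B). f S) = int m * (\<Sum>S\<leftarrow>B. f S)" for m and f :: "nat set \<Rightarrow> int"
    by (induction m) (simp_all add: algebra_simps)
  have "phase n (A @ ?C) = Del n"
  proof (rule phase_trivial)
    show "8 dvd (\<Sum>S\<leftarrow>A @ ?C. parity (S \<inter> x))" if "finite x" for x
    proof -
      have "(\<Sum>S\<leftarrow>A @ ?C. parity (S \<inter> x)) = (\<Sum>S\<leftarrow>A. parity (S \<inter> x)) + 7 * (\<Sum>S\<leftarrow>B. parity (S \<inter> x))"
        unfolding map_append sum_list_append C by simp
      then show ?thesis
        using dvd_add_7_mult[OF assms(2)[OF that]] by (simp only:)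
    qed
  qed (use assms(1) in auto)
  moreover have "phase n (?C @ B) = Del n"
  proof (rule phase_multiples_of_8)
    show "8 dvd count (mset (?C @ B)) S" for S
      unfolding mset_append count_union count_concat_replicate by simp
  qed
  ultimately have "phase n A = pair n (phase n A) (pair n (phase n ?C) (phase n B))"
    by (simp add: phase_append)
  also have "\<dots> = pair n (phase n (A @ ?C)) (phase n B)"
    by (simp add: phase_append pair_assoc)
  also have "\<dots> = phase n B"
    using \<open>phase n (A @ ?C) = Del n\<close> by simp
  finally show ?thesis .
qed

section \<open>Normal forms of circuits\<close>

definition tup :: "nat \<Rightarrow> nat set list \<Rightarrow> mor" where
  "tup n ps = Tup n (map (par_of n) ps)"

definition normal_form :: "nat \<Rightarrow> nat set list \<times> nat set list \<Rightarrow> mor" where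
  "normal_form n s = pair n (phase n (fst s)) (tup n (snd s))"

text \<open>
  A pair \<open>(A, ps)\<close> stands for a circuit with gadgets on the parities in \<open>A\<close> whose \<open>i\<close>-th output
  is the parity \<open>ps ! i\<close>.
\<close>

primrec run_gate :: "gate \<Rightarrow> nat set list \<times> nat set list \<Rightarrow> nat set list \<times> nat set list" where
  "run_gate (Tgate i) s = (snd s ! i # fst s, snd s)"
| "run_gate (CNOT i j) s = (fst s, (snd s)[j := sym_diff (snd s ! i) (snd s ! j)])"

definition initial :: "nat \<Rightarrow> nat set list \<times> nat set list" where
  "initial n = ([], map (\<lambda>i. {i}) [0..<n])"

lemma arity_tup [simp]: "dom (tup n ps) = n" "cod (tup n ps) = length ps"
  by (simp_all add: tup_def cod_Tup)

lemma tup_append: "tup n (ps @ qs) = pair n (tup n ps) (tup n qs)"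
  by (simp add: tup_def Tup_append)

lemma tup_singleton: "tup n [p] = par_of n p"
  by (simp add: tup_def par_arity)

lemma arity_par_of [simp]: "dom (par_of n S) = n" "cod (par_of n S) = 1"
  using par_arity[OF par_par_of[of n S]] by simp_all

lemma par_of_dup: "par_of n S >> dup = pair n (par_of n S) (par_of n S)"
  using par_par_of[of n S] by (intro copyable_dup) (auto simp: par_def)

lemma tup_local:
  assumes "dom G = length bs"
  shows "tup n (as @ bs @ cs) >> (idm (length as) || G || idm (length cs)) =
    pair n (tup n as) (pair n (tup n bs >> G) (tup n cs))"
  using assms by (simp add: tup_append pair_cmp)

lemma tup_local_replace:
  assumes "dom G = length bs" "tup n bs >> G = tup n bs'"
  shows "tup n (as @ bs @ cs) >> (idm (length as) || G || idm (length cs)) = tup n (as @ bs' @ cs)"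
  using tup_local[OF assms(1), of n as cs] unfolding assms(2) by (simp only: tup_append)

text \<open>Lets a gadget created in the middle of the tuple move out to the other gadgets.\<close>

lemma pair_phase_front:
  assumes "dom f = n" "dom g = n" "dom h = n" "cod g = 0"
  shows "pair n f (pair n g h) = pair n g (pair n f h)"
  using pair_comm0[of g n f] assms by (simp flip: pair_assoc)

lemma normal_form_local:
  "dom G = length ps \<Longrightarrow> normal_form n (A, ps) >> G = pair n (phase n A) (tup n ps >> G)"
  using pair_cmp[of "phase n A" "idm 0" n "tup n ps" G] by (simp add: normal_form_def)

text \<open>A phase on a wire is the same phase as an effect on a copy of that wire, by
  fusion.\<close>

lemma gadget_gate: "par_of n S >> sp Z 1 1 (pi / 4) = pair n (gadget n S) (par_of n S)"
proof -
  have "sp Z 1 1 (pi / 4) = dup >> (tee || idm 1)"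
    using sp_fusion'[of 1 0 Z 1 1 0 0 "pi / 4"] by simp
  then show ?thesis
    by (simp add: par_of_dup pair_cmp gadget_def flip: cmp_assoc)
qed

lemma tup_tgate:
  "tup n (as @ [p] @ cs) >> (idm (length as) || sp Z 1 1 (pi / 4) || idm (length cs)) =
    pair n (gadget n p) (tup n (as @ [p] @ cs))"
proof -
  have "tup n (as @ [p] @ cs) >> (idm (length as) || sp Z 1 1 (pi / 4) || idm (length cs)) =
      pair n (tup n as) (pair n (pair n (gadget n p) (par_of n p)) (tup n cs))"
    by (subst tup_local) (simp_all add: tup_singleton gadget_gate)
  also have "\<dots> = pair n (gadget n p) (pair n (tup n as) (pair n (par_of n p) (tup n cs)))"
    by (simp add: pair_assoc pair_phase_front[of "tup n as" n "gadget n p"])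
  finally show ?thesis
    by (simp only: tup_append tup_singleton)
qed

text \<open>The link without spectator wires; k is the number of wires crossed by the joining
  wire.\<close>

definition link_core :: "colour \<Rightarrow> colour \<Rightarrow> nat \<Rightarrow> mor" where
  "link_core c d k = (idm (1 + k) || sp d 1 2 0) >> (idm 1 || sw k 1 || idm 1) >> (sp c 2 1 0 || idm (k + 1))"

lemma arity_link_core [simp]: "dom (link_core c d k) = 1 + k + 1" "cod (link_core c d k) = 1 + k + 1"
  by (simp_all add: link_core_def)

lemma cls_link:
  "cls (link (i + 1 + k + 1 + r) c i d (i + 1 + k)) = idm i || link_core c d k || idm r"
proof -
  have a: "idm (i + 1 + k) || sp d 1 2 0 || idm r = idm i || (idm (1 + k) || sp d 1 2 0) || idm r"
    by (simp add: add.assoc tns_assoc flip: idm_tns)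
  have b: "idm (i + 1) || sw k 1 || idm (1 + r) = idm i || (idm 1 || sw k 1 || idm 1) || idm r"
    by (simp add: add.assoc tns_assoc flip: idm_tns)
  have c: "idm i || sp c 2 1 0 || idm (k + 1 + r) = idm i || (sp c 2 1 0 || idm (k + 1)) || idm r"
    by (simp add: tns_assoc idm_tns)
  have "cls (link (i + 1 + k + 1 + r) c i d (i + 1 + k)) =
      (idm (i + 1 + k) || sp d 1 2 0 || idm r) >> (idm (i + 1) || sw k 1 || idm (1 + r)) >>
      (idm i || sp c 2 1 0 || idm (k + 1 + r))"
    unfolding link_def cls_comp cls_tensor cls_pass
    by (simp add: idm_def sp_def add_ac)
  also have "\<dots> = idm i || link_core c d k || idm r"
    unfolding a b c link_core_def by (simp add: interchange)
  finally show ?thesis .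
qed

text \<open>The control is the lower wire here: its parity is copied, the copy crosses the middle
  block and is added to the target, layer by layer as in the definition.\<close>

lemma tup_link_core_XZ:
  "tup n ([a] @ bs @ [b]) >> link_core X Z (length bs) = tup n ([sym_diff b a] @ bs @ [b])"
proof -
  let ?a = "par_of n a" and ?b = "par_of n b" and ?B = "tup n bs" and ?k = "length bs"
  have 1: "tup n ([a] @ bs @ [b]) = pair n (pair n ?a ?B) ?b"
    by (simp add: tup_append tup_singleton pair_assoc del: append_Cons)
  have "pair n (pair n ?a ?B) ?b >> (idm (1 + ?k) || dup) = pair n (pair n ?a ?B) (pair n ?b ?b)"
    by (simp add: pair_cmp par_of_dup)
  then have 2: "pair n (pair n ?a ?B) ?b >> (idm (1 + ?k) || dup) = pair n ?a (pair n (pair n ?B ?b) ?b)"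
    by (simp add: pair_assoc)
  have "pair n ?a (pair n (pair n ?B ?b) ?b) >> (idm 1 || sw ?k 1 || idm 1) = pair n ?a (pair n (pair n ?b ?B) ?b)"
    using pair_swap[of ?B n ?b] by (simp add: pair_cmp)
  then have 3: "pair n ?a (pair n (pair n ?B ?b) ?b) >> (idm 1 || sw ?k 1 || idm 1) =
      pair n (pair n ?a ?b) (pair n ?B ?b)"
    by (simp add: pair_assoc)
  have 4: "pair n (pair n ?a ?b) (pair n ?B ?b) >> (add || idm (?k + 1)) = pair n (par_of n (sym_diff b a)) (pair n ?B ?b)"
    by (simp add: pair_cmp par_of_sym_diff plus_par_comm[of n ?b ?a]) (simp add: plus_par_def)
  have "tup n ([a] @ bs @ [b]) >> link_core X Z ?k = pair n (par_of n (sym_diff b a)) (pair n ?B ?b)"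
    unfolding link_core_def 1 cmp_assoc[symmetric] 2 3 4 ..
  then show ?thesis
    by (simp only: tup_append tup_singleton)
qed

text \<open>The wire joining the two spiders may be bent the other way.\<close>

lemma link_core_ZX:
  "link_core Z X k = (dup || idm (k + 1)) >> (idm 1 || sw 1 k || idm 1) >> (idm (1 + k) || add)"
proof -
  let ?cup = "sp Z 0 2 0"
  let ?E = "idm 1 || ((?cup || idm k) >> (idm 1 || sw 1 k)) || idm 1"
  \<comment> \<open>In this orientation the joining wire leaves the X-spider and enters the
    Z-spider. Writing the former as \<open>add\<close> after a cup, and the merge as a cap after
    \<open>dup\<close>, makes cup and cap meet and straighten.\<close>
  have X12: "sp X 1 2 0 = (?cup || idm 1) >> (idm 1 || add)"
    using sp_fusion[of 1 X 0 1 0 1 1 0] by (simp add: sp_cup)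
  have mrg: "mrg = (dup || idm 1) >> (idm 1 || bend)"
    using sp_fusion[of 1 Z 1 1 0 1 0 0] by simp
  have snake: "(idm 1 || ?cup) >> (bend || idm 1) = idm 1"
    using sp_fusion'[of 1 1 Z 0 1 0 0 0] sp_identity[of Z] by simp
  have cup0: "?cup || idm k = (idm k || ?cup) >> (sw k 1 || idm 1) >> (idm 1 || sw k 1)"
    using sw_slide[of "idm k" k ?cup 2 k 0] sw_add_right[of k 1 1] by (simp add: cmp_assoc)
  have inv: "(idm 1 || sw k 1) >> (idm 1 || sw 1 k) = idm (1 + (k + 1))"
    by (simp add: interchange idm_tns)
  \<comment> \<open>A cup whose legs straddle a block of k wires may be drawn on either side of the
    block.\<close>
  have cup: "(idm k || ?cup) >> (sw k 1 || idm 1) = (?cup || idm k) >> (idm 1 || sw 1 k)"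
    unfolding cup0 by (simp add: cmp_assoc inv add.assoc)
  have 1: "idm (1 + k) || sp X 1 2 0 = (idm 1 || (idm k || ?cup) || idm 1) >> (idm (2 + k) || add)"
  proof -
    have "idm (1 + k) || sp X 1 2 0 = (idm (1 + k) || ?cup || idm 1) >> (idm (1 + k) || idm 1 || add)"
      unfolding X12 by (simp add: interchange)
    also have "idm (1 + k) || idm 1 || add = idm (2 + k) || add"
    proof -
      have e: "1 + k + 1 = 2 + k"
        by simp
      have "idm (1 + k) || idm 1 = idm (2 + k)"
        unfolding idm_tns e ..
      then show ?thesis
        by (simp only: tns_assoc[symmetric])
    qed
    also have "idm (1 + k) || ?cup || idm 1 = idm 1 || (idm k || ?cup) || idm 1"
      by (simp add: tns_assoc flip: idm_tns)
    finally show ?thesis .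
  qed
  have 2: "(idm (2 + k) || add) >> (idm 1 || sw k 1 || idm 1) = (idm 1 || (sw k 1 || idm 1) || idm 1) >> (idm (2 + k) || add)"
  proof -
    have "(idm (2 + k) || add) >> (idm 1 || sw k 1 || idm 1) = (idm 1 || sw k 1) || add"
      using interchange[of "idm (2 + k)" "idm 1 || sw k 1" add "idm 1"] by (simp add: tns_assoc)
    also have "\<dots> = (idm 1 || (sw k 1 || idm 1) || idm 1) >> (idm (2 + k) || add)"
      using interchange[of "idm 1 || sw k 1" "idm (2 + k)" "idm 2" add] idm_tns[of 1 1] by (simp add: tns_assoc)
    finally show ?thesis .
  qed
  have 3: "?E = (idm 1 || ?cup || idm (k + 1)) >> (idm 2 || sw 1 k || idm 1)"
  proof -
    have "?E = (idm 1 || (?cup || idm k) || idm 1) >> (idm 1 || (idm 1 || sw 1 k) || idm 1)"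
      by (simp add: interchange)
    also have "idm 1 || (?cup || idm k) || idm 1 = idm 1 || ?cup || idm (k + 1)"
      by (simp add: tns_assoc idm_tns)
    also have "idm 1 || (idm 1 || sw 1 k) || idm 1 = idm 2 || sw 1 k || idm 1"
      using idm_tns[of 1 1] by (simp flip: tns_assoc)
    finally show ?thesis .
  qed
  have "link_core Z X k = ?E >> ((idm (2 + k) || add) >> (mrg || idm (k + 1)))"
  proof -
    have "link_core Z X k = (idm 1 || (idm k || ?cup) || idm 1) >> ((idm (2 + k) || add) >> (idm 1 || sw k 1 || idm 1)) >>
        (mrg || idm (k + 1))"
      unfolding link_core_def 1 by (simp only: cmp_assoc)
    also have "\<dots> = ((idm 1 || (idm k || ?cup) || idm 1) >> (idm 1 || (sw k 1 || idm 1) || idm 1)) >>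
        ((idm (2 + k) || add) >> (mrg || idm (k + 1)))"
      unfolding 2 by (simp only: cmp_assoc)
    also have "(idm 1 || (idm k || ?cup) || idm 1) >> (idm 1 || (sw k 1 || idm 1) || idm 1) = ?E"
      by (simp add: interchange cup)
    finally show ?thesis .
  qed
  also have "(idm (2 + k) || add) >> (mrg || idm (k + 1)) = (mrg || idm (k + 2)) >> (idm (1 + k) || add)"
  proof -
    have "(idm 2 || (idm k || add)) >> (mrg || idm (k + 1)) = (mrg || idm (k + 2)) >> (idm 1 || (idm k || add))"
      by (simp add: interchange)
    then show ?thesis
      by (simp add: idm_tns flip: tns_assoc)
  qed
  also have "mrg || idm (k + 2) = (dup || idm (1 + (k + 2))) >> (idm 1 || bend || idm (k + 2))"
  proof -
    have "mrg || idm (k + 2) = ((dup || idm 1) || idm (k + 2)) >> ((idm 1 || bend) || idm (k + 2))"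
      unfolding mrg by (subst interchange) simp_all
    then show ?thesis
      by (simp add: tns_assoc idm_tns)
  qed
  also have "?E >> ((dup || idm (1 + (k + 2))) >> (idm 1 || bend || idm (k + 2)) >> (idm (1 + k) || add)) =
      (dup || idm (k + 1)) >> (idm 1 || sw 1 k || idm 1) >> (idm (1 + k) || add)"
  proof -
    have a: "(idm 2 || sw 1 k || idm 1) >> (dup || idm (1 + (k + 2))) = (dup || idm (1 + (k + 2))) >> (idm 3 || sw 1 k || idm 1)"
    proof -
      have "(idm 1 || (idm 1 || sw 1 k || idm 1)) >> (dup || idm (1 + (k + 2))) =
          (dup || idm (1 + (k + 2))) >> (idm 2 || (idm 1 || sw 1 k || idm 1))"
        by (simp add: interchange)
      then show ?thesis
        using idm_tns[of 1 1] idm_tns[of 2 1] by (simp flip: tns_assoc)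
    qed
    have b: "(idm 1 || ?cup || idm (k + 1)) >> (dup || idm (1 + (k + 2))) = (dup || idm (k + 1)) >> (idm 2 || ?cup || idm (k + 1))"
      by (simp add: interchange)
    have c: "(idm 3 || sw 1 k || idm 1) >> (idm 1 || bend || idm (k + 2)) =
        (idm 1 || bend || idm (k + 2)) >> (idm 1 || sw 1 k || idm 1)"
    proof -
      have "(idm 1 || idm 2 || (sw 1 k || idm 1)) >> (idm 1 || bend || idm (k + 2)) =
          (idm 1 || bend || idm (k + 2)) >> (idm 1 || idm 0 || (sw 1 k || idm 1))"
        by (simp add: interchange del: tns_idm_0)
      then show ?thesis
        using idm_tns[of 1 2] by (simp flip: tns_assoc)
    qed
    have d: "(idm 2 || ?cup || idm (k + 1)) >> (idm 1 || bend || idm (k + 2)) = idm (k + 3)"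
    proof -
      have e: "idm 2 || ?cup || idm (k + 1) = idm 1 || (idm 1 || ?cup) || idm (k + 1)"
        using idm_tns[of 1 1] by (simp flip: tns_assoc)
      have f: "idm 1 || bend || idm (k + 2) = idm 1 || (bend || idm 1) || idm (k + 1)"
      proof -
        have "k + 2 = 1 + (k + 1)"
          by simp
        then show ?thesis
          by (simp only: tns_assoc idm_tns)
      qed
      show ?thesis
      proof -
        have g: "1 + (1 + (k + 1)) = k + 3"
          by simp
        have "(idm 1 || (idm 1 || ?cup) || idm (k + 1)) >> (idm 1 || (bend || idm 1) || idm (k + 1)) =
            idm 1 || idm 1 || idm (k + 1)"
          by (simp add: interchange snake)
        then show ?thesis
          unfolding e f by (simp only: idm_tns g)
      qed
    qed
    have "?E >> ((dup || idm (1 + (k + 2))) >> (idm 1 || bend || idm (k + 2)) >> (idm (1 + k) || add)) =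
        (idm 1 || ?cup || idm (k + 1)) >> ((idm 2 || sw 1 k || idm 1) >> (dup || idm (1 + (k + 2)))) >>
        (idm 1 || bend || idm (k + 2)) >> (idm (1 + k) || add)"
      unfolding 3 by (simp only: cmp_assoc)
    also have "\<dots> = ((idm 1 || ?cup || idm (k + 1)) >> (dup || idm (1 + (k + 2)))) >>
        ((idm 3 || sw 1 k || idm 1) >> (idm 1 || bend || idm (k + 2))) >> (idm (1 + k) || add)"
      unfolding a by (simp only: cmp_assoc)
    also have "\<dots> = (dup || idm (k + 1)) >> ((idm 2 || ?cup || idm (k + 1)) >> (idm 1 || bend || idm (k + 2))) >>
        (idm 1 || sw 1 k || idm 1) >> (idm (1 + k) || add)"
      unfolding b c by (simp only: cmp_assoc)
    also have "\<dots> = (dup || idm (k + 1)) >> (idm 1 || sw 1 k || idm 1) >> (idm (1 + k) || add)"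
      unfolding d by simp
    finally show ?thesis .
  qed
  finally show ?thesis .
qed

lemma tup_link_core_ZX:
  "tup n ([a] @ bs @ [b]) >> link_core Z X (length bs) = tup n ([a] @ bs @ [sym_diff a b])"
proof -
  let ?a = "par_of n a" and ?b = "par_of n b" and ?B = "tup n bs" and ?k = "length bs"
  have 1: "tup n ([a] @ bs @ [b]) = pair n ?a (pair n ?B ?b)"
    by (simp only: tup_append tup_singleton)
  have "pair n ?a (pair n ?B ?b) >> (dup || idm (?k + 1)) = pair n (pair n ?a ?a) (pair n ?B ?b)"
    by (simp add: pair_cmp par_of_dup)
  then have 2: "pair n ?a (pair n ?B ?b) >> (dup || idm (?k + 1)) = pair n ?a (pair n (pair n ?a ?B) ?b)"
    by (simp add: pair_assoc)
  have "pair n ?a (pair n (pair n ?a ?B) ?b) >> (idm 1 || sw 1 ?k || idm 1) = pair n ?a (pair n (pair n ?B ?a) ?b)"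
    using pair_swap[of ?a n ?B] by (simp add: pair_cmp)
  then have 3: "pair n ?a (pair n (pair n ?a ?B) ?b) >> (idm 1 || sw 1 ?k || idm 1) =
      pair n (pair n ?a ?B) (pair n ?a ?b)"
    by (simp add: pair_assoc)
  have 4: "pair n (pair n ?a ?B) (pair n ?a ?b) >> (idm (1 + ?k) || add) = pair n (pair n ?a ?B) (par_of n (sym_diff a b))"
    by (simp add: pair_cmp par_of_sym_diff) (simp add: plus_par_def)
  have "tup n ([a] @ bs @ [b]) >> link_core Z X ?k = pair n (pair n ?a ?B) (par_of n (sym_diff a b))"
    unfolding link_core_ZX 1 cmp_assoc[symmetric] 2 3 4 ..
  then show ?thesis
    by (simp only: tup_append tup_singleton) (simp add: pair_assoc)
qed

lemma split_list_2:
  assumes "i < j" "j < length ps"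
  obtains as a bs b cs where "ps = as @ ([a] @ bs @ [b]) @ cs" "length as = i" "length bs = j - i - 1"
    "length cs = length ps - j - 1" "ps ! i = a" "ps ! j = b"
proof
  let ?t = "drop (Suc i) ps"
  have "ps = take i ps @ ps ! i # ?t"
    using assms by (simp add: id_take_nth_drop)
  also have "?t = take (j - i - 1) ?t @ ps ! j # drop (Suc j) ps"
    using assms id_take_nth_drop[of "j - i - 1" ?t] by (simp add: One_nat_def)
  finally show "ps = take i ps @ ([ps ! i] @ take (j - i - 1) ?t @ [ps ! j]) @ drop (Suc j) ps"
    by simp
qed (use assms in auto)

text \<open>The gadgets have no outputs, so a gate acts on the tuple alone; a T gate then sends one
  new gadget forward, a CNOT replaces one parity.\<close>

lemma normal_form_gate:
  assumes "valid_gate n g" "length (snd s) = n"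
  shows "normal_form n s >> cls (gate_diagram n g) = normal_form n (run_gate g s)"
proof -
  obtain A ps where s: "s = (A, ps)" and len: "length ps = n"
    using assms(2) by (cases s) auto
  show ?thesis
  proof (cases g)
    case (Tgate i)
    then have i: "i < length ps"
      using assms len by simp
    define as cs where "as = take i ps" and "cs = drop (Suc i) ps"
    have ps: "ps = as @ [ps ! i] @ cs"
      using i by (simp add: as_def cs_def id_take_nth_drop)
    have l: "length as = i" "length cs = n - i - 1"
      using i len by (auto simp: as_def cs_def)
    have "cls (gate_diagram n g) = idm (length as) || sp Z 1 1 (pi / 4) || idm (length cs)"
      using l by (simp add: Tgate cls_tensor idm_def sp_def)
    moreover have "tup n ps >> (idm (length as) || sp Z 1 1 (pi / 4) || idm (length cs)) =
        pair n (gadget n (ps ! i)) (tup n ps)"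
      using tup_tgate[of n as "ps ! i" cs] ps by simp
    ultimately have "normal_form n s >> cls (gate_diagram n g) =
        pair n (phase n A) (pair n (gadget n (ps ! i)) (tup n ps))"
      using l i len by (simp add: s normal_form_local)
    also have "\<dots> = pair n (phase n (ps ! i # A)) (tup n ps)"
      by (simp add: pair_assoc pair_phase_front[of "phase n A" n "gadget n (ps ! i)"])
    finally show ?thesis
      by (simp add: s Tgate normal_form_def)
  next
    case (CNOT i j)
    show ?thesis
    proof (cases "i < j")
      case True
      have "j < length ps"
        using assms len CNOT by simp
      with True obtain as a bs b cs where ps: "ps = as @ ([a] @ bs @ [b]) @ cs" "length as = i"
        "length bs = j - i - 1" "length cs = length ps - j - 1" "ps ! i = a" "ps ! j = b"
        by (rule split_list_2)
      have n: "n = i + 1 + length bs + 1 + length cs" "j = i + 1 + length bs"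
        using ps(2-4) len True \<open>j < length ps\<close> by auto
      have gd: "cls (gate_diagram n g) = idm (length as) || link_core Z X (length bs) || idm (length cs)"
      proof -
        have "cls (link n Z i X j) = idm i || link_core Z X (length bs) || idm (length cs)"
          unfolding n by (rule cls_link)
        then show ?thesis
          using True unfolding CNOT ps(2) by simp
      qed
      have "tup n ps >> cls (gate_diagram n g) = tup n (as @ ([a] @ bs @ [sym_diff a b]) @ cs)"
        unfolding gd ps(1) by (rule tup_local_replace[OF _ tup_link_core_ZX]) simp
      moreover have "ps[j := sym_diff a b] = as @ ([a] @ bs @ [sym_diff a b]) @ cs"
      proof -
        have "ps = (as @ [a] @ bs) @ b # cs" "length (as @ [a] @ bs) = j"
          using ps n by auto
        then show ?thesis
          by (metis append.assoc append_Cons append_Nil list_update_length)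
      qed
      ultimately show ?thesis
        using ps gate_diagram_wf[OF assms(1)] len by (simp add: s CNOT normal_form_local) (simp add: normal_form_def)
    next
      case False
      then have ji: "j < i"
        using assms CNOT by auto
      have "i < length ps"
        using assms len CNOT by simp
      with ji obtain as a bs b cs where ps: "ps = as @ ([a] @ bs @ [b]) @ cs" "length as = j"
        "length bs = i - j - 1" "length cs = length ps - i - 1" "ps ! j = a" "ps ! i = b"
        by (rule split_list_2)
      have n: "n = j + 1 + length bs + 1 + length cs" "i = j + 1 + length bs"
        using ps(2-4) len ji \<open>i < length ps\<close> by auto
      have gd: "cls (gate_diagram n g) = idm (length as) || link_core X Z (length bs) || idm (length cs)"
      proof -
        have "cls (link n X j Z i) = idm j || link_core X Z (length bs) || idm (length cs)"
          unfolding n by (rule cls_link)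
        then show ?thesis
          using ji unfolding CNOT ps(2) by simp
      qed
      have "tup n ps >> cls (gate_diagram n g) = tup n (as @ ([sym_diff b a] @ bs @ [b]) @ cs)"
        unfolding gd ps(1) by (rule tup_local_replace[OF _ tup_link_core_XZ]) simp
      moreover have "ps[j := sym_diff b a] = as @ ([sym_diff b a] @ bs @ [b]) @ cs"
        unfolding ps(1) using ps(2) by (simp add: list_update_append)
      ultimately show ?thesis
        using ps gate_diagram_wf[OF assms(1)] len by (simp add: s CNOT normal_form_local) (simp add: normal_form_def)
    qed
  qed
qed

lemma length_run_gate [simp]: "length (snd (run_gate g s)) = length (snd s)"
  by (cases g) simp_all

lemma normal_form_circuit:
  "is_circuit n gs \<Longrightarrow> length (snd s) = n \<Longrightarrow>
    normal_form n s >> cls (circuit_diagram n gs) = normal_form n (fold run_gate gs s)"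
proof (induction gs arbitrary: s)
  case Nil
  then show ?case
    by (simp add: normal_form_def flip: idm_def)
next
  case (Cons g gs)
  then have "normal_form n s >> cls (gate_diagram n g) = normal_form n (run_gate g s)"
    by (intro normal_form_gate) (auto simp: is_circuit_def)
  with Cons show ?case
    by (simp add: cls_comp is_circuit_def flip: cmp_assoc)
qed

lemma normal_form_initial: "normal_form n (initial n) = idm n"
  using Tup_identity[of n] by (simp add: normal_form_def initial_def tup_def o_def)

lemma cls_circuit:
  assumes "is_circuit n gs"
  shows "cls (circuit_diagram n gs) = normal_form n (fold run_gate gs (initial n))"
proof -
  have "normal_form n (initial n) >> cls (circuit_diagram n gs) = normal_form n (fold run_gate gs (initial n))"
    using assms by (rule normal_form_circuit) (simp add: initial_def)
  then show ?thesis
    using circuit_diagram_wf[OF assms] by (simp add: normal_form_initial)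
qed

section \<open>The linear maps denoted by circuits\<close>

lemma finite_bit_strings: "finite {z :: bool list. length z = n}"
  using finite_lists_length_eq[of "UNIV :: bool set" n] by simp

lemma sum_bit_string_delta:
  fixes f :: "bool list \<Rightarrow> complex"
  assumes "length a = n"
  shows "(\<Sum>z | length z = n. (if z = a then c else 0) * f z) = c * f a"
proof -
  have "(\<Sum>z | length z = n. (if z = a then c else 0) * f z) = (\<Sum>z | length z = n. if z = a then c * f z else 0)"
    by (rule sum.cong) auto
  then show ?thesis
    using assms by (simp add: finite_bit_strings)
qed

lemma interp_wiring:
  "is_wiring K \<Longrightarrow> wf_zx K \<Longrightarrow> length x = ins K \<Longrightarrow> length y = outs K \<Longrightarrow>
    interp K x y = (if y = permuted K x then 1 else 0)"
proof (induction K arbitrary: x y)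
  case (Comp D E)
  have len: "length (permuted D x) = outs D"
    using Comp.prems is_wiring_outs[of D] by simp
  have "interp (D ;; E) x y = (\<Sum>z | length z = outs D. (if z = permuted D x then 1 else 0) * interp E z y)"
    unfolding interp.simps by (rule sum.cong) (use Comp in auto)
  also have "\<dots> = interp E (permuted D x) y"
    using len by (simp add: sum_bit_string_delta)
  finally show ?case
    using Comp len by simp
next
  case (Tensor D E)
  have "length (permuted D (take (ins D) x)) = outs D"
    using Tensor.prems is_wiring_outs[of D] by simp
  then have "(y = permuted (D \<otimes> E) x) \<longleftrightarrow> take (outs D) y = permuted D (take (ins D) x) \<and>
      drop (outs D) y = permuted E (drop (ins D) x)"
    by (auto simp: append_eq_conv_conj) (metis append_take_drop_id)
  with Tensor show ?case
    by auto
qed auto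

lemma interp_layer:
  assumes "length as = i" "length as' = i" "length bs = ins D" "length bs' = outs D"
  shows "interp (Wires i \<otimes> D \<otimes> Wires k) (as @ bs @ cs) (as' @ bs' @ cs') =
    (if as = as' \<and> cs = cs' then interp D bs bs' else 0)"
  using assms by simp

text \<open>The identity wires force the outer bits of the intermediate string, so the sum runs over
  the outputs of D only.\<close>

lemma sum_layer:
  assumes "length as = i" "length cs = k" "length bs = ins D" "m = i + outs D + k"
  shows "(\<Sum>w | length w = m. interp (Wires i \<otimes> D \<otimes> Wires k) (as @ bs @ cs) w * G w) =
    (\<Sum>bs' | length bs' = outs D. interp D bs bs' * G (as @ bs' @ cs))"
proof -
  let ?L = "interp (Wires i \<otimes> D \<otimes> Wires k) (as @ bs @ cs)"
  let ?B = "{bs' :: bool list. length bs' = outs D}"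
  have inj: "inj_on (\<lambda>bs'. as @ bs' @ cs) ?B"
    by (auto simp: inj_on_def)
  have "(\<Sum>w | length w = m. ?L w * G w) = (\<Sum>w \<in> (\<lambda>bs'. as @ bs' @ cs) ` ?B. ?L w * G w)"
  proof (rule sum.mono_neutral_right)
    show "\<forall>w \<in> {w. length w = m} - (\<lambda>bs'. as @ bs' @ cs) ` ?B. ?L w * G w = 0"
    proof
      fix w assume w: "w \<in> {w. length w = m} - (\<lambda>bs'. as @ bs' @ cs) ` ?B"
      define as' bs' cs' where "as' = take i w" and "bs' = take (outs D) (drop i w)"
        and "cs' = drop (outs D) (drop i w)"
      have w': "w = as' @ bs' @ cs'" and l: "length as' = i" "length bs' = outs D"
        using w assms by (auto simp: as'_def bs'_def cs'_def simp del: drop_drop)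
      have "\<not> (as = as' \<and> cs = cs')"
        using w w' l by auto
      then have "?L w = 0"
        unfolding w' using assms l by (subst interp_layer) auto
      then show "?L w * G w = 0"
        by simp
    qed
  qed (use assms finite_bit_strings in auto)
  also have "\<dots> = (\<Sum>bs' \<in> ?B. ?L (as @ bs' @ cs) * G (as @ bs' @ cs))"
    by (subst sum.reindex[OF inj]) (simp only: o_def)
  also have "\<dots> = (\<Sum>bs' \<in> ?B. interp D bs bs' * G (as @ bs' @ cs))"
  proof (rule sum.cong)
    fix bs' :: "bool list" assume "bs' \<in> ?B"
    then show "?L (as @ bs' @ cs) * G (as @ bs' @ cs) = interp D bs bs' * G (as @ bs' @ cs)"
      using interp_layer[OF assms(1) assms(1) assms(3), of bs' k cs cs] by (simp del: interp.simps)
  qed simp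
  finally show ?thesis .
qed

lemma nth_Cons_1: "(x # y # zs) ! 1 = y"
  by (simp add: One_nat_def)

lemma bit_strings_2: "{z :: bool list. length z = 2} = {[False, False], [False, True], [True, False], [True, True]}"
  unfolding numeral_2_eq_2 lists_length_Suc by auto

text \<open>The two summed bits leave the spider of colour d: the first travels across the k wires
  to the spider of colour c, the second stays on its own wire.\<close>

lemma interp_link:
  assumes "length as = i" "length bs = k" "length cs = r" "length as' = i" "length ys = k + 1 + r"
  shows "interp (link (i + 1 + k + 1 + r) c i d (i + 1 + k)) (as @ [a] @ bs @ [b] @ cs) (as' @ [a'] @ ys) =
    (\<Sum>bs' | length bs' = 2. interp (Spider d 1 2 0) [b] bs' *
      (if as = as' \<and> bs @ [bs' ! 1] @ cs = ys then interp (Spider c 2 1 0) [a, bs' ! 0] [a'] else 0))"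
proof -
  let ?x = "(as @ [a] @ bs) @ [b] @ cs" and ?y = "as' @ [a'] @ ys"
  let ?L1 = "Wires (i + 1 + k) \<otimes> Spider d 1 2 0 \<otimes> Wires r"
  let ?L2 = "Wires (i + 1) \<otimes> pass k \<otimes> Wires (1 + r)"
  let ?L3 = "Wires i \<otimes> Spider c 2 1 0 \<otimes> Wires (k + 1 + r)"
  let ?m = "i + 1 + k + 2 + r"
  have link: "link (i + 1 + k + 1 + r) c i d (i + 1 + k) = ?L1 ;; ?L2 ;; ?L3"
    by (simp add: link_def add_ac)
  have L2: "interp ?L2 w z = (if z = permuted ?L2 w then 1 else 0)" if "length w = ?m" "length z = ?m" for w z
    using that by (intro interp_wiring) auto
  have "interp (?L1 ;; ?L2 ;; ?L3) ?x ?y =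
      (\<Sum>z | length z = ?m. (\<Sum>w | length w = ?m. interp ?L1 ?x w * interp ?L2 w z) * interp ?L3 z ?y)"
  proof -
    have o: "outs (?L1 ;; ?L2) = ?m" "outs ?L1 = ?m"
      by simp_all
    show ?thesis
      unfolding interp.simps(7) o ..
  qed
  also have "\<dots> = (\<Sum>w | length w = ?m. interp ?L1 ?x w * (\<Sum>z | length z = ?m. interp ?L2 w z * interp ?L3 z ?y))"
    unfolding sum_distrib_right sum_distrib_left by (subst sum.swap) (simp only: mult.assoc)
  also have "\<dots> = (\<Sum>w | length w = ?m. interp ?L1 ?x w * interp ?L3 (permuted ?L2 w) ?y)"
  proof (rule sum.cong)
    fix w :: "bool list" assume w: "w \<in> {w. length w = ?m}"
    have "(\<Sum>z | length z = ?m. interp ?L2 w z * interp ?L3 z ?y) =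
        (\<Sum>z | length z = ?m. (if z = permuted ?L2 w then 1 else 0) * interp ?L3 z ?y)"
      by (rule sum.cong) (use w L2 in auto)
    also have "\<dots> = interp ?L3 (permuted ?L2 w) ?y"
      using w by (subst sum_bit_string_delta) auto
    finally show "interp ?L1 ?x w * (\<Sum>z | length z = ?m. interp ?L2 w z * interp ?L3 z ?y) =
        interp ?L1 ?x w * interp ?L3 (permuted ?L2 w) ?y"
      by simp
  qed simp
  also have "\<dots> = (\<Sum>bs' | length bs' = outs (Spider d 1 2 0). interp (Spider d 1 2 0) [b] bs' *
      interp ?L3 (permuted ?L2 ((as @ [a] @ bs) @ bs' @ cs)) ?y)"
    by (rule sum_layer) (use assms in auto)
  also have "\<dots> = (\<Sum>bs' | length bs' = 2. interp (Spider d 1 2 0) [b] bs' *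
      (if as = as' \<and> bs @ [bs' ! 1] @ cs = ys then interp (Spider c 2 1 0) [a, bs' ! 0] [a'] else 0))"
  proof (rule sum.cong)
    fix bs' :: "bool list" assume "bs' \<in> {bs'. length bs' = 2}"
    then obtain b1 b2 where bs': "bs' = [b1, b2]"
      unfolding bit_strings_2 by auto
    have "permuted ?L2 ((as @ [a] @ bs) @ bs' @ cs) = as @ [a, b1] @ (bs @ [b2] @ cs)"
      using assms by (simp add: bs' One_nat_def)
    then have "interp ?L3 (permuted ?L2 ((as @ [a] @ bs) @ bs' @ cs)) ?y =
        (if as = as' \<and> bs @ [b2] @ cs = ys then interp (Spider c 2 1 0) [a, b1] [a'] else 0)"
      using interp_layer[of as i as' "[a, b1]" "Spider c 2 1 0" "[a']" "k + 1 + r" "bs @ [b2] @ cs" ys] assms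
      by (simp only:) simp
    then show "interp (Spider d 1 2 0) [b] bs' * interp ?L3 (permuted ?L2 ((as @ [a] @ bs) @ bs' @ cs)) ?y =
        interp (Spider d 1 2 0) [b] bs' *
        (if as = as' \<and> bs @ [bs' ! 1] @ cs = ys then interp (Spider c 2 1 0) [a, bs' ! 0] [a'] else 0)"
      by (simp only: bs' nth_Cons_0 nth_Cons_1)
  qed simp
  finally show ?thesis
    unfolding link by simp
qed

text \<open>The common value of the nonzero entries of a phase-free three-legged X-spider: two basis
  terms, each with three factors 1 / sqrt 2.\<close>

definition cnot_scalar :: complex where
  "cnot_scalar = 2 / (complex_of_real (sqrt 2)) ^ 3"

lemma cnot_scalar_nonzero: "cnot_scalar \<noteq> 0"
  by (simp add: cnot_scalar_def)

lemma interp_spiders: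
  "interp (Spider Z 1 2 0) [b] [b1, b2] = (if b = b1 \<and> b = b2 then 1 else 0)"
  "interp (Spider Z 2 1 0) [b1, b2] [b] = (if b = b1 \<and> b = b2 then 1 else 0)"
  "interp (Spider X 1 2 0) [b] [b1, b2] = (if b = (b1 \<noteq> b2) then cnot_scalar else 0)"
  "interp (Spider X 2 1 0) [b1, b2] [b] = (if b = (b1 \<noteq> b2) then cnot_scalar else 0)"
  by (cases b; cases b1; cases b2; simp add: ket_power_def bra_power_def cnot_scalar_def power3_eq_cube)+

lemma interp_cnot_link:
  assumes "length as = i" "length bs = k" "length cs = r" "length y = i + 1 + k + 1 + r"
  shows "interp (link (i + 1 + k + 1 + r) Z i X (i + 1 + k)) (as @ [a] @ bs @ [b] @ cs) y =
      (if y = as @ [a] @ bs @ [a \<noteq> b] @ cs then cnot_scalar else 0)"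
    and "interp (link (i + 1 + k + 1 + r) X i Z (i + 1 + k)) (as @ [a] @ bs @ [b] @ cs) y =
      (if y = as @ [a \<noteq> b] @ bs @ [b] @ cs then cnot_scalar else 0)"
proof -
  define as' ys where "as' = take i y" and "ys = drop (Suc i) y"
  have y: "y = as' @ [y ! i] @ ys" and l: "length as' = i" "length ys = k + 1 + r"
    using assms by (auto simp: as'_def ys_def id_take_nth_drop)
  note simps = bit_strings_2 interp_spiders nth_Cons_1
  show "interp (link (i + 1 + k + 1 + r) Z i X (i + 1 + k)) (as @ [a] @ bs @ [b] @ cs) y =
      (if y = as @ [a] @ bs @ [a \<noteq> b] @ cs then cnot_scalar else 0)"
    by (subst (1 2) y, subst interp_link[OF assms(1-3) l])
      (use assms l in \<open>auto simp: simps simp del: interp.simps\<close>)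
  show "interp (link (i + 1 + k + 1 + r) X i Z (i + 1 + k)) (as @ [a] @ bs @ [b] @ cs) y =
      (if y = as @ [a \<noteq> b] @ bs @ [b] @ cs then cnot_scalar else 0)"
    by (subst (1 2) y, subst interp_link[OF assms(1-3) l])
      (use assms l in \<open>auto simp: simps simp del: interp.simps\<close>)
qed

section \<open>Circuits as permutations of the basis with phases\<close>

primrec gate_action :: "gate \<Rightarrow> bool list \<Rightarrow> bool list" where
  "gate_action (Tgate i) x = x"
| "gate_action (CNOT i j) x = x[j := (x ! i \<noteq> x ! j)]"

primrec gate_phase :: "gate \<Rightarrow> bool list \<Rightarrow> complex" where
  "gate_phase (Tgate i) x = (if x ! i then cis (pi / 4) else 1)"
| "gate_phase (CNOT i j) x = 1"

lemma length_gate_action [simp]: "length (gate_action g x) = length x"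
  by (cases g) simp_all

text \<open>The factor is left unspecified since it depends on the gate: 1 for T and
  \<open>cnot_scalar\<close> for CNOT.\<close>

lemma interp_gate:
  assumes "valid_gate n g"
  obtains \<kappa> where "\<kappa> \<noteq> 0" "\<And>x y. length x = n \<Longrightarrow> length y = n \<Longrightarrow>
    interp (gate_diagram n g) x y = (if y = gate_action g x then \<kappa> * gate_phase g x else 0)"
proof (cases g)
  case (Tgate i)
  have "interp (gate_diagram n g) x y = (if y = gate_action g x then 1 * gate_phase g x else 0)"
    if l: "length x = n" "length y = n" for x y
  proof -
    have i: "i < length x" "i < length y"
      using assms l Tgate by auto
    have x: "x = take i x @ [x ! i] @ drop (Suc i) x" and y: "y = take i y @ [y ! i] @ drop (Suc i) y"
      using i by (simp_all add: id_take_nth_drop)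
    have "interp (gate_diagram n g) x y = interp (Wires i \<otimes> Spider Z 1 1 (pi / 4) \<otimes> Wires (n - i - 1))
        (take i x @ [x ! i] @ drop (Suc i) x) (take i y @ [y ! i] @ drop (Suc i) y)"
      using x y Tgate by simp
    also have "\<dots> = (if take i x = take i y \<and> drop (Suc i) x = drop (Suc i) y
        then interp (Spider Z 1 1 (pi / 4)) [x ! i] [y ! i] else 0)"
      by (rule interp_layer) (use i in auto)
    also have "interp (Spider Z 1 1 (pi / 4)) [x ! i] [y ! i] = (if y ! i = x ! i then gate_phase g x else 0)"
      by (cases "x ! i"; cases "y ! i") (simp_all add: Tgate ket_power_def bra_power_def)
    also have "(if take i x = take i y \<and> drop (Suc i) x = drop (Suc i) y
        then (if y ! i = x ! i then gate_phase g x else 0) else 0) = (if y = x then gate_phase g x else 0)"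
    proof -
      have "take i x = take i y \<and> drop (Suc i) x = drop (Suc i) y \<and> y ! i = x ! i \<longleftrightarrow> y = x"
      proof
        assume "take i x = take i y \<and> drop (Suc i) x = drop (Suc i) y \<and> y ! i = x ! i"
        then have "take i y @ [y ! i] @ drop (Suc i) y = take i x @ [x ! i] @ drop (Suc i) x"
          by simp
        then show "y = x"
          by (simp only: x[symmetric] y[symmetric])
      qed simp
      then show ?thesis
        by auto
    qed
    finally show ?thesis
      by (simp add: Tgate)
  qed
  then show ?thesis
    by (rule that[rotated]) simp_all
next
  case (CNOT i j)
  have "interp (gate_diagram n g) x y = (if y = gate_action g x then cnot_scalar * gate_phase g x else 0)"
    if l: "length x = n" "length y = n" for x y
  proof (cases "i < j")
    case True
    moreover have "j < length x"
      using assms l CNOT by simp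
    ultimately obtain as a bs b cs where x: "x = as @ ([a] @ bs @ [b]) @ cs" "length as = i"
      "length bs = j - i - 1" "length cs = length x - j - 1" "x ! i = a" "x ! j = b"
      by (rule split_list_2)
    have n: "n = i + 1 + length bs + 1 + length cs" "j = i + 1 + length bs"
      using x(2-4) l True \<open>j < length x\<close> by auto
    have "interp (link n Z i X j) (as @ [a] @ bs @ [b] @ cs) y = (if y = as @ [a] @ bs @ [a \<noteq> b] @ cs then cnot_scalar else 0)"
      unfolding n by (rule interp_cnot_link(1)) (use x l n in auto)
    moreover have "gate_action g x = as @ [a] @ bs @ [a \<noteq> b] @ cs"
    proof -
      have e: "x = (as @ [a] @ bs) @ b # cs" "length (as @ [a] @ bs) = j"
        using x n by auto
      have "x[j := (a \<noteq> b)] = (as @ [a] @ bs) @ (a \<noteq> b) # cs"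
        by (subst e(1), subst e(2)[symmetric], rule list_update_length)
      then show ?thesis
        using x(5,6) by (simp add: CNOT)
    qed
    ultimately show ?thesis
      using True x(1) by (simp add: CNOT)
  next
    case False
    then have ji: "j < i"
      using assms CNOT by auto
    moreover have "i < length x"
      using assms l CNOT by simp
    ultimately obtain as a bs b cs where x: "x = as @ ([a] @ bs @ [b]) @ cs" "length as = j"
      "length bs = i - j - 1" "length cs = length x - i - 1" "x ! j = a" "x ! i = b"
      by (rule split_list_2)
    have n: "n = j + 1 + length bs + 1 + length cs" "i = j + 1 + length bs"
      using x(2-4) l ji \<open>i < length x\<close> by auto
    have "interp (link n X j Z i) (as @ [a] @ bs @ [b] @ cs) y = (if y = as @ [a \<noteq> b] @ bs @ [b] @ cs then cnot_scalar else 0)"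
      unfolding n by (rule interp_cnot_link(2)) (use x l n in auto)
    moreover have "gate_action g x = as @ [a \<noteq> b] @ bs @ [b] @ cs"
    proof -
      have "x[j := (a \<noteq> b)] = as @ (a \<noteq> b) # bs @ b # cs"
        using x(1,2) by (simp add: list_update_append)
      then show ?thesis
        using x(5,6) by (auto simp: CNOT)
    qed
    ultimately show ?thesis
      using False x(1) by (simp add: CNOT)
  qed
  then show ?thesis
    by (rule that[OF cnot_scalar_nonzero])
qed

primrec circuit_phase :: "gate list \<Rightarrow> bool list \<Rightarrow> complex" where
  "circuit_phase [] x = 1"
| "circuit_phase (g # gs) x = gate_phase g x * circuit_phase gs (gate_action g x)"

lemma interp_circuit:
  assumes "is_circuit n gs"
  shows "\<exists>\<kappa>. \<kappa> \<noteq> 0 \<and> (\<forall>x y. length x = n \<longrightarrow> length y = n \<longrightarrow>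
    interp (circuit_diagram n gs) x y = (if y = fold gate_action gs x then \<kappa> * circuit_phase gs x else 0))"
  using assms
proof (induction gs)
  case Nil
  then show ?case
    by (intro exI[of _ 1]) auto
next
  case (Cons g gs)
  have g: "valid_gate n g" and gs: "is_circuit n gs"
    using Cons.prems by (auto simp: is_circuit_def)
  obtain \<kappa> where \<kappa>: "\<kappa> \<noteq> 0" "\<forall>x y. length x = n \<longrightarrow> length y = n \<longrightarrow>
    interp (circuit_diagram n gs) x y = (if y = fold gate_action gs x then \<kappa> * circuit_phase gs x else 0)"
    using Cons.IH[OF gs] by blast
  obtain \<mu> where \<mu>: "\<mu> \<noteq> 0" "\<And>x y. length x = n \<Longrightarrow> length y = n \<Longrightarrow>
    interp (gate_diagram n g) x y = (if y = gate_action g x then \<mu> * gate_phase g x else 0)"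
    using interp_gate[OF g] by blast
  have "interp (circuit_diagram n (g # gs)) x y =
      (if y = fold gate_action (g # gs) x then (\<mu> * \<kappa>) * circuit_phase (g # gs) x else 0)"
    if l: "length x = n" "length y = n" for x y
  proof -
    have "interp (circuit_diagram n (g # gs)) x y =
        (\<Sum>z | length z = n. interp (gate_diagram n g) x z * interp (circuit_diagram n gs) z y)"
      using gate_diagram_wf[OF g] by simp
    also have "\<dots> = (\<Sum>z | length z = n. (if z = gate_action g x then \<mu> * gate_phase g x else 0) *
        interp (circuit_diagram n gs) z y)"
      by (rule sum.cong) (use \<mu>(2) l in auto)
    also have "\<dots> = \<mu> * gate_phase g x * interp (circuit_diagram n gs) (gate_action g x) y"
      using l by (simp add: sum_bit_string_delta)
    finally show ?thesis
      using \<kappa>(2) l by simp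
  qed
  then show ?case
    using \<kappa>(1) \<mu>(1) by (intro exI[of _ "\<mu> * \<kappa>"]) simp
qed

section \<open>Parities and phase polynomials of the denoted map\<close>

definition support :: "bool list \<Rightarrow> nat set" where
  "support x = {i. i < length x \<and> x ! i}"

definition eval_parity :: "nat set \<Rightarrow> bool list \<Rightarrow> bool" where
  "eval_parity S x \<longleftrightarrow> odd (card (S \<inter> support x))"

definition phase_value :: "nat set list \<Rightarrow> bool list \<Rightarrow> int" where
  "phase_value A x = (\<Sum>S\<leftarrow>A. parity (S \<inter> support x))"

lemma finite_support [simp]: "finite (support x)"
  by (simp add: support_def)

lemma eval_parity_sym_diff: "eval_parity (sym_diff S T) x \<longleftrightarrow> eval_parity S x \<noteq> eval_parity T x"
proof -
  let ?A = "S \<inter> support x" and ?B = "T \<inter> support x"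
  have "sym_diff S T \<inter> support x = (?A - ?B) \<union> (?B - ?A)"
    by auto
  then have 1: "card (sym_diff S T \<inter> support x) = card (?A - ?B) + card (?B - ?A)"
    by (simp only:) (rule card_Un_disjoint, auto)
  have 2: "card ?A = card (?A \<inter> ?B) + card (?A - ?B)"
    by (rule card_Int_Diff) simp
  have 3: "card ?B = card (?A \<inter> ?B) + card (?B - ?A)"
    by (subst Int_commute) (rule card_Int_Diff, simp)
  show ?thesis
    unfolding eval_parity_def 1 2 3 by auto
qed

lemma phase_value_Cons:
  "cis (pi / 4 * phase_value (S # A) x) = (if eval_parity S x then cis (pi / 4) else 1) * cis (pi / 4 * phase_value A x)"
  by (simp add: phase_value_def eval_parity_def parity_def cis_mult odd_iff_mod_2_eq_one distrib_left)

text \<open>The invariant tying symbolic to concrete execution: a T gate reads the bit to which the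
  current parity evaluates, and symmetric difference evaluates to exclusive or.\<close>

lemma run_gate_sound:
  assumes "valid_gate n g" "length (snd s) = n"
  shows "map (\<lambda>S. eval_parity S x) (snd (run_gate g s)) = gate_action g (map (\<lambda>S. eval_parity S x) (snd s))"
    and "cis (pi / 4 * phase_value (fst (run_gate g s)) x) =
      gate_phase g (map (\<lambda>S. eval_parity S x) (snd s)) * cis (pi / 4 * phase_value (fst s) x)"
proof -
  have "map (\<lambda>S. eval_parity S x) (snd (run_gate g s)) = gate_action g (map (\<lambda>S. eval_parity S x) (snd s)) \<and>
    cis (pi / 4 * phase_value (fst (run_gate g s)) x) =
      gate_phase g (map (\<lambda>S. eval_parity S x) (snd s)) * cis (pi / 4 * phase_value (fst s) x)"
  proof (cases g)
    case (Tgate i)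
    then have "i < length (snd s)"
      using assms by simp
    then show ?thesis
      unfolding Tgate run_gate.simps fst_conv snd_conv phase_value_Cons by simp
  next
    case (CNOT i j)
    then have "i < length (snd s)" "j < length (snd s)"
      using assms by simp_all
    then show ?thesis
      unfolding CNOT run_gate.simps fst_conv snd_conv map_update eval_parity_sym_diff by simp
  qed
  then show "map (\<lambda>S. eval_parity S x) (snd (run_gate g s)) = gate_action g (map (\<lambda>S. eval_parity S x) (snd s))"
    and "cis (pi / 4 * phase_value (fst (run_gate g s)) x) =
      gate_phase g (map (\<lambda>S. eval_parity S x) (snd s)) * cis (pi / 4 * phase_value (fst s) x)"
    by simp_all
qed

lemma run_circuit_sound:
  assumes "is_circuit n gs" "length (snd s) = n"
  shows "map (\<lambda>S. eval_parity S x) (snd (fold run_gate gs s)) = fold gate_action gs (map (\<lambda>S. eval_parity S x) (snd s)) \<and>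
    cis (pi / 4 * phase_value (fst (fold run_gate gs s)) x) =
      circuit_phase gs (map (\<lambda>S. eval_parity S x) (snd s)) * cis (pi / 4 * phase_value (fst s) x)"
  using assms
proof (induction gs arbitrary: s)
  case (Cons g gs)
  then have g: "valid_gate n g" and gs: "is_circuit n gs"
    by (auto simp: is_circuit_def)
  have l: "length (snd (run_gate g s)) = n"
    using Cons.prems by simp
  show ?case
    using Cons.IH[OF gs l] run_gate_sound[OF g Cons.prems(2), of x] by simp
qed simp

lemma eval_parity_initial:
  assumes "length x = n"
  shows "map (\<lambda>S. eval_parity S x) (snd (initial n)) = x"
proof -
  have "eval_parity {i} x = x ! i" if "i < n" for i
    using that assms by (cases "x ! i") (auto simp: eval_parity_def support_def)
  then show ?thesis
    using assms by (intro nth_equalityI) (auto simp: initial_def)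
qed

lemma interp_circuit_parities:
  assumes "is_circuit n gs" "fold run_gate gs (initial n) = (A, ps)"
  obtains \<kappa> where "\<kappa> \<noteq> 0" "\<And>x y. length x = n \<Longrightarrow> length y = n \<Longrightarrow> interp (circuit_diagram n gs) x y =
    (if y = map (\<lambda>S. eval_parity S x) ps then \<kappa> * cis (pi / 4 * phase_value A x) else 0)"
proof -
  obtain \<kappa> where \<kappa>: "\<kappa> \<noteq> 0" "\<forall>x y. length x = n \<longrightarrow> length y = n \<longrightarrow>
    interp (circuit_diagram n gs) x y = (if y = fold gate_action gs x then \<kappa> * circuit_phase gs x else 0)"
    using interp_circuit[OF assms(1)] by blast
  have "fold gate_action gs x = map (\<lambda>S. eval_parity S x) ps \<and> circuit_phase gs x = cis (pi / 4 * phase_value A x)"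
    if "length x = n" for x
    using run_circuit_sound[OF assms(1), of "initial n" x] assms(2) eval_parity_initial[OF that]
    by (simp add: initial_def phase_value_def)
  with \<kappa> that show ?thesis
    by simp
qed

lemma run_gate_bounded:
  assumes "valid_gate n g" "length (snd s) = n" "\<forall>S \<in> set (fst s) \<union> set (snd s). S \<subseteq> {..<n}"
  shows "\<forall>S \<in> set (fst (run_gate g s)) \<union> set (snd (run_gate g s)). S \<subseteq> {..<n}"
proof (cases g)
  case (Tgate i)
  then have "snd s ! i \<in> set (snd s)"
    using assms by simp
  then show ?thesis
    using assms Tgate by auto
next
  case (CNOT i j)
  then have "snd s ! i \<in> set (snd s)" "snd s ! j \<in> set (snd s)"
    using assms by simp_all
  then have "sym_diff (snd s ! i) (snd s ! j) \<subseteq> {..<n}"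
    using assms(3) by blast
  then show ?thesis
    using assms(3) set_update_subset_insert[of "snd s" j "sym_diff (snd s ! i) (snd s ! j)"]
    unfolding CNOT run_gate.simps fst_conv snd_conv by blast
qed

lemma run_circuit_bounded:
  assumes "is_circuit n gs" "length (snd s) = n" "\<forall>S \<in> set (fst s) \<union> set (snd s). S \<subseteq> {..<n}"
  shows "length (snd (fold run_gate gs s)) = n \<and>
    (\<forall>S \<in> set (fst (fold run_gate gs s)) \<union> set (snd (fold run_gate gs s)). S \<subseteq> {..<n})"
  using assms
proof (induction gs arbitrary: s)
  case (Cons g gs)
  then have g: "valid_gate n g" and gs: "is_circuit n gs"
    by (auto simp: is_circuit_def)
  show ?case
    using Cons.IH[OF gs, of "run_gate g s"] run_gate_bounded[OF g Cons.prems(2,3)] Cons.prems(2) by simp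
qed simp

text \<open>Evaluation at the i-th unit vector decides membership of i.\<close>

lemma parity_functions_eq:
  assumes "S \<subseteq> {..<n}" "T \<subseteq> {..<n}" "\<And>x. length x = n \<Longrightarrow> eval_parity S x = eval_parity T x"
  shows "S = T"
proof -
  have "i \<in> S \<longleftrightarrow> i \<in> T" if "i < n" for i
  proof -
    let ?x = "map (\<lambda>k. k = i) [0..<n]"
    have "support ?x = {i}"
      using that by (auto simp: support_def)
    then have "eval_parity U ?x \<longleftrightarrow> i \<in> U" for U
      by (cases "i \<in> U") (auto simp: eval_parity_def)
    then show ?thesis
      using assms(3)[of ?x] by simp
  qed
  then show ?thesis
    using assms(1,2) by blast
qed

text \<open>exp(i pi/4) has order 8: angles differing by 2 pi k belong to exponents differing by 8
  k.\<close>

lemma phase_value_mod_8: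
  assumes "cis (pi / 4 * phase_value A x) = cis (pi / 4 * phase_value B x)"
  shows "phase_value A x mod 8 = phase_value B x mod 8"
proof -
  obtain k :: int where "pi / 4 * phase_value B x = pi / 4 * phase_value A x + of_int k * (2 * pi)"
    using assms unfolding cis_eq_iff rcong_altdef by blast
  then have "pi * (real_of_int (phase_value B x)) = pi * (real_of_int (phase_value A x + 8 * k))"
    by (simp add: algebra_simps)
  then have "real_of_int (phase_value B x) = real_of_int (phase_value A x + 8 * k)"
    by simp
  then have "phase_value B x = phase_value A x + 8 * k"
    by (simp only: of_int_eq_iff)
  then show ?thesis
    by simp
qed

theorem corollary3p6:
  fixes n :: nat and U V :: "gate list"
  assumes "is_circuit n U" and "is_circuit n V"
    and "proportional (circuit_diagram n U) (circuit_diagram n V)"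
  shows "transforms (\<lambda>D E. clifford_rule D E \<or> S4_rule D E)
    (circuit_diagram n U) (circuit_diagram n V)"
proof -
  obtain A ps where U: "fold run_gate U (initial n) = (A, ps)"
    by fastforce
  obtain B qs where V: "fold run_gate V (initial n) = (B, qs)"
    by fastforce
  obtain \<kappa> where \<kappa>: "\<kappa> \<noteq> 0" "\<And>x y. length x = n \<Longrightarrow> length y = n \<Longrightarrow> interp (circuit_diagram n U) x y =
    (if y = map (\<lambda>S. eval_parity S x) ps then \<kappa> * cis (pi / 4 * phase_value A x) else 0)"
    using interp_circuit_parities[OF assms(1) U] by blast
  obtain \<mu> where \<mu>: "\<mu> \<noteq> 0" "\<And>x y. length x = n \<Longrightarrow> length y = n \<Longrightarrow> interp (circuit_diagram n V) x y =
    (if y = map (\<lambda>S. eval_parity S x) qs then \<mu> * cis (pi / 4 * phase_value B x) else 0)"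
    using interp_circuit_parities[OF assms(2) V] by blast
  obtain c where c: "c \<noteq> 0" "\<And>x y. length x = n \<Longrightarrow> length y = n \<Longrightarrow>
    interp (circuit_diagram n U) x y = c * interp (circuit_diagram n V) x y"
    using assms(3) circuit_diagram_wf[OF assms(1)] by (auto simp: proportional_def)
  have init: "length (snd (initial n)) = n" "\<forall>S \<in> set (fst (initial n)) \<union> set (snd (initial n)). S \<subseteq> {..<n}"
    by (auto simp: initial_def)
  have bdU: "length ps = n" "\<forall>S \<in> set A \<union> set ps. S \<subseteq> {..<n}"
    using run_circuit_bounded[OF assms(1) init] U by auto
  have bdV: "length qs = n" "\<forall>S \<in> set B \<union> set qs. S \<subseteq> {..<n}"
    using run_circuit_bounded[OF assms(2) init] V by auto
  have eq: "map (\<lambda>S. eval_parity S x) ps = map (\<lambda>S. eval_parity S x) qs \<and>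
      \<kappa> * cis (pi / 4 * phase_value A x) = c * \<mu> * cis (pi / 4 * phase_value B x)"
    if x: "length x = n" for x
  proof -
    \<comment> \<open>At the image of x under U the left-hand side is nonzero, so V must have the
      same image there.\<close>
    let ?y = "map (\<lambda>S. eval_parity S x) ps"
    have "\<kappa> * cis (pi / 4 * phase_value A x) =
        c * (if ?y = map (\<lambda>S. eval_parity S x) qs then \<mu> * cis (pi / 4 * phase_value B x) else 0)"
      using \<kappa>(2)[of x ?y] \<mu>(2)[of x ?y] c(2)[of x ?y] x bdU(1) by simp
    moreover have "\<kappa> * cis (pi / 4 * phase_value A x) \<noteq> 0"
      using \<kappa>(1) by simp
    ultimately show ?thesis
      by (auto split: if_splits)
  qed
  have "ps = qs"
  proof (rule nth_equalityI)
    fix i assume i: "i < length ps"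
    show "ps ! i = qs ! i"
    proof (rule parity_functions_eq)
      show "ps ! i \<subseteq> {..<n}" "qs ! i \<subseteq> {..<n}"
        using i bdU bdV by auto
      show "eval_parity (ps ! i) x = eval_parity (qs ! i) x" if "length x = n" for x
        using eq[OF that] i bdU(1) bdV(1) by (metis nth_map)
    qed
  qed (use bdU bdV in simp)
  moreover have "phase n A = phase n B"
  proof (rule phase_eq)
    show "\<forall>S \<in> set A \<union> set B. S \<subseteq> {..<n}"
      using bdU bdV by auto
    fix Y :: "nat set"
    assume "finite Y"
    \<comment> \<open>The first input is the indicator of Y below n. On the all-zero input both
      phases are 1, so the scalars agree and can be cancelled on every other input.\<close>
    let ?x = "map (\<lambda>i. i \<in> Y) [0..<n]" and ?z = "replicate n False"
    have "support ?z = {}"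
      by (auto simp: support_def)
    then have "phase_value C ?z = 0" for C
      by (simp add: phase_value_def parity_def)
    then have "\<kappa> = c * \<mu>"
      using eq[of ?z] by simp
    then have "cis (pi / 4 * phase_value A ?x) = cis (pi / 4 * phase_value B ?x)"
      using eq[of ?x] \<kappa>(1) by simp
    then have "phase_value A ?x mod 8 = phase_value B ?x mod 8"
      by (rule phase_value_mod_8)
    moreover have "phase_value C ?x = (\<Sum>S\<leftarrow>C. parity (S \<inter> Y))" if "\<forall>S \<in> set C. S \<subseteq> {..<n}" for C
    proof -
      have "S \<inter> support ?x = S \<inter> Y" if "S \<in> set C" for S
      proof -
        have "S \<subseteq> {..<n}"
          using that \<open>\<forall>S \<in> set C. S \<subseteq> {..<n}\<close> by blast
        then show ?thesis
          by (auto simp: support_def subset_iff)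
      qed
      then show ?thesis
        unfolding phase_value_def by (intro arg_cong[of _ _ sum_list] map_cong) auto
    qed
    ultimately show "(\<Sum>S\<leftarrow>A. parity (S \<inter> Y)) mod 8 = (\<Sum>S\<leftarrow>B. parity (S \<inter> Y)) mod 8"
      using bdU(2) bdV(2) by simp
  qed
  ultimately have "cls (circuit_diagram n U) = cls (circuit_diagram n V)"
    using cls_circuit[OF assms(1)] cls_circuit[OF assms(2)] by (simp add: U V normal_form_def)
  then show ?thesis
    using circuit_diagram_wf[OF assms(1)] by (intro cls_transforms) auto
qed

end
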